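(* Let $(S,\mathcal S)$ be a metric space with its Borel $\sigma$-field, let $X=(X_n,n\in\mathbb T)$ be a bifurcating Markov chain on $S$ with initial distribution $\nu$ and $\mathbb T$-transition probability $P$, and let $\Pi$ be a uniform generation-preserving random permutation independent of $X$. Let $F$ be an admissible space of functions with limit probability $\mu$. Let $f:S^3\to\mathbb R$ be measurable and such that $Pf^2$ and $Pf^4$ exist and belong to $F$. Assume that $Pf=0$. Then $n^{-1/2}M_n^{\Pi}(f)$ converges in distribution, as $n\to\infty$, to the Gaussian law $\mathcal N(0,s^2)$, where $s^2=(\mu,Pf^2)=\int_S Pf^2\,d\mu$.
   Context: Tree. $\mathbb T=\mathbb N^*=\{1,2,\dots\}$ is the binary tree: vertex $n$ has two daughters $2n$ and $2n+1$, the root is $1$. $\mathbb G_q=\{2^q,\dots,2^{q+1}-1\}$ is the $q$th generation, $\mathbb T_r=\bigcup_{q=0}^r\mathbb G_q$, $r_n=\lfloor\log_2 n\rfloor$ is the generation of $n$. $\mathbb T$-transition probability. A map $P:S\times\mathcal S^2\to[0,1]$ ($\mathcal S^2$ the product $\sigma$-field on $S^2$) such that $P(\cdot,A)$ is measurable for all $A\in\mathcal S^2$ and $P(x,\cdot)$ is a probability on $(S^2,\mathcal S^2)$ for all $x\in S$. Put $P_0(x,B)=P(x,B\times S)$, $P_1(x,B)=P(x,S\times B)$, $Q=(P_0+P_1)/2$; $Q^r$ is the $r$th iterate of $Q$ and $Q^rf(x)=\int_S f(y)Q^r(x,dy)$. When defined, $Pf(x)=\int_{S^2}f(y,z)P(x,dy\,dz)$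 for measurable $f:S^2\to\mathbb R$, and $Pf(x)=\int_{S^2}f(x,y,z)P(x,dy\,dz)$ for measurable $f:S^3\to\mathbb R$. $Pf^k$ means $P(f^k)$. Bifurcating Markov chain. On a filtered probability space $(\Omega,\mathcal F,(\mathcal F_r)_{r\in\mathbb N},\mathbb P)$, a family $(X_n,n\in\mathbb T)$ of $S$-valued random variables is a bifurcating Markov chain with initial distribution $\nu$ and $\mathbb T$-transition probability $P$ if $X_n$ is $\mathcal F_{r_n}$-measurable for all $n$, $X_1$ has law $\nu$, and for all $q\in\mathbb N$ and all families $(f_n,n\in\mathbb G_q)$ of bounded measurable functions on $S^2$, $\mathbb E[\prod_{n\in\mathbb G_q}f_n(X_{2n},X_{2n+1})\mid\mathcal F_q]=\prod_{n\in\mathbb G_q}Pf_n(X_n)$. The default filtration is $\mathcal F_r=\sigma(X_i,i\in\mathbb T_r)$. Admissible space. Let $\mathcal B(S)$ be the set of measurable functions $S\to\mathbb R$, and $(f\otimes g)(y,z)=f(y)g(z)$. A linear subspace $F\subset\mathcal B(S)$ is called admissible with limit probability $\mu$ (relative to $P,\nu$) if: (i) $F$ contains the constants; (ii) $f^2\in F$ for all $f\in F$; (iii) for all $f,g\in F$, $f\otimes g\in L^1(P(x,\cdot))$ for all $x\in S$, and $P(f\otimes g)\in F$; (iv) $\mu$ is a probability on $(S,\mathcal S)$ with $F\subset L^1(\mu)$ and $\lim_{r\to\infty}Q^rf(x)=\int_S f\,d\mu$ for all $x\in S$ and $f\in F$; (v) for all $f\in F$ there is $g\in F$ such that $|Q^rf|\le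 g$ for all $r\in\mathbb N$; (vi) $F\subset L^1(\nu)$. (Conditions (i) and (iii) imply that $Q^rf$ is well defined for $f\in F$.) Random permutation. $\Pi$ is a random permutation of $\mathbb N^*$ leaving each $\mathbb G_q$ invariant, whose restrictions to the $\mathbb G_q$ are independent over $q$, each uniform among the $(2^q)!$ permutations of $\mathbb G_q$. Sums. $\Delta_i=(X_i,X_{2i},X_{2i+1})$ and, for measurable $f:S^3\to\mathbb R$, $M_n^\Pi(f)=\sum_{i=1}^n f(\Delta_{\Pi(i)})$. *)

theory Defs
  imports "HOL-Probability.Probability" "HOL-Library.Discrete_Functions"
begin

section \<open>The binary tree\<close>

text \<open>Vertices are the positive natural numbers. The generation of a vertex \<open>n\<close> is
  \<open>floor_log n\<close>, the integer part of the binary logarithm.\<close>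

definition generation :: "nat \<Rightarrow> nat set" where
  "generation q = {2 ^ q ..< 2 ^ Suc q}"


section \<open>Transition probabilities on the tree\<close>

text \<open>Membership in the measurable functions into \<open>prob_algebra\<close> says that every \<open>P x\<close> is a
  probability on the product sigma-field and that \<open>x \<mapsto> P(x, A)\<close> is measurable for every
  measurable \<open>A\<close>. The product sigma-field is used rather than the Borel sigma-field of the
  product space; the two may differ when the space is not separable.\<close>

definition tree_transition :: "('a::metric_space \<Rightarrow> ('a \<times> 'a) measure) \<Rightarrow> bool" where
  "tree_transition P \<longleftrightarrow> P \<in> borel \<rightarrow>\<^sub>M prob_algebra (borel \<Otimes>\<^sub>M borel)"

definition marg0 :: "('a::metric_space \<Rightarrow> ('a \<times> 'a) measure) \<Rightarrow> 'a \<Rightarrow> 'a measure" where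
  "marg0 P x = distr (P x) borel fst"

definition marg1 :: "('a::metric_space \<Rightarrow> ('a \<times> 'a) measure) \<Rightarrow> 'a \<Rightarrow> 'a measure" where
  "marg1 P x = distr (P x) borel snd"

definition mean_kernel :: "('a::metric_space \<Rightarrow> ('a \<times> 'a) measure) \<Rightarrow> 'a \<Rightarrow> 'a measure" where
  "mean_kernel P x =
     measure_of UNIV (sets borel) (\<lambda>B. (emeasure (marg0 P x) B + emeasure (marg1 P x) B) / 2)"

fun mean_kernel_iter ::
  "('a::metric_space \<Rightarrow> ('a \<times> 'a) measure) \<Rightarrow> nat \<Rightarrow> 'a \<Rightarrow> 'a measure" where
  "mean_kernel_iter P 0 x = return borel x"
| "mean_kernel_iter P (Suc r) x = mean_kernel_iter P r x \<bind> mean_kernel P"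

definition mean_op ::
  "('a::metric_space \<Rightarrow> ('a \<times> 'a) measure) \<Rightarrow> nat \<Rightarrow> ('a \<Rightarrow> real) \<Rightarrow> 'a \<Rightarrow> real" where
  "mean_op P r f x = (\<integral>y. f y \<partial>mean_kernel_iter P r x)"

text \<open>The action of the transition probability on functions of two variables and on functions
  of three variables, together with the corresponding statement that \<open>P f\<close> is defined.\<close>

definition trans_op2 ::
  "('a::metric_space \<Rightarrow> ('a \<times> 'a) measure) \<Rightarrow> ('a \<times> 'a \<Rightarrow> real) \<Rightarrow> 'a \<Rightarrow> real" where
  "trans_op2 P f x = (\<integral>z. f z \<partial>P x)"

definition trans_exists3 ::
  "('a::metric_space \<Rightarrow> ('a \<times> 'a) measure) \<Rightarrow> ('a \<times> 'a \<times> 'a \<Rightarrow> real) \<Rightarrow> bool" where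
  "trans_exists3 P f \<longleftrightarrow> (\<forall>x. integrable (P x) (\<lambda>(y, z). f (x, y, z)))"

definition trans_op3 ::
  "('a::metric_space \<Rightarrow> ('a \<times> 'a) measure) \<Rightarrow> ('a \<times> 'a \<times> 'a \<Rightarrow> real) \<Rightarrow> 'a \<Rightarrow> real" where
  "trans_op3 P f x = (\<integral>(y, z). f (x, y, z) \<partial>P x)"

lemma space_tree_transition:
  assumes "tree_transition P"
  shows "prob_space (P x)" "sets (P x) = sets (borel \<Otimes>\<^sub>M borel)"
  using measurable_space[OF assms[unfolded tree_transition_def], of x]
  by (auto simp: space_prob_algebra)

lemma sets_mean_kernel [simp, measurable_cong]: "sets (mean_kernel P x) = sets borel"
  unfolding mean_kernel_def by (metis sets.sets_measure_of_eq space_borel)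

lemma emeasure_mean_kernel:
  assumes B: "B \<in> sets borel"
  shows "emeasure (mean_kernel P x) B = (emeasure (marg0 P x) B + emeasure (marg1 P x) B) / 2"
proof (rule emeasure_measure_of[OF mean_kernel_def])
  show "sets borel \<subseteq> Pow (UNIV :: 'a set)" by simp
  show "B \<in> sets (mean_kernel P x)" using B by simp
  show "positive (sets (mean_kernel P x))
          (\<lambda>B. (emeasure (marg0 P x) B + emeasure (marg1 P x) B) / 2)"
    by (simp add: positive_def)
  show "countably_additive (sets (mean_kernel P x))
          (\<lambda>B. (emeasure (marg0 P x) B + emeasure (marg1 P x) B) / 2)"
  proof (rule countably_additiveI)
    fix A :: "nat \<Rightarrow> 'a set"
    assume A: "range A \<subseteq> sets (mean_kernel P x)" "disjoint_family A"
    have "(\<Sum>i. emeasure (marg0 P x) (A i)) = emeasure (marg0 P x) (\<Union>i. A i)"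
         "(\<Sum>i. emeasure (marg1 P x) (A i)) = emeasure (marg1 P x) (\<Union>i. A i)"
      using A by (auto intro!: suminf_emeasure simp: marg0_def marg1_def)
    then show "(\<Sum>i. (emeasure (marg0 P x) (A i) + emeasure (marg1 P x) (A i)) / 2) =
        (emeasure (marg0 P x) (\<Union>(range A)) + emeasure (marg1 P x) (\<Union>(range A))) / 2"
      by (simp add: divide_ennreal_def suminf_add[symmetric])
  qed
qed


section \<open>Bifurcating Markov chains\<close>

locale bifurcating_markov_chain = prob_space M + filtration "space M" F
  for M :: "'w measure" and F :: "nat \<Rightarrow> 'w measure" +
  fixes \<nu> :: "'a::metric_space measure"
    and P :: "'a \<Rightarrow> ('a \<times> 'a) measure"
    and X :: "nat \<Rightarrow> 'w \<Rightarrow> 'a"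
  assumes filtration_subalgebra: "\<And>r. subalgebra M (F r)"
    and transition: "tree_transition P"
    and adapted: "\<And>n. n \<ge> 1 \<Longrightarrow> X n \<in> F (floor_log n) \<rightarrow>\<^sub>M borel"
    and initial: "distr M borel (X 1) = \<nu>"
    and branching: "\<And>q (f :: nat \<Rightarrow> 'a \<times> 'a \<Rightarrow> real).
      (\<And>n. n \<in> generation q \<Longrightarrow>
         f n \<in> borel_measurable (borel \<Otimes>\<^sub>M borel) \<and> bounded (range (f n))) \<Longrightarrow>
      (AE \<omega> in M.
         real_cond_exp M (F q) (\<lambda>\<omega>. \<Prod>n\<in>generation q. f n (X (2 * n) \<omega>, X (2 * n + 1) \<omega>)) \<omega>
         = (\<Prod>n\<in>generation q. trans_op2 P (f n) (X n \<omega>)))"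


section \<open>Admissible spaces of functions\<close>

text \<open>The first three clauses say that \<open>H\<close> is a linear subspace of the space of
  measurable functions (it is nonempty by the fourth clause).\<close>

definition admissible ::
  "('a::metric_space \<Rightarrow> ('a \<times> 'a) measure) \<Rightarrow> 'a measure \<Rightarrow> 'a measure \<Rightarrow> ('a \<Rightarrow> real) set \<Rightarrow> bool"
where
  "admissible P \<nu> \<mu> H \<longleftrightarrow>
     H \<subseteq> borel_measurable borel \<and>
     (\<forall>f\<in>H. \<forall>g\<in>H. (\<lambda>x. f x + g x) \<in> H) \<and>
     (\<forall>f\<in>H. \<forall>c. (\<lambda>x. c * f x) \<in> H) \<and>
     (\<forall>c. (\<lambda>x. c) \<in> H) \<and>
     (\<forall>f\<in>H. (\<lambda>x. (f x)\<^sup>2) \<in> H) \<and>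
     (\<forall>f\<in>H. \<forall>g\<in>H. (\<forall>x. integrable (P x) (\<lambda>(y, z). f y * g z)) \<and>
        trans_op2 P (\<lambda>(y, z). f y * g z) \<in> H) \<and>
     prob_space \<mu> \<and> sets \<mu> = sets borel \<and>
     (\<forall>f\<in>H. integrable \<mu> f \<and> (\<forall>x. (\<lambda>r. mean_op P r f x) \<longlonglongrightarrow> (\<integral>y. f y \<partial>\<mu>))) \<and>
     (\<forall>f\<in>H. \<exists>g\<in>H. \<forall>r x. \<bar>mean_op P r f x\<bar> \<le> g x) \<and>
     (\<forall>f\<in>H. integrable \<nu> f)"


section \<open>Random permutations preserving the generations\<close>

text \<open>The restriction to a generation is extended by the identity, so that it ranges over
  the finite set \<open>{p. p permutes generation q}\<close>; the value of the random permutation at \<open>0\<close>,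
  which is not a vertex, is \<open>0\<close>.\<close>

definition restrict_generation :: "(nat \<Rightarrow> nat) \<Rightarrow> nat \<Rightarrow> nat \<Rightarrow> nat" where
  "restrict_generation p q = (\<lambda>n. if n \<in> generation q then p n else n)"

definition uniform_generation_permutation :: "'w measure \<Rightarrow> ('w \<Rightarrow> nat \<Rightarrow> nat) \<Rightarrow> bool" where
  "uniform_generation_permutation M \<pi> \<longleftrightarrow>
     (\<forall>\<omega>\<in>space M. \<pi> \<omega> permutes {1..} \<and> (\<forall>q. \<pi> \<omega> ` generation q = generation q)) \<and>
     prob_space.indep_vars M (\<lambda>q. count_space {p. p permutes generation q})
       (\<lambda>q \<omega>. restrict_generation (\<pi> \<omega>) q) UNIV \<and>
     (\<forall>q. distr M (count_space {p. p permutes generation q})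
            (\<lambda>\<omega>. restrict_generation (\<pi> \<omega>) q)
          = uniform_count_measure {p. p permutes generation q})"

text \<open>Independence of the chain and the permutation is stated through the generated
  sigma-fields, since \<open>indep_var\<close> only relates variables with values in the same type.\<close>

definition independent_of_chain ::
  "'w measure \<Rightarrow> (nat \<Rightarrow> 'w \<Rightarrow> 'a::metric_space) \<Rightarrow> ('w \<Rightarrow> nat \<Rightarrow> nat) \<Rightarrow> bool" where
  "independent_of_chain M X \<pi> \<longleftrightarrow>
     prob_space.indep_set M
       (sets (vimage_algebra (space M) (\<lambda>\<omega>. \<lambda>n\<in>{1..}. X n \<omega>) (PiM {1..} (\<lambda>_. borel))))
       (sets (vimage_algebra (space M) (\<lambda>\<omega>. \<lambda>n\<in>{1..}. \<pi> \<omega> n) (PiM {1..} (\<lambda>_. count_space UNIV))))"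


section \<open>Sums over the tree and the limit law\<close>

definition triangle :: "(nat \<Rightarrow> 'w \<Rightarrow> 'a) \<Rightarrow> nat \<Rightarrow> 'w \<Rightarrow> 'a \<times> 'a \<times> 'a" where
  "triangle X i \<omega> = (X i \<omega>, X (2 * i) \<omega>, X (2 * i + 1) \<omega>)"

definition perm_sum ::
  "(nat \<Rightarrow> 'w \<Rightarrow> 'a) \<Rightarrow> ('w \<Rightarrow> nat \<Rightarrow> nat) \<Rightarrow> ('a \<times> 'a \<times> 'a \<Rightarrow> real) \<Rightarrow> nat \<Rightarrow> 'w \<Rightarrow> real" where
  "perm_sum X \<pi> f n \<omega> = (\<Sum>i=1..n. f (triangle X (\<pi> \<omega> i) \<omega>))"

text \<open>The Gaussian law with given mean and variance; it is a Dirac mass when the variance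
  is zero, a case in which \<open>normal_density\<close> is not a probability density.\<close>

definition gaussian_law :: "real \<Rightarrow> real \<Rightarrow> real measure" where
  "gaussian_law m v =
     (if v = 0 then return borel m else density lborel (normal_density m (sqrt v)))"

end

theory Submission
  imports Defs
begin

text \<open>By Levy's continuity theorem it suffices to find the limit of the characteristic functions.
  Independence of the chain and the permutation turns the characteristic function of
  the sum up to \<open>n\<close> into an average, over the permutations \<open>p\<close> of the last generation \<open>q\<close>, of
  characteristic functions of deterministic sums, running over all earlier generations and over
  \<open>p {2\<^sup>q..n}\<close>. Given the chain up to generation \<open>r\<close>, the triangles rooted in generation \<open>r\<close> are
  independent and centred, so up to a third-order error the phase of a set \<open>K\<close> of such triangles may
  be replaced by \<open>exp (- u\<^sup>2 / 2 \<Sum>\<^sub>K Pf\<^sup>2(X\<^sub>j))\<close>, and then by the constant \<open>exp (- u\<^sup>2 |K| s\<^sup>2 / 2)\<close> at the cost of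
  the \<open>L\<^sup>1\<close> norm of \<open>\<Sum>\<^sub>K (Pf\<^sup>2(X\<^sub>j) - s\<^sup>2)\<close>; the generations are removed one after the other in this way.
  For full generations the \<open>L\<^sup>1\<close> norms are controlled by an \<open>L\<^sup>2\<close> law of large numbers. For the last
  generation they are controlled on average only: a uniform sample has a second moment no larger
  than the squared sum plus the sum of squares over the whole generation. A deterministic
  sample could be concentrated on a subtree, where the law of large numbers fails.\<close>

section \<open>Generations and conditional independence\<close>

text \<open>Functions in an admissible space may be unbounded, and the space is closed under squares
  and tensor averages but not known to be closed under absolute values. Every dominating function is
  therefore built from squares. Third moments go through \<open>|y|^3 \<le> y^2 + y^4\<close>, which
  is where \<open>Pf^4\<close> enters. The branching property speaks of bounded real functions of
  the children alone. It is strengthened to a description of the joint law of past and children,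
  because a triangle contains its root and the earlier generations enter as a complex weight.
  Conditional characteristic functions are compared with exponentials and not with quadratic
  polynomials: a product of exponentials over \<open>K\<close> depends on the chain through a single
  sum, which a law of large numbers can control. All factors lie in the closed unit disc, so the
  errors of successive replacements add up. With \<open>u = t n^(-1/2)\<close>, the \<open>n\<close>
  remainders of order \<open>|u|^3\<close> total \<open>n^(-1/2)\<close>, while the deviations of
  the variance sums are multiplied by \<open>u^2\<close>, that is, divided by
  \<open>n\<close>.\<close>

lemma finite_generation [simp]: "finite (generation q)"
  by (simp add: generation_def)

lemma card_generation [simp]: "card (generation q) = 2 ^ q"
  by (simp add: generation_def)

lemma generation_ge_1: "i \<in> generation q \<Longrightarrow> 1 \<le> i"
  unfolding generation_def by (metis atLeastLessThan_iff dual_order.trans one_le_numeral one_le_power)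

lemma floor_log_generation: "i \<in> generation q \<Longrightarrow> floor_log i = q"
  unfolding generation_def by (intro floor_log_eqI) (auto intro: Nat.gr0I)

lemma generation_Suc: "generation (Suc q) = (\<lambda>i. 2 * i) ` generation q \<union> (\<lambda>i. 2 * i + 1) ` generation q"
proof -
  have "j \<in> (\<lambda>i. 2 * i) ` {2 ^ q..<2 ^ Suc q} \<union> (\<lambda>i. 2 * i + 1) ` {2 ^ q..<2 ^ Suc q}"
    if "2 ^ Suc q \<le> j" "j < 2 ^ Suc (Suc q)" for j :: nat
  proof (cases "even j")
    case True
    then show ?thesis using that by (auto elim!: evenE)
  next
    case False
    then show ?thesis using that by (auto elim!: oddE)
  qed
  then show ?thesis unfolding generation_def
    by (intro equalityI subsetI) (simp, fastforce)
qed

lemma sum_generation_Suc: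
  fixes g :: "nat \<Rightarrow> 'b::comm_monoid_add"
  shows "(\<Sum>j\<in>generation (Suc q). g j) = (\<Sum>i\<in>generation q. g (2 * i) + g (2 * i + 1))"
proof -
  have "(\<Sum>j\<in>generation (Suc q). g j) =
      (\<Sum>j\<in>(\<lambda>i. 2 * i) ` generation q. g j) + (\<Sum>j\<in>(\<lambda>i. 2 * i + 1) ` generation q. g j)"
    unfolding generation_Suc by (rule sum.union_disjoint) (auto, presburger)
  also have "\<dots> = (\<Sum>i\<in>generation q. g (2 * i)) + (\<Sum>i\<in>generation q. g (2 * i + 1))"
    by (simp add: sum.reindex inj_on_def)
  finally show ?thesis by (simp add: sum.distrib)
qed

lemma lessThan_power_Suc: "{1..<2 ^ Suc q} = {1..<2 ^ q} \<union> generation q"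
  and disjoint_power_generation: "{1..<2 ^ q} \<inter> generation q = {}"
  unfolding generation_def
  by (auto simp: not_le intro: Suc_leI less_le_trans[of 0 "2 ^ q"])

section \<open>Product kernels over a finite set of vertices\<close>

context
  fixes P :: "'a::metric_space \<Rightarrow> ('a \<times> 'a) measure"
  assumes transition: "tree_transition P"
begin

lemma measurable_transition: "P \<in> borel \<rightarrow>\<^sub>M subprob_algebra (borel \<Otimes>\<^sub>M borel)"
  using transition unfolding tree_transition_def by (rule measurable_prob_algebraD)

text \<open>Rectangles form an intersection-stable generator of the product sigma-field, and the
  mass of a rectangle is a finite product of measurable functions of \<omega>. With \<open>X\<close>
  the vertices of one generation, this kernel will be the conditional law of their children.\<close>

lemma measurable_PiM_transition:
  assumes "finite I" and X: "\<And>i. i \<in> I \<Longrightarrow> X i \<in> N \<rightarrow>\<^sub>M borel"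
  shows "(\<lambda>\<omega>. PiM I (\<lambda>i. P (X i \<omega>))) \<in> N \<rightarrow>\<^sub>M prob_algebra (PiM I (\<lambda>_. borel \<Otimes>\<^sub>M borel))"
proof (rule measurable_prob_algebra_generated[OF sets_PiM Int_stable_prod_algebra prod_algebra_sets_into_space])
  fix \<omega> assume "\<omega> \<in> space N"
  interpret prob_space "P x" for x by (rule space_tree_transition[OF transition])
  show "prob_space (PiM I (\<lambda>i. P (X i \<omega>)))"
    by (intro prob_space_PiM) unfold_locales
  show "sets (PiM I (\<lambda>i. P (X i \<omega>))) = sets (PiM I (\<lambda>_. borel \<Otimes>\<^sub>M borel))"
    by (intro sets_PiM_cong refl space_tree_transition[OF transition])
next
  fix A :: "('b \<Rightarrow> 'a \<times> 'a) set" assume "A \<in> prod_algebra I (\<lambda>_. borel \<Otimes>\<^sub>M borel)"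
  then obtain B where A: "A = Pi\<^sub>E I B" and B: "\<And>i. i \<in> I \<Longrightarrow> B i \<in> sets (borel \<Otimes>\<^sub>M borel)"
    by (rule prod_algebraE_all) auto
  interpret prob_space "P x" for x by (rule space_tree_transition[OF transition])
  have "emeasure (PiM I (\<lambda>i. P (X i \<omega>))) A = (\<Prod>i\<in>I. emeasure (P (X i \<omega>)) (B i))" for \<omega>
  proof -
    interpret product_sigma_finite "\<lambda>i. P (X i \<omega>)" by unfold_locales
    show ?thesis unfolding A
      by (rule emeasure_PiM) (auto simp: \<open>finite I\<close> B space_tree_transition[OF transition])
  qed
  moreover have "(\<lambda>\<omega>. emeasure (P (X i \<omega>)) (B i)) \<in> borel_measurable N" if "i \<in> I" for i
    using measurable_compose[OF X[OF that] measurable_compose[OF measurable_transition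
        measurable_emeasure_subprob_algebra[OF B[OF that]]]] .
  ultimately show "(\<lambda>\<omega>. emeasure (PiM I (\<lambda>i. P (X i \<omega>))) A) \<in> borel_measurable N"
    by simp
qed

end

section \<open>The conditional law of a generation of children given the past\<close>

context bifurcating_markov_chain
begin

sublocale transition: prob_space "P x" for x
  by (rule space_tree_transition[OF transition])

lemma sets_transition [simp, measurable_cong]: "sets (P x) = sets (borel \<Otimes>\<^sub>M borel)"
  by (rule space_tree_transition[OF transition])

lemma space_transition [simp]: "space (P x) = UNIV"
  using sets_eq_imp_space_eq[OF sets_transition, of x] by (simp add: space_pair_measure)

lemma measure_transition_UNIV [simp]: "measure (P x) UNIV = 1"
  using transition.prob_space[of x] by simp

abbreviation children :: "nat \<Rightarrow> 'w \<Rightarrow> 'a \<times> 'a" where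
  "children i \<omega> \<equiv> (X (2 * i) \<omega>, X (2 * i + 1) \<omega>)"

lemma measurable_vertex_filtration:
  assumes "1 \<le> i" "floor_log i \<le> r" shows "X i \<in> F r \<rightarrow>\<^sub>M borel"
proof (rule measurable_from_subalg[OF _ adapted[OF assms(1)]])
  show "subalgebra (F r) (F (floor_log i))"
    unfolding subalgebra_def using sets_F_mono[OF assms(2)] by (auto simp: space_F)
qed

lemma measurable_vertex: "1 \<le> i \<Longrightarrow> X i \<in> M \<rightarrow>\<^sub>M borel"
  by (rule measurable_from_subalg[OF filtration_subalgebra adapted])

lemma measurable_children: "1 \<le> i \<Longrightarrow> children i \<in> M \<rightarrow>\<^sub>M borel \<Otimes>\<^sub>M borel"
  by (intro measurable_Pair measurable_vertex) auto

lemma sigma_finite_subalgebra_filtration: "sigma_finite_subalgebra M (F r)"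
  by (intro finite_measure_subalgebra_is_sigma_finite finite_measure_subalgebra.intro
        finite_measure_subalgebra_axioms.intro filtration_subalgebra) unfold_locales

text \<open>Both sides are finite measures and agree on products of an event of \<open>F r\<close>
  with a rectangle, where equality is the branching property for indicators. Keeping \<omega> itself
  as a coordinate lets a test function combine the children with anything known at time
  \<open>r\<close>, in particular with the roots of the triangles.\<close>

lemma joint_law:
  fixes r
  defines "I \<equiv> generation r"
  defines "N \<equiv> PiM I (\<lambda>_. borel \<Otimes>\<^sub>M borel) :: (nat \<Rightarrow> 'a \<times> 'a) measure"
  shows "distr M (F r \<Otimes>\<^sub>M N) (\<lambda>\<omega>. (\<omega>, \<lambda>i\<in>I. children i \<omega>)) =
    restr_to_subalg M (F r) \<bind> (\<lambda>\<omega>. distr (PiM I (\<lambda>i. P (X i \<omega>))) (F r \<Otimes>\<^sub>M N) (Pair \<omega>))"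
    and "(\<lambda>\<omega>. distr (PiM I (\<lambda>i. P (X i \<omega>))) (F r \<Otimes>\<^sub>M N) (Pair \<omega>)) \<in> F r \<rightarrow>\<^sub>M prob_algebra (F r \<Otimes>\<^sub>M N)"
    and "(\<lambda>\<omega>. (\<omega>, \<lambda>i\<in>I. children i \<omega>)) \<in> M \<rightarrow>\<^sub>M F r \<Otimes>\<^sub>M N"
proof -
  interpret sub: sigma_finite_subalgebra M "F r" by (rule sigma_finite_subalgebra_filtration)
  let ?K = "\<lambda>\<omega>. distr (PiM I (\<lambda>i. P (X i \<omega>))) (F r \<Otimes>\<^sub>M N) (Pair \<omega>)"
  have I: "finite I" "\<And>i. i \<in> I \<Longrightarrow> 1 \<le> i" "\<And>i. i \<in> I \<Longrightarrow> floor_log i = r"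
    by (auto simp: I_def floor_log_generation dest: generation_ge_1)
  have XF: "X i \<in> F r \<rightarrow>\<^sub>M borel" if "i \<in> I" for i
    using I that by (intro measurable_vertex_filtration) auto
  have \<kappa>: "(\<lambda>\<omega>. PiM I (\<lambda>i. P (X i \<omega>))) \<in> F r \<rightarrow>\<^sub>M prob_algebra N"
    unfolding N_def by (intro measurable_PiM_transition transition I(1) XF)
  show K: "?K \<in> F r \<rightarrow>\<^sub>M prob_algebra (F r \<Otimes>\<^sub>M N)"
    by (rule measurable_distr_prob_space2[OF \<kappa>]) simp
  have [measurable]: "(\<lambda>\<omega>. \<omega>) \<in> M \<rightarrow>\<^sub>M F r"
    using filtration_subalgebra[of r] by (auto simp: measurable_def subalgebra_def)
  have [measurable]: "children i \<in> M \<rightarrow>\<^sub>M borel \<Otimes>\<^sub>M borel" if "i \<in> I" for i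
    by (rule measurable_children[OF I(2)[OF that]])
  show meas: "(\<lambda>\<omega>. (\<omega>, \<lambda>i\<in>I. children i \<omega>)) \<in> M \<rightarrow>\<^sub>M F r \<Otimes>\<^sub>M N"
    unfolding N_def by (intro measurable_Pair measurable_restrict) measurable
  let ?G = "{a \<times> b | a b. a \<in> sets (F r) \<and> b \<in> prod_algebra I (\<lambda>_. borel \<Otimes>\<^sub>M borel :: ('a \<times> 'a) measure)}"
  have spN: "space N = (\<Pi>\<^sub>E i\<in>I. UNIV)" by (simp add: N_def space_PiM space_pair_measure)
  have top: "space N \<in> prod_algebra I (\<lambda>_. borel \<Otimes>\<^sub>M borel)"
    unfolding spN using sets.top[of "borel \<Otimes>\<^sub>M borel :: ('a \<times> 'a) measure"]
    by (intro prod_algebraI_finite I) (simp add: space_pair_measure)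
  have sub_pow: "?G \<subseteq> Pow (space (F r) \<times> space N)"
  proof safe
    fix a x y and b :: "(nat \<Rightarrow> 'a \<times> 'a) set"
    assume "a \<in> sets (F r)" "x \<in> a" and b: "b \<in> prod_algebra I (\<lambda>_. borel \<Otimes>\<^sub>M borel)" "y \<in> b"
    then show "x \<in> space (F r)" using sets.sets_into_space by blast
    show "y \<in> space N"
      using b prod_algebra_sets_into_space[of I "\<lambda>_. borel \<Otimes>\<^sub>M borel :: ('a \<times> 'a) measure"]
      unfolding N_def space_PiM by blast
  qed
  have gen: "sets (F r \<Otimes>\<^sub>M N) = sigma_sets (space (F r) \<times> space N) ?G"
  proof -
    have "sets (F r \<Otimes>\<^sub>M N) = sets (sigma (space (F r) \<times> space N) ?G)"
    proof (rule sets_pair_eq[where Ca="{space (F r)}" and Cb="{space N}"])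
      show "sets (F r) = sigma_sets (space (F r)) (sets (F r))" by (simp add: sets.sigma_sets_eq)
      show "sets N = sigma_sets (space N) (prod_algebra I (\<lambda>_. borel \<Otimes>\<^sub>M borel))"
        unfolding N_def by (simp add: sets_PiM space_PiM)
      show "prod_algebra I (\<lambda>_. borel \<Otimes>\<^sub>M borel) \<subseteq> Pow (space N)"
        unfolding N_def space_PiM by (rule prod_algebra_sets_into_space)
    qed (use top sets.space_closed in auto)
    then show ?thesis
      using sub_pow by (subst (asm) sets_measure_of)
  qed
  have ne: "space (restr_to_subalg M (F r)) \<noteq> {}"
    by (simp add: space_restr_to_subalg not_empty)
  have K': "?K \<in> restr_to_subalg M (F r) \<rightarrow>\<^sub>M subprob_algebra (F r \<Otimes>\<^sub>M N)"
    using measurable_prob_algebraD[OF K] measurable_cong_sets[OF sets_restr_to_subalg[OF filtration_subalgebra] refl]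
    by blast
  show "distr M (F r \<Otimes>\<^sub>M N) (\<lambda>\<omega>. (\<omega>, \<lambda>i\<in>I. children i \<omega>)) = restr_to_subalg M (F r) \<bind> ?K"
  proof (rule measure_eqI_generator_eq[where E="?G" and A="\<lambda>_. space (F r) \<times> space N"])
    show "Int_stable ?G"
    proof (rule Int_stableI, safe)
      fix a a' and b b' :: "(nat \<Rightarrow> 'a \<times> 'a) set"
      assume "a \<in> sets (F r)" "a' \<in> sets (F r)" "b \<in> prod_algebra I (\<lambda>_. borel \<Otimes>\<^sub>M borel)" "b' \<in> prod_algebra I (\<lambda>_. borel \<Otimes>\<^sub>M borel)"
      then show "\<exists>c d. a \<times> b \<inter> a' \<times> b' = c \<times> d \<and> c \<in> sets (F r) \<and> d \<in> prod_algebra I (\<lambda>_. borel \<Otimes>\<^sub>M borel)"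
        using Int_stable_prod_algebra[of I "\<lambda>_. borel \<Otimes>\<^sub>M borel :: ('a \<times> 'a) measure"]
        by (intro exI[of _ "a \<inter> a'"] exI[of _ "b \<inter> b'"]) (auto simp: Int_stable_def)
    qed
    show "?G \<subseteq> Pow (space (F r) \<times> space N)"
      by (rule sub_pow)
    show "sets (distr M (F r \<Otimes>\<^sub>M N) (\<lambda>\<omega>. (\<omega>, \<lambda>i\<in>I. children i \<omega>))) = sigma_sets (space (F r) \<times> space N) ?G"
      by (simp only: sets_distr gen)
    show "sets (restr_to_subalg M (F r) \<bind> ?K) = sigma_sets (space (F r) \<times> space N) ?G"
      using sets_bind[OF _ ne, of ?K "F r \<Otimes>\<^sub>M N"] gen by simp
    show "range (\<lambda>_. space (F r) \<times> space N) \<subseteq> ?G" using top by auto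
    show "emeasure (distr M (F r \<Otimes>\<^sub>M N) (\<lambda>\<omega>. (\<omega>, \<lambda>i\<in>I. children i \<omega>))) (space (F r) \<times> space N) \<noteq> \<infinity>"
      using prob_space.emeasure_le_1[OF prob_space_distr[OF meas], of "space (F r) \<times> space N"]
      by (auto simp: top_unique)
  next
    fix C assume "C \<in> ?G"
    then obtain a b where C: "C = a \<times> b" and a [measurable]: "a \<in> sets (F r)"
      and "b \<in> prod_algebra I (\<lambda>_. borel \<Otimes>\<^sub>M borel :: ('a \<times> 'a) measure)" by blast
    then obtain B where b: "b = Pi\<^sub>E I B" and B [measurable]: "\<And>i. i \<in> I \<Longrightarrow> B i \<in> sets (borel \<Otimes>\<^sub>M borel)"
      by (auto elim!: prod_algebraE_all)
    have aM [measurable]: "a \<in> sets M" using a filtration_subalgebra[of r] by (auto simp: subalgebra_def)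
    have asub: "a \<subseteq> space M" using sets.sets_into_space[OF aM] .
    have Cm: "C \<in> sets (F r \<Otimes>\<^sub>M N)"
      unfolding C b N_def by (intro pair_measureI a sets_PiM_I_finite I B)
    \<comment> \<open>The value 0 off \<open>I\<close> is a dummy that makes measurability and
      boundedness hold for every index; only the factors in \<open>I\<close> enter the
      products.\<close>
    let ?f = "\<lambda>i. if i \<in> I then indicator (B i) else (\<lambda>_. 0 :: real)"
    have f: "?f i \<in> borel_measurable (borel \<Otimes>\<^sub>M borel)" for i
      by auto
    have bd: "bounded (range (?f i))" for i
      by (rule boundedI[of _ 1]) (auto simp: indicator_def)
    have tr: "trans_op2 P (?f i) x = measure (P x) (B i)" if "i \<in> I" for i x
      unfolding trans_op2_def using that B[OF that] by simp
    have ae: "AE \<omega> in M. real_cond_exp M (F r) (\<lambda>\<omega>. \<Prod>i\<in>I. ?f i (children i \<omega>)) \<omega>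
         = (\<Prod>i\<in>I. measure (P (X i \<omega>)) (B i))"
    proof -
      have "AE \<omega> in M. real_cond_exp M (F r) (\<lambda>\<omega>. \<Prod>i\<in>generation r. ?f i (children i \<omega>)) \<omega>
         = (\<Prod>i\<in>generation r. trans_op2 P (?f i) (X i \<omega>))"
        by (rule branching) (use f bd in blast)
      moreover have "(\<Prod>i\<in>generation r. trans_op2 P (?f i) (X i \<omega>)) = (\<Prod>i\<in>I. measure (P (X i \<omega>)) (B i))" for \<omega>
        unfolding I_def[symmetric] by (intro prod.cong refl tr)
      ultimately show ?thesis unfolding I_def[symmetric] by simp
    qed
    have pm: "(\<lambda>\<omega>. \<Prod>i\<in>I. ?f i (children i \<omega>)) \<in> borel_measurable M"
      by (intro borel_measurable_prod measurable_compose[OF measurable_children f] I(2))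
    have pb: "\<bar>\<Prod>i\<in>I. ?f i (children i \<omega>)\<bar> \<le> 1" for \<omega>
      unfolding abs_prod by (intro prod_le_1) (auto simp: indicator_def)
    have int: "integrable M (\<lambda>\<omega>. indicator a \<omega> * (\<Prod>i\<in>I. ?f i (children i \<omega>)))"
      using pm pb
      by (intro integrable_const_bound[of _ 1]) (auto simp: abs_mult indicator_def)
    have km: "(\<lambda>\<omega>. emeasure (P (X i \<omega>)) (B i)) \<in> borel_measurable (F r)" if "i \<in> I" for i
      using measurable_compose[OF XF[OF that] measurable_compose[OF measurable_transition[OF transition]
          measurable_emeasure_subprob_algebra[OF B[OF that]]]] .
    have km': "(\<lambda>\<omega>. emeasure (P (X i \<omega>)) (B i)) \<in> borel_measurable M" if "i \<in> I" for i
      by (rule measurable_from_subalg[OF filtration_subalgebra km[OF that]])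
    have km'': "(\<lambda>\<omega>. measure (P (X i \<omega>)) (B i)) \<in> borel_measurable M" if "i \<in> I" for i
      unfolding measure_def using km'[OF that] by measurable
    have "emeasure (distr M (F r \<Otimes>\<^sub>M N) (\<lambda>\<omega>. (\<omega>, \<lambda>i\<in>I. children i \<omega>))) C =
        emeasure M {\<omega> \<in> space M. \<omega> \<in> a \<and> (\<forall>i\<in>I. children i \<omega> \<in> B i)}"
      by (subst emeasure_distr[OF meas Cm], rule arg_cong[where f="emeasure M"]) (auto simp: C b)
    also have "\<dots> = (\<integral>\<^sup>+\<omega>. ennreal (indicator a \<omega> * (\<Prod>i\<in>I. ?f i (children i \<omega>))) \<partial>M)"
    proof -
      have "{\<omega> \<in> space M. \<omega> \<in> a \<and> (\<forall>i\<in>I. children i \<omega> \<in> B i)} \<in> sets M"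
        using I(1) by measurable
      moreover have "ennreal (indicator a \<omega> * (\<Prod>i\<in>I. ?f i (children i \<omega>))) =
          indicator {\<omega> \<in> space M. \<omega> \<in> a \<and> (\<forall>i\<in>I. children i \<omega> \<in> B i)} \<omega>" if "\<omega> \<in> space M" for \<omega>
      proof (cases "\<forall>i\<in>I. children i \<omega> \<in> B i")
        case True
        then show ?thesis using that by (auto simp: indicator_def)
      next
        case False
        then have "(\<Prod>i\<in>I. ?f i (children i \<omega>)) = 0"
          using I(1) by (auto simp: prod_zero_iff intro!: bexI)
        then show ?thesis using False by (auto simp: indicator_def)
      qed
      ultimately show ?thesis by (simp cong: nn_integral_cong)
    qed
    also have "\<dots> = ennreal (\<integral>\<omega>. indicator a \<omega> * (\<Prod>i\<in>I. ?f i (children i \<omega>)) \<partial>M)"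
      by (rule nn_integral_eq_integral[OF int]) (auto intro!: mult_nonneg_nonneg prod_nonneg)
    \<comment> \<open>The indicator of \<open>a\<close> is measurable for \<open>F r\<close>, so
      conditioning the remaining factor on \<open>F r\<close> leaves the integral unchanged.\<close>
    also have "(\<integral>\<omega>. indicator a \<omega> * (\<Prod>i\<in>I. ?f i (children i \<omega>)) \<partial>M) =
        (\<integral>\<omega>. indicator a \<omega> * real_cond_exp M (F r) (\<lambda>\<omega>. \<Prod>i\<in>I. ?f i (children i \<omega>)) \<omega> \<partial>M)"
      by (rule sub.real_cond_exp_intg(2)[symmetric, OF int _ pm]) measurable
    also have "\<dots> = (\<integral>\<omega>. indicator a \<omega> * (\<Prod>i\<in>I. measure (P (X i \<omega>)) (B i)) \<partial>M)"
      using ae km'' by (intro integral_cong_AE) auto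
    also have "ennreal \<dots> = (\<integral>\<^sup>+\<omega>. ennreal (indicator a \<omega> * (\<Prod>i\<in>I. measure (P (X i \<omega>)) (B i))) \<partial>M)"
    proof (rule nn_integral_eq_integral[symmetric])
      have "\<bar>indicator a \<omega> * (\<Prod>i\<in>I. measure (P (X i \<omega>)) (B i))\<bar> \<le> 1" for \<omega>
      proof -
        have "\<bar>\<Prod>i\<in>I. measure (P (X i \<omega>)) (B i)\<bar> \<le> 1"
          unfolding abs_prod by (intro prod_le_1) auto
        then show ?thesis by (auto simp: indicator_def)
      qed
      then show "integrable M (\<lambda>\<omega>. indicator a \<omega> * (\<Prod>i\<in>I. measure (P (X i \<omega>)) (B i)))"
        using km'' by (intro integrable_const_bound[of _ 1]) auto
    qed (auto intro!: mult_nonneg_nonneg prod_nonneg)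
    also have "\<dots> = (\<integral>\<^sup>+\<omega>. indicator a \<omega> * (\<Prod>i\<in>I. emeasure (P (X i \<omega>)) (B i)) \<partial>M)"
      by (intro nn_integral_cong)
        (auto simp: ennreal_mult prod_nonneg prod_ennreal transition.emeasure_eq_measure indicator_def)
    also have "\<dots> = (\<integral>\<^sup>+\<omega>. indicator a \<omega> * (\<Prod>i\<in>I. emeasure (P (X i \<omega>)) (B i)) \<partial>restr_to_subalg M (F r))"
      using km by (intro nn_integral_subalgebra2[symmetric] filtration_subalgebra) auto
    also have "\<dots> = (\<integral>\<^sup>+\<omega>. emeasure (?K \<omega>) C \<partial>restr_to_subalg M (F r))"
    proof (rule nn_integral_cong)
      fix \<omega> assume "\<omega> \<in> space (restr_to_subalg M (F r))"
      then have \<omega>: "\<omega> \<in> space (F r)" by (simp add: space_restr_to_subalg space_F)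
      interpret product_sigma_finite "\<lambda>i. P (X i \<omega>)" by unfold_locales
      have sN: "sets (PiM I (\<lambda>i. P (X i \<omega>))) = sets N"
        unfolding N_def by (intro sets_PiM_cong) auto
      have spN': "space (PiM I (\<lambda>i. P (X i \<omega>))) = space N"
        by (rule sets_eq_imp_space_eq[OF sN])
      have pm': "Pair \<omega> \<in> PiM I (\<lambda>i. P (X i \<omega>)) \<rightarrow>\<^sub>M F r \<Otimes>\<^sub>M N"
        using measurable_Pair1'[OF \<omega>, of N] measurable_cong_sets[OF sN refl] by blast
      have "b \<subseteq> space N" by (auto simp: b spN)
      then have "Pair \<omega> -` C \<inter> space (PiM I (\<lambda>i. P (X i \<omega>))) = (if \<omega> \<in> a then Pi\<^sub>E I B else {})"
        unfolding C spN' by (auto simp: b)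
      then have "emeasure (?K \<omega>) C = emeasure (PiM I (\<lambda>i. P (X i \<omega>))) (if \<omega> \<in> a then Pi\<^sub>E I B else {})"
        by (subst emeasure_distr[OF pm' Cm]) simp
      also have "\<dots> = indicator a \<omega> * (\<Prod>i\<in>I. emeasure (P (X i \<omega>)) (B i))"
        using emeasure_PiM[OF I(1), of B] B by (auto simp: indicator_def)
      finally show "indicator a \<omega> * (\<Prod>i\<in>I. emeasure (P (X i \<omega>)) (B i)) = emeasure (?K \<omega>) C" by simp
    qed
    also have "\<dots> = emeasure (restr_to_subalg M (F r) \<bind> ?K) C"
      by (rule emeasure_bind[OF ne K' Cm, symmetric])
    finally show "emeasure (distr M (F r \<Otimes>\<^sub>M N) (\<lambda>\<omega>. (\<omega>, \<lambda>i\<in>I. children i \<omega>))) C = emeasure (restr_to_subalg M (F r) \<bind> ?K) C" .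
  qed (use top in auto)
qed

text \<open>The integrand has a parameter of its own, so the kernel is first pushed forward by
  \<open>Pair \<omega>\<close> to a fixed product space, where the integral of one function against
  a measurable family of measures is measurable.\<close>

lemma measurable_transition_integral:
  fixes g :: "'b \<Rightarrow> 'a \<times> 'a \<Rightarrow> 'c::{banach, second_countable_topology}"
  assumes "Y \<in> N \<rightarrow>\<^sub>M borel" "(\<lambda>(\<omega>, y). g \<omega> y) \<in> borel_measurable (N \<Otimes>\<^sub>M (borel \<Otimes>\<^sub>M borel))"
  shows "(\<lambda>\<omega>. \<integral>y. g \<omega> y \<partial>P (Y \<omega>)) \<in> borel_measurable N"
proof -
  let ?N = "N \<Otimes>\<^sub>M (borel \<Otimes>\<^sub>M borel :: ('a \<times> 'a) measure)"
  have [measurable]: "(\<lambda>\<omega>. P (Y \<omega>)) \<in> N \<rightarrow>\<^sub>M subprob_algebra (borel \<Otimes>\<^sub>M borel)"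
    by (rule measurable_compose[OF assms(1) measurable_transition[OF transition]])
  have "(\<lambda>\<omega>. distr (P (Y \<omega>)) ?N (Pair \<omega>)) \<in> N \<rightarrow>\<^sub>M subprob_algebra ?N"
    by (rule measurable_distr2) measurable
  then have "(\<lambda>\<omega>. \<integral>z. (case z of (\<omega>, y) \<Rightarrow> g \<omega> y) \<partial>distr (P (Y \<omega>)) ?N (Pair \<omega>)) \<in> borel_measurable N"
    by (rule measurable_compose[OF _ integral_measurable_subprob_algebra[OF assms(2)]])
  moreover have "(\<integral>z. (case z of (\<omega>, y) \<Rightarrow> g \<omega> y) \<partial>distr (P (Y \<omega>)) ?N (Pair \<omega>)) = (\<integral>y. g \<omega> y \<partial>P (Y \<omega>))"
    if "\<omega> \<in> space N" for \<omega>
  proof -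
    have "Pair \<omega> \<in> P (Y \<omega>) \<rightarrow>\<^sub>M ?N"
      using measurable_Pair1'[OF that, of "borel \<Otimes>\<^sub>M borel :: ('a \<times> 'a) measure"] by (simp cong: measurable_cong_sets)
    from integral_distr[OF this assms(2)] show ?thesis by simp
  qed
  ultimately show ?thesis by (simp cong: measurable_cong)
qed

text \<open>Fubini's theorem for the disintegration \<open>joint_law\<close>: the children are
  integrated first, with the past frozen.\<close>

lemma expectation_joint_law:
  fixes r and \<Psi> :: "'w \<times> (nat \<Rightarrow> 'a \<times> 'a) \<Rightarrow> real"
  defines "I \<equiv> generation r"
  assumes \<Psi>: "\<Psi> \<in> borel_measurable (F r \<Otimes>\<^sub>M PiM I (\<lambda>_. borel \<Otimes>\<^sub>M borel))" and B: "\<And>z. \<bar>\<Psi> z\<bar> \<le> B"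
  shows "(\<integral>\<omega>. \<Psi> (\<omega>, \<lambda>i\<in>I. children i \<omega>) \<partial>M) = (\<integral>\<omega>. (\<integral>y. \<Psi> (\<omega>, y) \<partial>PiM I (\<lambda>i. P (X i \<omega>))) \<partial>M)"
proof -
  let ?N = "PiM I (\<lambda>_. borel \<Otimes>\<^sub>M borel) :: (nat \<Rightarrow> 'a \<times> 'a) measure"
  let ?K = "\<lambda>\<omega>. distr (PiM I (\<lambda>i. P (X i \<omega>))) (F r \<Otimes>\<^sub>M ?N) (Pair \<omega>)"
  let ?R = "restr_to_subalg M (F r)"
  have K: "?K \<in> F r \<rightarrow>\<^sub>M subprob_algebra (F r \<Otimes>\<^sub>M ?N)"
    using joint_law(2)[of r] unfolding I_def by (rule measurable_prob_algebraD)
  have K': "?K \<in> ?R \<rightarrow>\<^sub>M subprob_algebra (F r \<Otimes>\<^sub>M ?N)"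
    using K measurable_cong_sets[OF sets_restr_to_subalg[OF filtration_subalgebra] refl] by blast
  have "(\<integral>\<omega>. \<Psi> (\<omega>, \<lambda>i\<in>I. children i \<omega>) \<partial>M) = (\<integral>z. \<Psi> z \<partial>distr M (F r \<Otimes>\<^sub>M ?N) (\<lambda>\<omega>. (\<omega>, \<lambda>i\<in>I. children i \<omega>)))"
    using joint_law(3)[of r] \<Psi> unfolding I_def by (rule integral_distr[symmetric])
  also have "\<dots> = (\<integral>z. \<Psi> z \<partial>(?R \<bind> ?K))"
    unfolding I_def joint_law(1) ..
  also have "\<dots> = (\<integral>\<omega>. (\<integral>z. \<Psi> z \<partial>?K \<omega>) \<partial>?R)"
  proof (rule integral_bind[OF \<Psi> _ K', where B'=1])
    show "finite_measure ?R"
      by (rule finite_measure_restr_to_subalg[OF filtration_subalgebra]) unfold_locales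
    show "AE \<omega> in ?R. emeasure (?K \<omega>) (space (?K \<omega>)) \<le> ennreal 1"
    proof (rule AE_I2)
      fix \<omega> assume "\<omega> \<in> space ?R"
      then have "?K \<omega> \<in> space (subprob_algebra (F r \<Otimes>\<^sub>M ?N))"
        using measurable_space[OF K'] by blast
      then show "emeasure (?K \<omega>) (space (?K \<omega>)) \<le> ennreal 1"
        by (simp add: space_subprob_algebra subprob_space.subprob_emeasure_le_1)
    qed
  qed (rule B)
  also have "\<dots> = (\<integral>\<omega>. (\<integral>z. \<Psi> z \<partial>?K \<omega>) \<partial>M)"
    by (intro integral_subalgebra2 filtration_subalgebra
          measurable_compose[OF K integral_measurable_subprob_algebra[OF \<Psi>]])
  also have "\<dots> = (\<integral>\<omega>. (\<integral>y. \<Psi> (\<omega>, y) \<partial>PiM I (\<lambda>i. P (X i \<omega>))) \<partial>M)"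
  proof (rule Bochner_Integration.integral_cong[OF refl], rule integral_distr[OF _ \<Psi>])
    fix \<omega> assume "\<omega> \<in> space M"
    then have "Pair \<omega> \<in> ?N \<rightarrow>\<^sub>M F r \<Otimes>\<^sub>M ?N" by (intro measurable_Pair1') (simp add: space_F)
    moreover have "sets (PiM I (\<lambda>i. P (X i \<omega>))) = sets ?N" by (intro sets_PiM_cong) auto
    ultimately show "Pair \<omega> \<in> PiM I (\<lambda>i. P (X i \<omega>)) \<rightarrow>\<^sub>M F r \<Otimes>\<^sub>M ?N"
      using measurable_cong_sets[OF _ refl] by blast
  qed
  finally show ?thesis .
qed

text \<open>Conditionally on \<open>F r\<close> the pairs of children are independent with laws
  \<open>P (X j \<omega>)\<close>, while \<open>Z\<close> and the roots are constants, so the inner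
  integral factorises.\<close>

lemma expectation_prod_triangle:
  fixes Z :: "'w \<Rightarrow> complex" and h :: "'a \<times> 'a \<times> 'a \<Rightarrow> complex"
  assumes K: "K \<subseteq> generation r"
    and Z [measurable]: "Z \<in> borel_measurable (F r)" and Z1: "\<And>\<omega>. norm (Z \<omega>) \<le> 1"
    and h [measurable]: "h \<in> borel_measurable (borel \<Otimes>\<^sub>M borel \<Otimes>\<^sub>M borel)" and h1: "\<And>w. norm (h w) \<le> 1"
  shows "(\<integral>\<omega>. Z \<omega> * (\<Prod>j\<in>K. h (triangle X j \<omega>)) \<partial>M) =
    (\<integral>\<omega>. Z \<omega> * (\<Prod>j\<in>K. \<integral>y. h (X j \<omega>, y) \<partial>P (X j \<omega>)) \<partial>M)"
proof -
  define I where "I = generation r"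
  have I: "finite I" "\<And>i. i \<in> I \<Longrightarrow> 1 \<le> i" "\<And>i. i \<in> I \<Longrightarrow> floor_log i = r" and KI: "K \<subseteq> I" "finite K"
    using K finite_subset[OF K] by (auto simp: I_def floor_log_generation dest: generation_ge_1)
  have XF [measurable]: "X i \<in> F r \<rightarrow>\<^sub>M borel" if "i \<in> K" for i
    using I that KI by (intro measurable_vertex_filtration) auto
  have XM [measurable]: "X i \<in> M \<rightarrow>\<^sub>M borel" if "i \<in> K" for i
    using I that KI by (intro measurable_vertex) auto
  have [measurable]: "children i \<in> M \<rightarrow>\<^sub>M borel \<Otimes>\<^sub>M borel" if "i \<in> K" for i
    using I that KI by (intro measurable_children) auto
  define \<Psi> where "\<Psi> = (\<lambda>z :: 'w \<times> (nat \<Rightarrow> 'a \<times> 'a). Z (fst z) * (\<Prod>j\<in>K. h (X j (fst z), snd z j)))"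
  have [measurable]: "(\<lambda>z. snd z j) \<in> F r \<Otimes>\<^sub>M PiM I (\<lambda>_. borel \<Otimes>\<^sub>M borel) \<rightarrow>\<^sub>M borel \<Otimes>\<^sub>M (borel :: 'a measure)" if "j \<in> K" for j
    using that KI by (intro measurable_compose[OF measurable_snd] measurable_component_singleton) auto
  have \<Psi>m [measurable]: "\<Psi> \<in> borel_measurable (F r \<Otimes>\<^sub>M PiM I (\<lambda>_. borel \<Otimes>\<^sub>M borel))"
    unfolding \<Psi>_def by measurable
  have \<Psi>1: "norm (\<Psi> z) \<le> 1" for z
    unfolding \<Psi>_def norm_mult prod_norm[symmetric]
    by (intro mult_le_one prod_le_1 Z1 prod_nonneg) (auto simp: h1)
  have Re\<Psi>: "\<bar>Re (\<Psi> z)\<bar> \<le> 1" and Im\<Psi>: "\<bar>Im (\<Psi> z)\<bar> \<le> 1" for z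
    using \<Psi>1[of z] abs_Re_le_cmod[of "\<Psi> z"] abs_Im_le_cmod[of "\<Psi> z"] by linarith+
  have ZM [measurable]: "Z \<in> borel_measurable M"
    by (rule measurable_from_subalg[OF filtration_subalgebra Z])
  have \<Psi>M: "(\<lambda>\<omega>. \<Psi> (\<omega>, \<lambda>i\<in>I. children i \<omega>)) \<in> borel_measurable M"
    using measurable_compose[OF joint_law(3)[of r] \<Psi>m[unfolded I_def]] unfolding I_def .
  have i1: "integrable M (\<lambda>\<omega>. \<Psi> (\<omega>, \<lambda>i\<in>I. children i \<omega>))"
    using \<Psi>M \<Psi>1 by (intro integrable_const_bound[of _ 1]) auto
  have hi: "integrable (P x) (\<lambda>y. h (x, y))" for x
    using h1 by (intro transition.integrable_const_bound[of _ 1]) auto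
  have \<Psi>P: "integrable (PiM I (\<lambda>i. P (X i \<omega>))) (\<lambda>y. \<Psi> (\<omega>, y))"
    and inner: "(\<integral>y. \<Psi> (\<omega>, y) \<partial>PiM I (\<lambda>i. P (X i \<omega>))) = Z \<omega> * (\<Prod>j\<in>K. \<integral>y. h (X j \<omega>, y) \<partial>P (X j \<omega>))"
    if \<omega>: "\<omega> \<in> space M" for \<omega>
  proof -
    interpret R: prob_space "PiM I (\<lambda>i. P (X i \<omega>))"
      by (intro prob_space_PiM) unfold_locales
    interpret S: product_sigma_finite "\<lambda>i. P (X i \<omega>)" by unfold_locales
    have "sets (PiM I (\<lambda>i. P (X i \<omega>))) = sets (PiM I (\<lambda>_. borel \<Otimes>\<^sub>M borel :: ('a \<times> 'a) measure))"
      by (intro sets_PiM_cong) auto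
    moreover have "(\<lambda>y. \<Psi> (\<omega>, y)) \<in> borel_measurable (PiM I (\<lambda>_. borel \<Otimes>\<^sub>M borel))"
      using \<omega> by (intro measurable_compose[OF measurable_Pair1' \<Psi>m]) (simp add: space_F)
    ultimately have "(\<lambda>y. \<Psi> (\<omega>, y)) \<in> borel_measurable (PiM I (\<lambda>i. P (X i \<omega>)))"
      using measurable_cong_sets[OF _ refl] by blast
    then show "integrable (PiM I (\<lambda>i. P (X i \<omega>))) (\<lambda>y. \<Psi> (\<omega>, y))"
      using \<Psi>1 by (intro R.integrable_const_bound[of _ 1]) auto
    have "(\<integral>y. \<Psi> (\<omega>, y) \<partial>PiM I (\<lambda>i. P (X i \<omega>))) =
        Z \<omega> * (\<integral>y. (\<Prod>j\<in>K. h (X j \<omega>, y j)) \<partial>PiM I (\<lambda>i. P (X i \<omega>)))"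
      unfolding \<Psi>_def by simp
    \<comment> \<open>The product measure lives on the whole generation; vertices outside
      \<open>K\<close> receive the factor 1, which integrates to 1.\<close>
    also have "(\<integral>y. (\<Prod>j\<in>K. h (X j \<omega>, y j)) \<partial>PiM I (\<lambda>i. P (X i \<omega>))) =
        (\<integral>y. (\<Prod>j\<in>I. (if j \<in> K then h (X j \<omega>, y j) else 1)) \<partial>PiM I (\<lambda>i. P (X i \<omega>)))"
      using KI by (simp add: prod.If_cases[OF I(1)] Int_absorb1)
    also have "\<dots> = (\<Prod>j\<in>I. \<integral>y. (if j \<in> K then h (X j \<omega>, y) else 1) \<partial>P (X j \<omega>))"
    proof (intro S.product_integral_prod[OF I(1), of "\<lambda>j y. if j \<in> K then h (X j \<omega>, y) else 1"])
      show "integrable (P (X j \<omega>)) (\<lambda>y. if j \<in> K then h (X j \<omega>, y) else 1)" for j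
        using hi by (cases "j \<in> K") auto
    qed
    also have "\<dots> = (\<Prod>j\<in>I. if j \<in> K then (\<integral>y. h (X j \<omega>, y) \<partial>P (X j \<omega>)) else 1)"
      by (intro prod.cong) auto
    also have "\<dots> = (\<Prod>j\<in>K. \<integral>y. h (X j \<omega>, y) \<partial>P (X j \<omega>))"
      using KI by (simp add: prod.If_cases[OF I(1)] Int_absorb1)
    finally show "(\<integral>y. \<Psi> (\<omega>, y) \<partial>PiM I (\<lambda>i. P (X i \<omega>))) = Z \<omega> * (\<Prod>j\<in>K. \<integral>y. h (X j \<omega>, y) \<partial>P (X j \<omega>))" .
  qed
  have hP: "norm (\<integral>y. h (x, y) \<partial>P x) \<le> 1" for x
    by (rule order_trans[OF integral_norm_bound transition.integral_le_const])
      (auto intro: integrable_norm hi simp: h1)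
  have [measurable]: "(\<lambda>\<omega>. \<integral>y. h (X j \<omega>, y) \<partial>P (X j \<omega>)) \<in> borel_measurable M" if "j \<in> K" for j
    by (rule measurable_transition_integral) (use that in measurable)
  have i2: "integrable M (\<lambda>\<omega>. Z \<omega> * (\<Prod>j\<in>K. \<integral>y. h (X j \<omega>, y) \<partial>P (X j \<omega>)))"
  proof (rule integrable_const_bound[of _ 1])
    show "AE \<omega> in M. norm (Z \<omega> * (\<Prod>j\<in>K. \<integral>y. h (X j \<omega>, y) \<partial>P (X j \<omega>))) \<le> 1"
      unfolding norm_mult prod_norm[symmetric]
      by (intro AE_I2 mult_le_one prod_le_1 Z1 prod_nonneg) (auto simp: hP)
  qed measurable
  have "(\<integral>\<omega>. Z \<omega> * (\<Prod>j\<in>K. h (triangle X j \<omega>)) \<partial>M) = (\<integral>\<omega>. \<Psi> (\<omega>, \<lambda>i\<in>I. children i \<omega>) \<partial>M)"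
    unfolding \<Psi>_def triangle_def using KI
    by (intro Bochner_Integration.integral_cong arg_cong2[where f="(*)"] prod.cong) auto
  also have "\<dots> = (\<integral>\<omega>. Z \<omega> * (\<Prod>j\<in>K. \<integral>y. h (X j \<omega>, y) \<partial>P (X j \<omega>)) \<partial>M)"
  \<comment> \<open>\<open>expectation_joint_law\<close> is a statement about real functions, so it
    is applied to the real and imaginary parts of \<open>\<Psi>\<close>.\<close>
  proof (rule complex_eqI)
    have "Re (\<integral>\<omega>. \<Psi> (\<omega>, \<lambda>i\<in>I. children i \<omega>) \<partial>M) = (\<integral>\<omega>. Re (\<Psi> (\<omega>, \<lambda>i\<in>I. children i \<omega>)) \<partial>M)"
      by (rule integral_Re[OF i1, symmetric])
    also have "\<dots> = (\<integral>\<omega>. (\<integral>y. Re (\<Psi> (\<omega>, y)) \<partial>PiM I (\<lambda>i. P (X i \<omega>))) \<partial>M)"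
      using expectation_joint_law[of "\<lambda>z. Re (\<Psi> z)" r 1] Re\<Psi> \<Psi>m unfolding I_def by auto
    also have "\<dots> = (\<integral>\<omega>. Re (Z \<omega> * (\<Prod>j\<in>K. \<integral>y. h (X j \<omega>, y) \<partial>P (X j \<omega>))) \<partial>M)"
      by (intro Bochner_Integration.integral_cong refl) (simp only: integral_Re[OF \<Psi>P] inner)
    also have "\<dots> = Re (\<integral>\<omega>. Z \<omega> * (\<Prod>j\<in>K. \<integral>y. h (X j \<omega>, y) \<partial>P (X j \<omega>)) \<partial>M)"
      by (rule integral_Re[OF i2])
    finally show "Re (\<integral>\<omega>. \<Psi> (\<omega>, \<lambda>i\<in>I. children i \<omega>) \<partial>M) = Re (\<integral>\<omega>. Z \<omega> * (\<Prod>j\<in>K. \<integral>y. h (X j \<omega>, y) \<partial>P (X j \<omega>)) \<partial>M)" .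
    have "Im (\<integral>\<omega>. \<Psi> (\<omega>, \<lambda>i\<in>I. children i \<omega>) \<partial>M) = (\<integral>\<omega>. Im (\<Psi> (\<omega>, \<lambda>i\<in>I. children i \<omega>)) \<partial>M)"
      by (rule integral_Im[OF i1, symmetric])
    also have "\<dots> = (\<integral>\<omega>. (\<integral>y. Im (\<Psi> (\<omega>, y)) \<partial>PiM I (\<lambda>i. P (X i \<omega>))) \<partial>M)"
      using expectation_joint_law[of "\<lambda>z. Im (\<Psi> z)" r 1] Im\<Psi> \<Psi>m unfolding I_def by auto
    also have "\<dots> = (\<integral>\<omega>. Im (Z \<omega> * (\<Prod>j\<in>K. \<integral>y. h (X j \<omega>, y) \<partial>P (X j \<omega>))) \<partial>M)"
      by (intro Bochner_Integration.integral_cong refl) (simp only: integral_Im[OF \<Psi>P] inner)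
    also have "\<dots> = Im (\<integral>\<omega>. Z \<omega> * (\<Prod>j\<in>K. \<integral>y. h (X j \<omega>, y) \<partial>P (X j \<omega>)) \<partial>M)"
      by (rule integral_Im[OF i2])
    finally show "Im (\<integral>\<omega>. \<Psi> (\<omega>, \<lambda>i\<in>I. children i \<omega>) \<partial>M) = Im (\<integral>\<omega>. Z \<omega> * (\<Prod>j\<in>K. \<integral>y. h (X j \<omega>, y) \<partial>P (X j \<omega>)) \<partial>M)" .
  qed
  finally show ?thesis .
qed

section \<open>Laws of the children of one or two vertices\<close>

lemma expectation_branching:
  assumes f: "\<And>n. n \<in> generation q \<Longrightarrow> f n \<in> borel_measurable (borel \<Otimes>\<^sub>M borel)"
    and "\<And>n. n \<in> generation q \<Longrightarrow> bounded (range (f n))"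
  shows "(\<integral>\<omega>. (\<Prod>n\<in>generation q. f n (children n \<omega>)) \<partial>M) =
    (\<integral>\<omega>. (\<Prod>n\<in>generation q. trans_op2 P (f n) (X n \<omega>)) \<partial>M)"
proof -
  interpret sub: sigma_finite_subalgebra M "F q" by (rule sigma_finite_subalgebra_filtration)
  have "\<exists>C. \<forall>z. norm (f n z) \<le> C" if "n \<in> generation q" for n
    using assms(2)[OF that] by (auto simp: bounded_iff)
  then obtain C where C: "\<And>n z. n \<in> generation q \<Longrightarrow> \<bar>f n z\<bar> \<le> C n"
    by (metis real_norm_def)
  have "integrable M (\<lambda>\<omega>. \<Prod>n\<in>generation q. f n (children n \<omega>))"
  proof (rule integrable_const_bound[of _ "\<Prod>n\<in>generation q. C n"])
    show "AE \<omega> in M. norm (\<Prod>n\<in>generation q. f n (children n \<omega>)) \<le> (\<Prod>n\<in>generation q. C n)"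
      unfolding prod_norm[symmetric] using C by (intro AE_I2 prod_mono) auto
    show "(\<lambda>\<omega>. \<Prod>n\<in>generation q. f n (children n \<omega>)) \<in> borel_measurable M"
      by (intro borel_measurable_prod measurable_compose[OF measurable_children f] generation_ge_1)
  qed
  then have "(\<integral>\<omega>. (\<Prod>n\<in>generation q. f n (children n \<omega>)) \<partial>M) =
      (\<integral>\<omega>. real_cond_exp M (F q) (\<lambda>\<omega>. \<Prod>n\<in>generation q. f n (children n \<omega>)) \<omega> \<partial>M)"
    by (rule sub.real_cond_exp_int(2)[symmetric])
  also have "\<dots> = (\<integral>\<omega>. (\<Prod>n\<in>generation q. trans_op2 P (f n) (X n \<omega>)) \<partial>M)"
  proof (rule integral_cong_AE)
    show "AE \<omega> in M. real_cond_exp M (F q) (\<lambda>\<omega>. \<Prod>n\<in>generation q. f n (children n \<omega>)) \<omega> =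
        (\<Prod>n\<in>generation q. trans_op2 P (f n) (X n \<omega>))"
      by (rule branching) (use assms in auto)
    have "(\<lambda>\<omega>. trans_op2 P (f n) (X n \<omega>)) \<in> borel_measurable M" if "n \<in> generation q" for n
      unfolding trans_op2_def using f[OF that] measurable_vertex[OF generation_ge_1[OF that]]
      by (intro measurable_transition_integral) auto
    then show "(\<lambda>\<omega>. \<Prod>n\<in>generation q. trans_op2 P (f n) (X n \<omega>)) \<in> borel_measurable M" by auto
  qed simp
  finally show ?thesis .
qed

lemma trans_op2_one [simp]: "trans_op2 P (\<lambda>_. 1) x = 1"
  by (simp add: trans_op2_def)

lemma expectation_children_bounded:
  assumes i: "1 \<le> i" and f: "f \<in> borel_measurable (borel \<Otimes>\<^sub>M borel)" "bounded (range f)"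
  shows "(\<integral>\<omega>. f (children i \<omega>) \<partial>M) = (\<integral>\<omega>. trans_op2 P f (X i \<omega>) \<partial>M)"
proof -
  define q where "q = floor_log i"
  have iq: "i \<in> generation q"
    using i floor_log_exp2_le[of i] floor_log_exp2_gt[of i] by (auto simp: generation_def q_def)
  \<comment> \<open>Constant factors 1 at the other vertices remain 1 under \<open>P\<close>, as
    each \<open>P x\<close> is a probability. In the next fact \<open>g\<close> is a variable so
    that it covers both sides of the branching identity.\<close>
  let ?f = "\<lambda>n. if n = i then f else (\<lambda>_. 1)"
  have *: "(\<Prod>n\<in>generation q. g (?f n) n) = g f i" if "\<And>n. g (\<lambda>_. 1) n = 1" for g :: "_ \<Rightarrow> nat \<Rightarrow> real"
    using iq that by (subst prod.remove[OF _ iq]) (auto intro!: prod.neutral)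
  show ?thesis
    using expectation_branching[of q ?f] f *[of "\<lambda>f n. f (children n _)"] *[of "\<lambda>f n. trans_op2 P f (X n _)"]
    by auto
qed

lemma expectation_children_pair_bounded:
  assumes ij: "i \<in> generation q" "j \<in> generation q" "i \<noteq> j"
    and f: "f \<in> borel_measurable (borel \<Otimes>\<^sub>M borel)" "bounded (range f)"
  shows "(\<integral>\<omega>. f (children i \<omega>) * f (children j \<omega>) \<partial>M) =
    (\<integral>\<omega>. trans_op2 P f (X i \<omega>) * trans_op2 P f (X j \<omega>) \<partial>M)"
proof -
  let ?f = "\<lambda>n. if n = i \<or> n = j then f else (\<lambda>_. 1)"
  have *: "(\<Prod>n\<in>generation q. g (?f n) n) = g f i * g f j" if "\<And>n. g (\<lambda>_. 1) n = 1" for g :: "_ \<Rightarrow> nat \<Rightarrow> real"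
  proof -
    have "(\<Prod>n\<in>generation q. g (?f n) n) = (\<Prod>n\<in>{i, j}. g (?f n) n)"
      using ij that by (intro prod.mono_neutral_right) auto
    then show ?thesis using ij by simp
  qed
  show ?thesis
    using expectation_branching[of q ?f] f *[of "\<lambda>f n. f (children n _)"] *[of "\<lambda>f n. trans_op2 P f (X n _)"]
    by auto
qed

text \<open>An identity of laws, unlike one for bounded test functions, applies at once to
  nonnegative functions of possibly infinite integral. This yields integrability along the tree
  instead of presupposing it.\<close>

lemma law_children:
  assumes i: "1 \<le> i"
  shows "distr M (borel \<Otimes>\<^sub>M borel) (children i) = distr M borel (X i) \<bind> P"
proof (rule measure_eqI)
  note [measurable] = measurable_vertex[OF i] measurable_children[OF i]
  have Pm: "P \<in> distr M borel (X i) \<rightarrow>\<^sub>M subprob_algebra (borel \<Otimes>\<^sub>M borel)"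
    using measurable_transition[OF transition] by (simp cong: measurable_cong_sets)
  show "sets (distr M (borel \<Otimes>\<^sub>M borel) (children i)) = sets (distr M borel (X i) \<bind> P)"
    by (subst sets_bind[where N="borel \<Otimes>\<^sub>M borel"]) auto
  fix A assume "A \<in> sets (distr M (borel \<Otimes>\<^sub>M borel) (children i))"
  then have A [measurable]: "A \<in> sets (borel \<Otimes>\<^sub>M borel)" by simp
  have Am: "(\<lambda>\<omega>. measure (P (X i \<omega>)) A) \<in> borel_measurable M"
    using measurable_compose[OF measurable_vertex[OF i] measurable_compose[OF measurable_transition[OF transition]
          measurable_emeasure_subprob_algebra[OF A]]]
    unfolding measure_def by measurable
  have "emeasure (distr M (borel \<Otimes>\<^sub>M borel) (children i)) A =
      ennreal (measure M {\<omega> \<in> space M. children i \<omega> \<in> A})"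
    unfolding emeasure_distr[OF measurable_children[OF i] A] emeasure_eq_measure[symmetric]
    by (rule arg_cong[where f="emeasure M"]) auto
  also have "measure M {\<omega> \<in> space M. children i \<omega> \<in> A} =
      (\<integral>\<omega>. indicator {\<omega> \<in> space M. children i \<omega> \<in> A} \<omega> \<partial>M)" 
    by (auto intro!: arg_cong[where f=prob])
  also have "\<dots> = (\<integral>\<omega>. indicator A (children i \<omega>) \<partial>M)"
    by (intro Bochner_Integration.integral_cong) (auto simp: indicator_def)
  also have "\<dots> = (\<integral>\<omega>. trans_op2 P (indicator A) (X i \<omega>) \<partial>M)"
    by (rule expectation_children_bounded[OF i]) (auto intro: boundedI[of _ 1] simp: indicator_def)
  also have "\<dots> = (\<integral>\<omega>. measure (P (X i \<omega>)) A \<partial>M)"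
    by (simp add: trans_op2_def)
  also have "ennreal \<dots> = (\<integral>\<^sup>+\<omega>. emeasure (P (X i \<omega>)) A \<partial>M)"
    using Am by (subst nn_integral_eq_integral[symmetric])
      (auto intro!: integrable_const_bound[of _ 1] simp: transition.emeasure_eq_measure)
  also have "\<dots> = (\<integral>\<^sup>+x. emeasure (P x) A \<partial>distr M borel (X i))"
    using measurable_compose[OF measurable_transition[OF transition] measurable_emeasure_subprob_algebra[OF A]]
    by (subst nn_integral_distr) auto
  also have "\<dots> = emeasure (distr M borel (X i) \<bind> P) A"
    by (rule emeasure_bind[OF _ Pm A, symmetric]) simp
  finally show "emeasure (distr M (borel \<Otimes>\<^sub>M borel) (children i)) A = emeasure (distr M borel (X i) \<bind> P) A" .
qed

lemma nn_integral_children: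
  assumes i: "1 \<le> i" and f [measurable]: "f \<in> borel_measurable (borel \<Otimes>\<^sub>M borel)"
  shows "(\<integral>\<^sup>+\<omega>. f (children i \<omega>) \<partial>M) = (\<integral>\<^sup>+\<omega>. (\<integral>\<^sup>+y. f y \<partial>P (X i \<omega>)) \<partial>M)"
proof -
  note [measurable] = measurable_vertex[OF i] measurable_children[OF i]
  have Pm: "P \<in> distr M borel (X i) \<rightarrow>\<^sub>M subprob_algebra (borel \<Otimes>\<^sub>M borel)"
    using measurable_transition[OF transition] by (simp cong: measurable_cong_sets)
  have "(\<integral>\<^sup>+\<omega>. f (children i \<omega>) \<partial>M) = (\<integral>\<^sup>+z. f z \<partial>distr M (borel \<Otimes>\<^sub>M borel) (children i))"
    by (rule nn_integral_distr[OF measurable_children[OF i], symmetric]) simp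
  also have "\<dots> = (\<integral>\<^sup>+x. (\<integral>\<^sup>+y. f y \<partial>P x) \<partial>distr M borel (X i))"
    unfolding law_children[OF i] by (rule nn_integral_bind[OF f Pm])
  also have "\<dots> = (\<integral>\<^sup>+\<omega>. (\<integral>\<^sup>+y. f y \<partial>P (X i \<omega>)) \<partial>M)"
    using measurable_compose[OF measurable_transition[OF transition] nn_integral_measurable_subprob_algebra[OF f]]
    by (subst nn_integral_distr) auto
  finally show ?thesis .
qed

end

section \<open>Admissible spaces\<close>

text \<open>The averaged kernel is given by its values on sets, as half the sum of the marginals.
  Induction over nonnegative measurable functions carries this to integrals, and the marginals are
  then read as coordinates under \<open>P x\<close>.\<close>

lemma nn_integral_mean_kernel:
  assumes P: "tree_transition P" and g: "g \<in> borel_measurable borel"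
  shows "(\<integral>\<^sup>+y. g y \<partial>mean_kernel P x) = (\<integral>\<^sup>+(y, z). g y + g z \<partial>P x) / 2"
proof -
  have [measurable_cong]: "sets (P x) = sets (borel \<Otimes>\<^sub>M borel)" by (rule space_tree_transition[OF P])
  have marg: "(\<integral>\<^sup>+y. g y \<partial>marg0 P x) = (\<integral>\<^sup>+y. g (fst y) \<partial>P x)"
      "(\<integral>\<^sup>+y. g y \<partial>marg1 P x) = (\<integral>\<^sup>+y. g (snd y) \<partial>P x)" if "g \<in> borel_measurable borel" for g :: "'a \<Rightarrow> ennreal"
    unfolding marg0_def marg1_def using that by (simp_all add: nn_integral_distr)
  have sets_marg: "sets (marg0 P x) = sets borel" "sets (marg1 P x) = sets borel"
    by (simp_all add: marg0_def marg1_def)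
  note [measurable_cong] = sets_marg
  have "(\<integral>\<^sup>+y. g y \<partial>mean_kernel P x) = ((\<integral>\<^sup>+y. g y \<partial>marg0 P x) + (\<integral>\<^sup>+y. g y \<partial>marg1 P x)) / 2"
    using g
  proof induct
    case (cong f g)
    have "f = g" using cong by auto
    then show ?case using cong by simp
  next
    case (set A)
    then show ?case by (simp add: emeasure_mean_kernel sets_marg)
  next
    case (mult u c)
    then have [measurable]: "u \<in> borel_measurable borel" by simp
    show ?case using mult
      by (simp add: nn_integral_cmult distrib_left[symmetric] divide_ennreal_def mult.assoc)
  next
    case (add u v)
    then have [measurable]: "u \<in> borel_measurable borel" "v \<in> borel_measurable borel" by simp_all
    show ?case using add
      by (simp add: nn_integral_add divide_ennreal_def flip: distrib_right) (simp add: ac_simps)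
  next
    case (seq U)
    then have [measurable]: "\<And>i. U i \<in> borel_measurable borel" by simp
    have inc: "incseq (\<lambda>i. \<integral>\<^sup>+y. U i y \<partial>N)" for N
      using seq by (auto simp: incseq_def le_fun_def intro!: nn_integral_mono)
    have "(\<integral>\<^sup>+y. (SUP i. U i) y \<partial>mean_kernel P x) = (SUP i. \<integral>\<^sup>+y. U i y \<partial>mean_kernel P x)"
      using seq by (simp add: image_comp nn_integral_monotone_convergence_SUP)
    also have "\<dots> = (SUP i. ((\<integral>\<^sup>+y. U i y \<partial>marg0 P x) + (\<integral>\<^sup>+y. U i y \<partial>marg1 P x)) / 2)"
      using seq by simp
    \<comment> \<open>Both sequences of integrals increase, which is what permits adding the
      suprema.\<close>
    also have "\<dots> = ((SUP i. \<integral>\<^sup>+y. U i y \<partial>marg0 P x) + (SUP i. \<integral>\<^sup>+y. U i y \<partial>marg1 P x)) / 2"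
      by (simp add: divide_ennreal_def SUP_mult_right_ennreal[symmetric] ennreal_SUP_add inc)
    also have "\<dots> = ((\<integral>\<^sup>+y. (SUP i. U i) y \<partial>marg0 P x) + (\<integral>\<^sup>+y. (SUP i. U i) y \<partial>marg1 P x)) / 2"
      using seq by (simp add: image_comp nn_integral_monotone_convergence_SUP)
    finally show ?case .
  qed
  also have "\<dots> = (\<integral>\<^sup>+y. g (fst y) + g (snd y) \<partial>P x) / 2"
    using g by (simp add: marg nn_integral_add)
  finally show ?thesis by (simp add: split_beta')
qed

lemma measurable_mean_kernel:
  assumes P: "tree_transition P"
  shows "mean_kernel P \<in> borel \<rightarrow>\<^sub>M subprob_algebra borel"
proof (rule measurable_subprob_algebra)
  interpret P: prob_space "P x" for x by (rule space_tree_transition[OF P])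
  have sets_P [measurable_cong]: "sets (P x) = sets (borel \<Otimes>\<^sub>M borel)" for x by (rule space_tree_transition[OF P])
  show "subprob_space (mean_kernel P x)" for x
  proof
    have "emeasure (mean_kernel P x) UNIV = (\<integral>\<^sup>+y. 1 \<partial>mean_kernel P x)"
      using sets_eq_imp_space_eq[OF sets_mean_kernel, of P x] by simp
    also have "\<dots> = (\<integral>\<^sup>+(y, z). 1 + 1 \<partial>P x) / 2"
      by (rule nn_integral_mean_kernel[OF P]) simp
    also have "\<dots> = 1" by (simp add: P.emeasure_space_1 split_beta')
    finally show "emeasure (mean_kernel P x) (space (mean_kernel P x)) \<le> 1"
      using sets_eq_imp_space_eq[OF sets_mean_kernel, of P x] by simp
    show "space (mean_kernel P x) \<noteq> {}"
      using sets_eq_imp_space_eq[OF sets_mean_kernel, of P x] by simp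
  qed
  fix A :: "'a set" assume A: "A \<in> sets borel"
  have m: "(\<lambda>x. emeasure (P x) B) \<in> borel_measurable borel" if "B \<in> sets (borel \<Otimes>\<^sub>M borel)" for B
    using measurable_compose[OF measurable_transition[OF P] measurable_emeasure_subprob_algebra[OF that]] .
  have "emeasure (mean_kernel P x) A = (emeasure (P x) (A \<times> UNIV) + emeasure (P x) (UNIV \<times> A)) / 2" for x
  proof -
    have sp: "space (P x) = UNIV"
      using sets_eq_imp_space_eq[OF sets_P] by (simp add: space_pair_measure)
    have "fst -` A = A \<times> (UNIV :: 'a set)" "snd -` A = (UNIV :: 'a set) \<times> A" by auto
    then show ?thesis
      unfolding emeasure_mean_kernel[OF A] marg0_def marg1_def
      by (subst (1 2) emeasure_distr) (auto simp: A sp)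
  qed
  then show "(\<lambda>x. emeasure (mean_kernel P x) A) \<in> borel_measurable borel"
    using m[of "A \<times> UNIV"] m[of "UNIV \<times> A"] A by simp
qed simp

lemma sets_mean_kernel_iter [simp, measurable_cong]:
  assumes "tree_transition P" shows "sets (mean_kernel_iter P r x) = sets borel"
proof (induction r)
  case (Suc r)
  show ?case
    using sets_eq_imp_space_eq[OF Suc] by (simp add: sets_bind[where N=borel])
qed simp

section \<open>The averaged operator on an admissible space\<close>

locale admissible_chain = bifurcating_markov_chain M F \<nu> P X
  for M :: "'w measure" and F \<nu> and P :: "'a::metric_space \<Rightarrow> ('a \<times> 'a) measure" and X +
  fixes \<mu> :: "'a measure" and H
  assumes admissible: "admissible P \<nu> \<mu> H"
begin

sublocale limit: prob_space \<mu>
  using admissible unfolding admissible_def by blast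

lemma
  shows admissible_measurable: "f \<in> H \<Longrightarrow> f \<in> borel_measurable borel"
    and admissible_add: "f \<in> H \<Longrightarrow> g \<in> H \<Longrightarrow> (\<lambda>x. f x + g x) \<in> H"
    and admissible_cmult: "f \<in> H \<Longrightarrow> (\<lambda>x. c * f x) \<in> H"
    and admissible_const: "(\<lambda>x. c) \<in> H"
    and admissible_power2: "f \<in> H \<Longrightarrow> (\<lambda>x. (f x)\<^sup>2) \<in> H"
    and admissible_tensor_integrable: "f \<in> H \<Longrightarrow> g \<in> H \<Longrightarrow> integrable (P x) (\<lambda>(y, z). f y * g z)"
    and admissible_tensor: "f \<in> H \<Longrightarrow> g \<in> H \<Longrightarrow> trans_op2 P (\<lambda>(y, z). f y * g z) \<in> H"
    and admissible_integrable_limit: "f \<in> H \<Longrightarrow> integrable \<mu> f"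
    and admissible_mean_op_limit: "f \<in> H \<Longrightarrow> (\<lambda>r. mean_op P r f x) \<longlonglongrightarrow> (\<integral>y. f y \<partial>\<mu>)"
    and admissible_mean_op_dominated: "f \<in> H \<Longrightarrow> \<exists>g\<in>H. \<forall>r x. \<bar>mean_op P r f x\<bar> \<le> g x"
    and admissible_integrable_initial: "f \<in> H \<Longrightarrow> integrable \<nu> f"
  using admissible unfolding admissible_def by blast+

lemma admissible_diff: "f \<in> H \<Longrightarrow> g \<in> H \<Longrightarrow> (\<lambda>x. f x - g x) \<in> H"
  using admissible_add[OF _ admissible_cmult[of g "-1"], of f] by simp

text \<open>The operator Q, written as one integral against \<open>P x\<close> so that siblings are
  handled together. The iterated kernels are matched with its powers in
  \<open>mean_op_eq\<close>.\<close>

definition mean_step :: "('a \<Rightarrow> real) \<Rightarrow> 'a \<Rightarrow> real" where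
  "mean_step f x = trans_op2 P (\<lambda>(y, z). f y + f z) x / 2"

text \<open>Tensoring with the constant 1 extracts a single coordinate, so the tensor clause of
  admissibility applied to \<open>f \<otimes> 1\<close> and \<open>1 \<otimes> f\<close> yields the
  two summands.\<close>

lemma
  assumes f: "f \<in> H"
  shows transition_integrable_sum: "integrable (P x) (\<lambda>(y, z). f y + f z)"
    and admissible_mean_step: "mean_step f \<in> H"
proof -
  have *: "integrable (P x) (\<lambda>(y, z). f y)" "integrable (P x) (\<lambda>(y, z). f z)" for x
    using admissible_tensor_integrable[OF f admissible_const[of 1]]
      admissible_tensor_integrable[OF admissible_const[of 1] f] by simp_all
  from Bochner_Integration.integrable_add[OF this]
  show "integrable (P x) (\<lambda>(y, z). f y + f z)" by (simp add: split_beta')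
  have "mean_step f = (\<lambda>x. (1 / 2) * (trans_op2 P (\<lambda>(y, z). f y * 1) x + trans_op2 P (\<lambda>(y, z). 1 * f z) x))"
    using Bochner_Integration.integral_add[OF *]
    unfolding mean_step_def trans_op2_def by (simp add: split_beta' fun_eq_iff)
  also have "\<dots> \<in> H"
    by (intro admissible_cmult admissible_add admissible_tensor f admissible_const)
  finally show "mean_step f \<in> H" .
qed

lemma admissible_mean_step_funpow: "f \<in> H \<Longrightarrow> (mean_step ^^ r) f \<in> H"
  by (induction r) (auto intro: admissible_mean_step)

lemma mean_step_nonneg: "(\<And>x. 0 \<le> f x) \<Longrightarrow> 0 \<le> mean_step f x"
  unfolding mean_step_def trans_op2_def by (intro divide_nonneg_pos integral_nonneg_AE) auto

lemma mean_step_diff: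
  assumes "f \<in> H" "g \<in> H"
  shows "mean_step (\<lambda>x. f x - g x) = (\<lambda>x. mean_step f x - mean_step g x)"
  using Bochner_Integration.integral_diff[OF transition_integrable_sum[OF assms(1)] transition_integrable_sum[OF assms(2)]]
  unfolding mean_step_def trans_op2_def
  by (auto simp: split_beta' fun_eq_iff diff_divide_distrib[symmetric] intro!: arg_cong2[where f="(/)"])
     (metis (no_types, lifting) Bochner_Integration.integral_cong add_diff_add)

lemma mean_step_funpow_diff:
  assumes "f \<in> H" "g \<in> H"
  shows "(mean_step ^^ r) (\<lambda>x. f x - g x) = (\<lambda>x. (mean_step ^^ r) f x - (mean_step ^^ r) g x)"
  by (induction r) (simp_all add: mean_step_diff admissible_mean_step_funpow assms)

text \<open>This decomposition replaces the positive and negative parts, which need not belong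
  to an admissible space.\<close>

lemma admissible_decompose:
  assumes "f \<in> H"
  obtains f1 f2 where "f1 \<in> H" "f2 \<in> H" "\<And>x. 0 \<le> f1 x" "\<And>x. 0 \<le> f2 x" "f = (\<lambda>x. f1 x - f2 x)"
proof
  show "(\<lambda>x. (1 / 2) * (f x + 1)\<^sup>2) \<in> H" "(\<lambda>x. (1 / 2) * ((f x)\<^sup>2 + 1)) \<in> H"
    by (intro admissible_cmult admissible_power2 admissible_add assms admissible_const)+
  show "f = (\<lambda>x. (1 / 2) * (f x + 1)\<^sup>2 - (1 / 2) * ((f x)\<^sup>2 + 1))"
    by (auto simp: fun_eq_iff power2_eq_square algebra_simps)
qed auto

lemma nn_integral_sum_transition:
  assumes f: "f \<in> H" and nn: "\<And>x. 0 \<le> f x"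
  shows "(\<integral>\<^sup>+(y, z). ennreal (f y) + ennreal (f z) \<partial>P x) = ennreal (2 * mean_step f x)"
proof -
  have "(\<integral>\<^sup>+(y, z). ennreal (f y) + ennreal (f z) \<partial>P x) = (\<integral>\<^sup>+y. ennreal (case y of (y, z) \<Rightarrow> f y + f z) \<partial>P x)"
    by (intro nn_integral_cong) (auto simp: nn)
  also have "\<dots> = ennreal (2 * mean_step f x)"
    unfolding mean_step_def trans_op2_def
    by (subst nn_integral_eq_integral[OF transition_integrable_sum[OF f]]) (auto simp: nn)
  finally show ?thesis .
qed

lemma nn_integral_mean_kernel_iter:
  assumes "f \<in> H" "\<And>x. 0 \<le> f x"
  shows "(\<integral>\<^sup>+y. f y \<partial>mean_kernel_iter P r x) = ennreal ((mean_step ^^ r) f x)"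
  using assms
proof (induction r arbitrary: f)
  case 0
  then show ?case using admissible_measurable[OF 0(1)] by (simp add: nn_integral_return)
next
  case (Suc r)
  have half: "ennreal (2 * c) / 2 = ennreal c" if "0 \<le> c" for c
    using divide_ennreal[of "2 * c" 2] that by simp
  have "mean_kernel P \<in> mean_kernel_iter P r x \<rightarrow>\<^sub>M subprob_algebra borel"
    using measurable_mean_kernel[OF transition] measurable_cong_sets[OF sets_mean_kernel_iter[OF transition] refl] by blast
  then have "(\<integral>\<^sup>+y. f y \<partial>mean_kernel_iter P (Suc r) x) = (\<integral>\<^sup>+z. (\<integral>\<^sup>+y. f y \<partial>mean_kernel P z) \<partial>mean_kernel_iter P r x)"
    using admissible_measurable[OF Suc.prems(1)] by (simp add: nn_integral_bind[where B=borel])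
  also have "\<dots> = (\<integral>\<^sup>+z. ennreal (mean_step f z) \<partial>mean_kernel_iter P r x)"
    using admissible_measurable[OF Suc.prems(1)] mean_step_nonneg[OF Suc.prems(2)]
    by (subst nn_integral_mean_kernel[OF transition])
       (auto simp: nn_integral_sum_transition Suc.prems half intro!: nn_integral_cong)
  \<comment> \<open>\<open>mean_kernel_iter\<close> appends its last step at the end where
    \<open>f\<close> sits, so the induction hypothesis is needed for
    \<open>mean_step f\<close>.\<close>
  also have "\<dots> = ennreal ((mean_step ^^ Suc r) f x)"
    using Suc.IH[OF admissible_mean_step[OF Suc.prems(1)] mean_step_nonneg[OF Suc.prems(2)]]
    by (simp add: funpow_swap1)
  finally show ?case .
qed

lemma mean_step_funpow_nonneg: "(\<And>x. 0 \<le> f x) \<Longrightarrow> 0 \<le> (mean_step ^^ r) f x"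
  by (induction r arbitrary: x) (auto intro: mean_step_nonneg)

text \<open>Translates the convergence and domination clauses, phrased with iterated kernels, into
  statements on powers of \<open>mean_step\<close>. For nonnegative functions the extended integral
  gives integrability together with the value; the general case is a difference of two such
  functions.\<close>

lemma mean_op_eq:
  assumes "f \<in> H" shows "mean_op P r f = (mean_step ^^ r) f"
proof
  fix x
  have m: "f \<in> borel_measurable (mean_kernel_iter P r x)" if "f \<in> H" for f
    using admissible_measurable[OF that] measurable_cong_sets[OF sets_mean_kernel_iter[OF transition] refl] by blast
  have *: "has_bochner_integral (mean_kernel_iter P r x) f ((mean_step ^^ r) f x)" if "f \<in> H" "\<And>x. 0 \<le> f x" for f
    by (rule has_bochner_integral_nn_integral)
       (use m[OF that(1)] that mean_step_funpow_nonneg[of f] nn_integral_mean_kernel_iter[OF that] in auto)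
  obtain f1 f2 where f: "f1 \<in> H" "f2 \<in> H" "\<And>x. 0 \<le> f1 x" "\<And>x. 0 \<le> f2 x" "f = (\<lambda>x. f1 x - f2 x)"
    using admissible_decompose[OF assms] by blast
  show "mean_op P r f x = (mean_step ^^ r) f x"
    unfolding mean_op_def f(5) mean_step_funpow_diff[OF f(1,2)]
    by (rule has_bochner_integral_integral_eq has_bochner_integral_diff * f)+
qed

lemma mean_step_funpow_tendsto: "f \<in> H \<Longrightarrow> (\<lambda>r. (mean_step ^^ r) f x) \<longlonglongrightarrow> (\<integral>y. f y \<partial>\<mu>)"
  using admissible_mean_op_limit[of f x] by (simp add: mean_op_eq)

lemma mean_step_funpow_dominated:
  assumes "f \<in> H" obtains g where "g \<in> H" "\<And>r x. \<bar>(mean_step ^^ r) f x\<bar> \<le> g x"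
  using admissible_mean_op_dominated[OF assms] mean_op_eq[OF assms] by auto

section \<open>Expectations along the generations\<close>

lemma nn_integral_children_sum:
  assumes i: "1 \<le> i" and f: "f \<in> H" and nn: "\<And>x. 0 \<le> f x"
  shows "(\<integral>\<^sup>+\<omega>. ennreal (f (X (2 * i) \<omega>) + f (X (2 * i + 1) \<omega>)) \<partial>M) = (\<integral>\<^sup>+\<omega>. ennreal (2 * mean_step f (X i \<omega>)) \<partial>M)"
proof -
  note [measurable] = admissible_measurable[OF f]
  have "(\<integral>\<^sup>+\<omega>. ennreal (f (X (2 * i) \<omega>) + f (X (2 * i + 1) \<omega>)) \<partial>M) =
      (\<integral>\<^sup>+\<omega>. (case children i \<omega> of (y, z) \<Rightarrow> ennreal (f y) + ennreal (f z)) \<partial>M)"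
    by (auto simp: nn)
  also have "\<dots> = (\<integral>\<^sup>+\<omega>. (\<integral>\<^sup>+(y, z). ennreal (f y) + ennreal (f z) \<partial>P (X i \<omega>)) \<partial>M)"
    by (rule nn_integral_children[OF i]) measurable
  also have "\<dots> = (\<integral>\<^sup>+\<omega>. ennreal (2 * mean_step f (X i \<omega>)) \<partial>M)"
    by (simp add: nn_integral_sum_transition f nn)
  finally show ?thesis .
qed

text \<open>Descends from the root, where integrability under \<nu> is assumed. A nonnegative
  \<open>g\<close> at one child is at most its sum over both children, whose expectation is that of
  \<open>2 * mean_step g\<close> at the parent. Since the function changes at each step, the
  induction runs over all of \<open>H\<close> at once.\<close>

lemma integrable_vertex:
  assumes "1 \<le> i" "f \<in> H" shows "integrable M (\<lambda>\<omega>. f (X i \<omega>))"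
  using assms
proof (induction i arbitrary: f rule: less_induct)
  case (less i)
  obtain f1 f2 where f: "f1 \<in> H" "f2 \<in> H" "\<And>x. 0 \<le> f1 x" "\<And>x. 0 \<le> f2 x" "f = (\<lambda>x. f1 x - f2 x)"
    using admissible_decompose[OF less.prems(2)] by blast
  have "integrable M (\<lambda>\<omega>. g (X i \<omega>))" if g: "g \<in> H" "\<And>x. 0 \<le> g x" for g
  proof (cases "i = 1")
    case True
    have "integrable (distr M borel (X 1)) g"
      unfolding initial by (rule admissible_integrable_initial[OF g(1)])
    then show ?thesis
      unfolding True using integrable_distr[OF measurable_vertex[of 1]] by simp
  next
    case False
    define k where "k = i div 2"
    have k: "1 \<le> k" "k < i" "i = 2 * k \<or> i = 2 * k + 1"
      using False less.prems(1) by (auto simp: k_def)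
    note [measurable] = measurable_vertex[OF less.prems(1)] admissible_measurable[OF g(1)]
    have "(\<integral>\<^sup>+\<omega>. ennreal (g (X i \<omega>)) \<partial>M) \<le> (\<integral>\<^sup>+\<omega>. ennreal (g (X (2 * k) \<omega>) + g (X (2 * k + 1) \<omega>)) \<partial>M)"
      using k(3) g(2) by (intro nn_integral_mono) auto
    also have "\<dots> = (\<integral>\<^sup>+\<omega>. ennreal (2 * mean_step g (X k \<omega>)) \<partial>M)"
      by (rule nn_integral_children_sum[OF k(1) g])
    also have "\<dots> < \<infinity>"
      using less.IH[OF k(2,1) admissible_cmult[OF admissible_mean_step[OF g(1)], of 2]] mean_step_nonneg[OF g(2)]
      by (subst nn_integral_eq_integral) auto
    finally show ?thesis using g(2) by (intro integrableI_nonneg) auto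
  qed
  then show ?case using f by auto
qed

lemma expectation_children_sum:
  assumes i: "1 \<le> i" and "f \<in> H"
  shows "(\<integral>\<omega>. f (X (2 * i) \<omega>) \<partial>M) + (\<integral>\<omega>. f (X (2 * i + 1) \<omega>) \<partial>M) = 2 * (\<integral>\<omega>. mean_step f (X i \<omega>) \<partial>M)"
proof -
  have *: "(\<integral>\<omega>. g (X (2 * i) \<omega>) \<partial>M) + (\<integral>\<omega>. g (X (2 * i + 1) \<omega>) \<partial>M) = 2 * (\<integral>\<omega>. mean_step g (X i \<omega>) \<partial>M)"
    if g: "g \<in> H" "\<And>x. 0 \<le> g x" for g
  proof -
    have int: "integrable M (\<lambda>\<omega>. g (X (2 * i) \<omega>))" "integrable M (\<lambda>\<omega>. g (X (2 * i + 1) \<omega>))"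
      "integrable M (\<lambda>\<omega>. mean_step g (X i \<omega>))"
      using i g by (auto intro!: integrable_vertex admissible_mean_step)
    have "(\<integral>\<omega>. g (X (2 * i) \<omega>) \<partial>M) + (\<integral>\<omega>. g (X (2 * i + 1) \<omega>) \<partial>M) = (\<integral>\<omega>. g (X (2 * i) \<omega>) + g (X (2 * i + 1) \<omega>) \<partial>M)"
      by (rule Bochner_Integration.integral_add[OF int(1,2), symmetric])
    also have "\<dots> = enn2real (\<integral>\<^sup>+\<omega>. ennreal (g (X (2 * i) \<omega>) + g (X (2 * i + 1) \<omega>)) \<partial>M)"
      using int g(2) by (subst integral_eq_nn_integral) auto
    also have "\<dots> = (\<integral>\<omega>. 2 * mean_step g (X i \<omega>) \<partial>M)"
      unfolding nn_integral_children_sum[OF i g]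
      using borel_measurable_integrable[OF int(3)] mean_step_nonneg[OF g(2)] by (subst integral_eq_nn_integral) auto
    finally show ?thesis by simp
  qed
  obtain f1 f2 where f: "f1 \<in> H" "f2 \<in> H" "\<And>x. 0 \<le> f1 x" "\<And>x. 0 \<le> f2 x" "f = (\<lambda>x. f1 x - f2 x)"
    using admissible_decompose[OF assms(2)] by blast
  show ?thesis
    unfolding f(5) mean_step_diff[OF f(1,2)]
    using *[OF f(1,3)] *[OF f(2,4)] i
    by (simp add: Bochner_Integration.integral_diff integrable_vertex f admissible_mean_step)
qed

text \<open>The many-to-one formula: a uniformly chosen vertex of generation \<open>r\<close> is
  distributed as the chain with kernel Q after \<open>r\<close> steps from \<nu>.\<close>

lemma expectation_generation_sum:
  assumes "f \<in> H"
  shows "(\<Sum>j\<in>generation r. \<integral>\<omega>. f (X j \<omega>) \<partial>M) = 2 ^ r * (\<integral>x. (mean_step ^^ r) f x \<partial>\<nu>)"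
  using assms
proof (induction r arbitrary: f)
  case 0
  have "generation 0 = {1}" by (auto simp: generation_def)
  moreover have "(\<integral>x. f x \<partial>\<nu>) = (\<integral>\<omega>. f (X 1 \<omega>) \<partial>M)"
    unfolding initial[symmetric] by (rule integral_distr[OF measurable_vertex admissible_measurable[OF 0]]) simp
  ultimately show ?case by simp
next
  case (Suc r)
  have "(\<Sum>j\<in>generation (Suc r). \<integral>\<omega>. f (X j \<omega>) \<partial>M) = (\<Sum>i\<in>generation r. 2 * (\<integral>\<omega>. mean_step f (X i \<omega>) \<partial>M))"
    unfolding sum_generation_Suc
    by (intro sum.cong refl expectation_children_sum Suc.prems) (rule generation_ge_1)
  also have "\<dots> = 2 ^ Suc r * (\<integral>x. (mean_step ^^ Suc r) f x \<partial>\<nu>)"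
    unfolding sum_distrib_left[symmetric] Suc.IH[OF admissible_mean_step[OF Suc.prems]]
    by (simp add: funpow_swap1)
  finally show ?case .
qed

end

section \<open>The law of large numbers along generations\<close>

context admissible_chain
begin

text \<open>Squares stay in \<open>H\<close> and dominate products.\<close>

lemma integrable_vertex_mult:
  assumes "1 \<le> i" "1 \<le> j" "f \<in> H" "g \<in> H"
  shows "integrable M (\<lambda>\<omega>. f (X i \<omega>) * g (X j \<omega>))"
proof (rule Bochner_Integration.integrable_bound)
  show "integrable M (\<lambda>\<omega>. (f (X i \<omega>))\<^sup>2 + (g (X j \<omega>))\<^sup>2)"
    using integrable_vertex[OF assms(1) admissible_power2[OF assms(3)]]
      integrable_vertex[OF assms(2) admissible_power2[OF assms(4)]] by simp
  show "(\<lambda>\<omega>. f (X i \<omega>) * g (X j \<omega>)) \<in> borel_measurable M"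
    using assms by (intro borel_measurable_times borel_measurable_integrable integrable_vertex)
  have "\<bar>a * b\<bar> \<le> a\<^sup>2 + b\<^sup>2" for a b :: real
    using sum_squares_bound[of a b] sum_squares_bound[of a "-b"] by (auto simp: abs_if)
  then show "AE \<omega> in M. norm (f (X i \<omega>) * g (X j \<omega>)) \<le> norm ((f (X i \<omega>))\<^sup>2 + (g (X j \<omega>))\<^sup>2)"
    by auto
qed

lemma integrable_children_sum_mult:
  assumes "1 \<le> i" "1 \<le> j" "f \<in> H"
  shows "integrable M (\<lambda>\<omega>. (f (X (2 * i) \<omega>) + f (X (2 * i + 1) \<omega>)) * (f (X (2 * j) \<omega>) + f (X (2 * j + 1) \<omega>)))"
  unfolding distrib_left distrib_right
  using assms by (intro Bochner_Integration.integrable_add integrable_vertex_mult) auto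

text \<open>Distinct vertices of a generation have conditionally independent children. Branching
  covers bounded functions only, so the sum over siblings is truncated and both sides pass to the
  limit by dominated convergence.\<close>

lemma expectation_children_sum_mult:
  assumes ij: "i \<in> generation q" "j \<in> generation q" "i \<noteq> j" and f: "f \<in> H"
  shows "(\<integral>\<omega>. (f (X (2 * i) \<omega>) + f (X (2 * i + 1) \<omega>)) * (f (X (2 * j) \<omega>) + f (X (2 * j + 1) \<omega>)) \<partial>M) =
    4 * (\<integral>\<omega>. mean_step f (X i \<omega>) * mean_step f (X j \<omega>) \<partial>M)"
proof -
  have i1: "1 \<le> i" "1 \<le> j" using ij by (auto dest: generation_ge_1)
  note [measurable] = measurable_vertex[OF i1(1)] measurable_vertex[OF i1(2)]
    measurable_children[OF i1(1)] measurable_children[OF i1(2)] admissible_measurable[OF f]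
  define a where "a = (\<lambda>w :: 'a \<times> 'a. f (fst w) + f (snd w))"
  define t where "t n w = max (- real n) (min (real n) (a w))" for n w
  have [measurable]: "a \<in> borel_measurable (borel \<Otimes>\<^sub>M borel)" "t n \<in> borel_measurable (borel \<Otimes>\<^sub>M borel)" for n
    unfolding a_def t_def by measurable
  have t_bound: "\<bar>t n w\<bar> \<le> \<bar>a w\<bar>" "\<bar>t n w\<bar> \<le> real n" for n w
    unfolding t_def by (auto simp: abs_if max_def min_def)
  have t_lim: "(\<lambda>n. t n w) \<longlonglongrightarrow> a w" for w
  proof (rule tendsto_eventually)
    obtain N :: nat where "\<bar>a w\<bar> \<le> real N" using real_arch_simple by blast
    then show "\<forall>\<^sub>F n in sequentially. t n w = a w"
      unfolding eventually_sequentially t_def by (intro exI[of _ N]) (auto simp: abs_if max_def min_def split: if_splits)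
  qed
  have aP: "integrable (P x) a" for x
    using transition_integrable_sum[OF f] by (simp add: a_def split_beta')
  \<comment> \<open>Dominates the conditional means of all truncations and lies in \<open>H\<close>,
    which is not known for the mean of \<open>\<bar>a\<bar>\<close>. It comes from
    \<open>|u + v| \<le> (u^2 + v^2) / 2 + 1\<close>, averaged under \<open>P x\<close>.\<close>
  define c where "c = (\<lambda>x. mean_step (\<lambda>x. (f x)\<^sup>2) x + 1)"
  have cH: "c \<in> H" unfolding c_def by (intro admissible_add admissible_mean_step admissible_power2 admissible_const f)
  have c: "(\<integral>w. \<bar>a w\<bar> \<partial>P x) \<le> c x" for x
  proof -
    have i: "integrable (P x) (\<lambda>(y, z). (f y)\<^sup>2 + (f z)\<^sup>2)"
      by (rule transition_integrable_sum[OF admissible_power2[OF f]])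
    have "(\<integral>w. \<bar>a w\<bar> \<partial>P x) \<le> (\<integral>w. (case w of (y, z) \<Rightarrow> (f y)\<^sup>2 + (f z)\<^sup>2) / 2 + 1 \<partial>P x)"
    proof (rule integral_mono)
      have "\<bar>u + v\<bar> \<le> (u\<^sup>2 + v\<^sup>2) / 2 + 1" for u v :: real
        using zero_le_power2[of "u - 1"] zero_le_power2[of "u + 1"] zero_le_power2[of "v - 1"] zero_le_power2[of "v + 1"]
        by (auto simp: power2_eq_square algebra_simps abs_if add_divide_distrib)
      then show "\<bar>a w\<bar> \<le> (case w of (y, z) \<Rightarrow> (f y)\<^sup>2 + (f z)\<^sup>2) / 2 + 1" for w
        by (simp add: a_def split_beta')
    qed (use aP i in auto)
    also have "\<dots> = c x"
      using i unfolding c_def mean_step_def trans_op2_def by simp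
    finally show ?thesis .
  qed
  have Pt_lim: "(\<lambda>n. trans_op2 P (t n) x) \<longlonglongrightarrow> 2 * mean_step f x" for x
  proof -
    have "(\<lambda>n. \<integral>w. t n w \<partial>P x) \<longlonglongrightarrow> (\<integral>w. a w \<partial>P x)"
      by (rule integral_dominated_convergence[where w="\<lambda>w. \<bar>a w\<bar>"]) (use aP t_lim t_bound in auto)
    then show ?thesis by (simp add: trans_op2_def mean_step_def a_def split_beta')
  qed
  have Pt_bound: "\<bar>trans_op2 P (t n) x\<bar> \<le> c x" for n x
  proof -
    have "\<bar>trans_op2 P (t n) x\<bar> \<le> (\<integral>w. \<bar>t n w\<bar> \<partial>P x)"
      unfolding trans_op2_def by (rule integral_abs_bound)
    also have "\<dots> \<le> (\<integral>w. \<bar>a w\<bar> \<partial>P x)"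
      using aP t_bound(1)
      by (intro integral_mono integrable_abs Bochner_Integration.integrable_bound[OF integrable_abs[OF aP], of "t n"]) auto
    finally show ?thesis using c[of x] by linarith
  qed
  have Ptm [measurable]: "(\<lambda>x. trans_op2 P (t n) x) \<in> borel_measurable borel" for n
    unfolding trans_op2_def by (rule measurable_transition_integral) auto
  have [measurable]: "mean_step f \<in> borel_measurable borel"
    by (rule admissible_measurable[OF admissible_mean_step[OF f]])
  have L: "(\<lambda>n. \<integral>\<omega>. t n (children i \<omega>) * t n (children j \<omega>) \<partial>M) \<longlonglongrightarrow> (\<integral>\<omega>. a (children i \<omega>) * a (children j \<omega>) \<partial>M)"
  proof (rule integral_dominated_convergence[where w="\<lambda>\<omega>. \<bar>a (children i \<omega>) * a (children j \<omega>)\<bar>"])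
    show "integrable M (\<lambda>\<omega>. \<bar>a (children i \<omega>) * a (children j \<omega>)\<bar>)"
      using integrable_children_sum_mult[OF i1 f] by (intro integrable_abs) (simp add: a_def)
    show "AE \<omega> in M. norm (t n (children i \<omega>) * t n (children j \<omega>)) \<le> \<bar>a (children i \<omega>) * a (children j \<omega>)\<bar>" for n
      unfolding real_norm_def abs_mult using t_bound(1) by (intro AE_I2 mult_mono) auto
    show "(\<lambda>\<omega>. a (children i \<omega>) * a (children j \<omega>)) \<in> borel_measurable M"
      "(\<lambda>\<omega>. t n (children i \<omega>) * t n (children j \<omega>)) \<in> borel_measurable M" for n
      by measurable
  qed (intro AE_I2 tendsto_mult t_lim)
  have R: "(\<lambda>n. \<integral>\<omega>. trans_op2 P (t n) (X i \<omega>) * trans_op2 P (t n) (X j \<omega>) \<partial>M) \<longlonglongrightarrow>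
      (\<integral>\<omega>. (2 * mean_step f (X i \<omega>)) * (2 * mean_step f (X j \<omega>)) \<partial>M)"
  proof (rule integral_dominated_convergence[where w="\<lambda>\<omega>. c (X i \<omega>) * c (X j \<omega>)"])
    show "integrable M (\<lambda>\<omega>. c (X i \<omega>) * c (X j \<omega>))"
      by (rule integrable_vertex_mult[OF i1 cH cH])
    have c0: "0 \<le> c x" for x using Pt_bound[of 0 x] by linarith
    show "AE \<omega> in M. norm (trans_op2 P (t n) (X i \<omega>) * trans_op2 P (t n) (X j \<omega>)) \<le> c (X i \<omega>) * c (X j \<omega>)" for n
      unfolding real_norm_def abs_mult using Pt_bound c0 by (intro AE_I2 mult_mono) auto
    show "AE \<omega> in M. (\<lambda>n. trans_op2 P (t n) (X i \<omega>) * trans_op2 P (t n) (X j \<omega>)) \<longlonglongrightarrow>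
        (2 * mean_step f (X i \<omega>)) * (2 * mean_step f (X j \<omega>))"
      by (intro AE_I2 tendsto_mult Pt_lim)
  qed measurable
  have "bounded (range (t n))" for n
    using t_bound(2)[of n] by (intro boundedI[of _ "real n"]) auto
  then have "(\<integral>\<omega>. t n (children i \<omega>) * t n (children j \<omega>) \<partial>M) =
      (\<integral>\<omega>. trans_op2 P (t n) (X i \<omega>) * trans_op2 P (t n) (X j \<omega>) \<partial>M)" for n
    by (intro expectation_children_pair_bounded[OF ij]) auto
  with L R have "(\<integral>\<omega>. a (children i \<omega>) * a (children j \<omega>) \<partial>M) = (\<integral>\<omega>. (2 * mean_step f (X i \<omega>)) * (2 * mean_step f (X j \<omega>)) \<partial>M)"
    using LIMSEQ_unique by simp
  also have "\<dots> = (\<integral>\<omega>. 4 * (mean_step f (X i \<omega>) * mean_step f (X j \<omega>)) \<partial>M)"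
    by (simp add: mult_ac)
  finally show ?thesis by (simp add: a_def)
qed

section \<open>Second moments of generation sums\<close>

definition second_moment :: "('a \<Rightarrow> real) \<Rightarrow> nat \<Rightarrow> real" where
  "second_moment f r = (\<integral>\<omega>. (\<Sum>j\<in>generation r. f (X j \<omega>))\<^sup>2 \<partial>M)"

lemma second_moment_eq:
  assumes "f \<in> H"
  shows "second_moment f r = (\<Sum>i\<in>generation r. \<Sum>j\<in>generation r. \<integral>\<omega>. f (X i \<omega>) * f (X j \<omega>) \<partial>M)"
  unfolding second_moment_def power2_eq_square sum_product
  using assms by (simp add: integrable_vertex_mult generation_ge_1[simplified])

lemma second_moment_nonneg: "0 \<le> second_moment f r"
  unfolding second_moment_def by (rule integral_nonneg_AE) auto

text \<open>Expands the square over pairs of parents. Different parents give a product of mean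
  steps; equal parents are bounded by the squares of the two siblings. Adding the nonnegative
  diagonal of mean steps completes the square for \<open>mean_step f\<close>, whose weight 4 matches
  the normalisation by \<open>4 ^ r\<close>.\<close>

lemma second_moment_Suc_le:
  assumes f: "f \<in> H"
  shows "second_moment f (Suc r) \<le>
    2 * (\<Sum>j\<in>generation (Suc r). \<integral>\<omega>. (f (X j \<omega>))\<^sup>2 \<partial>M) + 4 * second_moment (mean_step f) r"
proof -
  let ?s = "\<lambda>i \<omega>. f (X (2 * i) \<omega>) + f (X (2 * i + 1) \<omega>)"
  let ?d = "\<lambda>i. 2 * ((\<integral>\<omega>. (f (X (2 * i) \<omega>))\<^sup>2 \<partial>M) + (\<integral>\<omega>. (f (X (2 * i + 1) \<omega>))\<^sup>2 \<partial>M))"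
  let ?m = "\<lambda>i j. \<integral>\<omega>. mean_step f (X i \<omega>) * mean_step f (X j \<omega>) \<partial>M"
  have le: "(\<integral>\<omega>. ?s i \<omega> * ?s j \<omega> \<partial>M) \<le> (if i = j then ?d i else 0) + 4 * ?m i j"
    if ij: "i \<in> generation r" "j \<in> generation r" for i j
  proof (cases "i = j")
    case False
    then show ?thesis using expectation_children_sum_mult[OF ij False f] by simp
  next
    case True
    have i: "1 \<le> i" using ij by (auto dest: generation_ge_1)
    have int: "integrable M (\<lambda>\<omega>. (f (X (2 * i) \<omega>))\<^sup>2)" "integrable M (\<lambda>\<omega>. (f (X (2 * i + 1) \<omega>))\<^sup>2)"
      using i by (auto intro!: integrable_vertex[OF _ admissible_power2[OF f]])
    have "(\<integral>\<omega>. ?s i \<omega> * ?s i \<omega> \<partial>M) \<le> (\<integral>\<omega>. 2 * ((f (X (2 * i) \<omega>))\<^sup>2 + (f (X (2 * i + 1) \<omega>))\<^sup>2) \<partial>M)"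
    proof (rule integral_mono)
      show "integrable M (\<lambda>\<omega>. ?s i \<omega> * ?s i \<omega>)"
        by (rule integrable_children_sum_mult[OF i i f])
      show "integrable M (\<lambda>\<omega>. 2 * ((f (X (2 * i) \<omega>))\<^sup>2 + (f (X (2 * i + 1) \<omega>))\<^sup>2))"
        using int by auto
      have "(u + v) * (u + v) \<le> 2 * (u\<^sup>2 + v\<^sup>2)" for u v :: real
        using zero_le_power2[of "u - v"] by (simp add: power2_eq_square algebra_simps)
      then show "?s i \<omega> * ?s i \<omega> \<le> 2 * ((f (X (2 * i) \<omega>))\<^sup>2 + (f (X (2 * i + 1) \<omega>))\<^sup>2)" for \<omega> .
    qed
    also have "\<dots> = ?d i" using int by simp
    finally have "(\<integral>\<omega>. ?s i \<omega> * ?s i \<omega> \<partial>M) \<le> ?d i" .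
    moreover have "0 \<le> ?m i i" by (rule integral_nonneg_AE) auto
    ultimately have "(\<integral>\<omega>. ?s i \<omega> * ?s i \<omega> \<partial>M) \<le> ?d i + 4 * ?m i i" by linarith
    then show ?thesis by (simp only: True[symmetric] refl if_True)
  qed
  have "second_moment f (Suc r) = (\<integral>\<omega>. (\<Sum>i\<in>generation r. \<Sum>j\<in>generation r. ?s i \<omega> * ?s j \<omega>) \<partial>M)"
    unfolding second_moment_def sum_generation_Suc power2_eq_square sum_product ..
  also have "\<dots> = (\<Sum>i\<in>generation r. \<Sum>j\<in>generation r. \<integral>\<omega>. ?s i \<omega> * ?s j \<omega> \<partial>M)"
    using integrable_children_sum_mult[OF _ _ f] by (simp add: generation_ge_1[simplified])
  also have "\<dots> \<le> (\<Sum>i\<in>generation r. \<Sum>j\<in>generation r. (if i = j then ?d i else 0) + 4 * ?m i j)"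
    by (intro sum_mono le)
  also have "\<dots> = (\<Sum>i\<in>generation r. ?d i) + 4 * (\<Sum>i\<in>generation r. \<Sum>j\<in>generation r. ?m i j)"
    by (simp add: sum.distrib sum_distrib_left)
  also have "(\<Sum>i\<in>generation r. ?d i) = 2 * (\<Sum>j\<in>generation (Suc r). \<integral>\<omega>. (f (X j \<omega>))\<^sup>2 \<partial>M)"
    unfolding sum_generation_Suc sum_distrib_left ..
  also have "(\<Sum>i\<in>generation r. \<Sum>j\<in>generation r. ?m i j) = second_moment (mean_step f) r"
    by (rule second_moment_eq[OF admissible_mean_step[OF f], symmetric])
  finally show ?thesis .
qed

text \<open>Cauchy-Schwarz, which may lose a factor of the size of the generation and is therefore
  used at a fixed generation only.\<close>

lemma second_moment_le:
  assumes f: "f \<in> H"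
  shows "second_moment f r \<le> 2 ^ r * (\<Sum>j\<in>generation r. \<integral>\<omega>. (f (X j \<omega>))\<^sup>2 \<partial>M)"
proof -
  have int: "integrable M (\<lambda>\<omega>. (f (X j \<omega>))\<^sup>2)" if "j \<in> generation r" for j
    using integrable_vertex[OF generation_ge_1[OF that] admissible_power2[OF f]] .
  have "second_moment f r \<le> (\<integral>\<omega>. 2 ^ r * (\<Sum>j\<in>generation r. (f (X j \<omega>))\<^sup>2) \<partial>M)"
    unfolding second_moment_def
  proof (rule integral_mono)
    show "integrable M (\<lambda>\<omega>. (\<Sum>j\<in>generation r. f (X j \<omega>))\<^sup>2)"
      unfolding power2_eq_square sum_product using f
      by (intro Bochner_Integration.integrable_sum integrable_vertex_mult generation_ge_1)
    show "(\<Sum>j\<in>generation r. f (X j \<omega>))\<^sup>2 \<le> 2 ^ r * (\<Sum>j\<in>generation r. (f (X j \<omega>))\<^sup>2)" for \<omega>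
      using sum_squared_le_sum_of_squares[of "\<lambda>j. f (X j \<omega>)" "generation r"] by (simp add: mult.commute)
  qed (use int in auto)
  also have "\<dots> = 2 ^ r * (\<Sum>j\<in>generation r. \<integral>\<omega>. (f (X j \<omega>))\<^sup>2 \<partial>M)"
    using int by simp
  finally show ?thesis .
qed

text \<open>By the many-to-one formula the sum is \<open>2 ^ r\<close> times the \<nu>-integral of
  an iterate of \<open>f\<close>, and one function in \<open>H\<close> dominates all iterates;
  \<open>C\<close> is its \<nu>-integral.\<close>

lemma generation_sum_bound:
  assumes f: "f \<in> H"
  obtains C where "0 \<le> C" "\<And>r. (\<Sum>j\<in>generation r. \<integral>\<omega>. f (X j \<omega>) \<partial>M) \<le> 2 ^ r * C"
proof -
  obtain g where g: "g \<in> H" "\<And>r x. \<bar>(mean_step ^^ r) f x\<bar> \<le> g x"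
    using mean_step_funpow_dominated[OF f] by blast
  show thesis
  proof
    show "0 \<le> (\<integral>x. g x \<partial>\<nu>)" using g(2) by (intro integral_nonneg_AE AE_I2) (meson abs_ge_zero order_trans)
    have "(\<integral>x. (mean_step ^^ r) f x \<partial>\<nu>) \<le> (\<integral>x. g x \<partial>\<nu>)" for r
      using g by (intro integral_mono admissible_integrable_initial admissible_mean_step_funpow f) (auto intro: order_trans[OF abs_ge_self])
    then show "(\<Sum>j\<in>generation r. \<integral>\<omega>. f (X j \<omega>) \<partial>M) \<le> 2 ^ r * (\<integral>x. g x \<partial>\<nu>)" for r
      unfolding expectation_generation_sum[OF f] by simp
  qed
qed

text \<open>Going back \<open>s\<close> generations from \<open>p + s\<close> replaces \<open>f\<close> by its \<open>s\<close>-th mean step, at a cost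
  which is small as soon as \<open>p\<close> is large, uniformly in \<open>s\<close>.\<close>

lemma second_moment_add_le:
  assumes "f \<in> H" "\<And>k x. \<bar>(mean_step ^^ k) f x\<bar> \<le> g x" "g \<in> H"
    and C: "\<And>r. (\<Sum>j\<in>generation r. \<integral>\<omega>. (g (X j \<omega>))\<^sup>2 \<partial>M) \<le> 2 ^ r * C"
  shows "second_moment f (p + s) / 4 ^ (p + s) \<le>
    2 * C * (1 / 2 ^ p - 1 / 2 ^ (p + s)) + second_moment ((mean_step ^^ s) f) p / 4 ^ p"
  using assms(1,2)
proof (induction s arbitrary: f)
  case (Suc s)
  let ?r = "p + s"
  have "(\<Sum>j\<in>generation (Suc ?r). \<integral>\<omega>. (f (X j \<omega>))\<^sup>2 \<partial>M) \<le> (\<Sum>j\<in>generation (Suc ?r). \<integral>\<omega>. (g (X j \<omega>))\<^sup>2 \<partial>M)"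
  proof (intro sum_mono integral_mono integrable_vertex admissible_power2 Suc.prems(1) assms(3))
    show "(f x)\<^sup>2 \<le> (g x)\<^sup>2" for x
      using Suc.prems(2)[of 0 x] by (simp add: abs_le_square_iff[symmetric])
  qed (auto dest: generation_ge_1)
  also note C[of "Suc ?r"]
  finally have "second_moment f (Suc ?r) \<le> 2 * (2 ^ Suc ?r * C) + 4 * second_moment (mean_step f) ?r"
    using second_moment_Suc_le[OF Suc.prems(1), of ?r] by linarith
  then have "second_moment f (Suc ?r) / 4 ^ Suc ?r \<le> (2 * (2 ^ Suc ?r * C) + 4 * second_moment (mean_step f) ?r) / 4 ^ Suc ?r"
    by (intro divide_right_mono) auto
  also have "\<dots> = 2 * C / 2 ^ Suc ?r + second_moment (mean_step f) ?r / 4 ^ ?r"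
  proof -
    have "(4 :: real) ^ Suc ?r = 2 ^ Suc ?r * 2 ^ Suc ?r" by (simp flip: power_mult_distrib)
    then have "2 * (2 ^ Suc ?r * C) / (4 :: real) ^ Suc ?r = 2 * C / 2 ^ Suc ?r" by simp
    then show ?thesis by (simp add: add_divide_distrib)
  qed
  also have "second_moment (mean_step f) ?r / 4 ^ ?r \<le>
      2 * C * (1 / 2 ^ p - 1 / 2 ^ ?r) + second_moment ((mean_step ^^ s) (mean_step f)) p / 4 ^ p"
  proof (rule Suc.IH)
    show "\<bar>(mean_step ^^ k) (mean_step f) x\<bar> \<le> g x" for k x
      using Suc.prems(2)[of "Suc k" x] by (simp add: funpow_swap1)
  qed (rule admissible_mean_step[OF Suc.prems(1)])
  \<comment> \<open>Since \<open>1 / 2 ^ Suc r = 1 / 2 ^ r - 1 / 2 ^ Suc r\<close>, the sibling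
    errors telescope to a bound uniform in \<open>s\<close>.\<close>
  finally show ?case
    by (simp add: funpow_swap1 field_simps)
qed simp

text \<open>Two scales: \<open>p\<close> is fixed first, so late that the sibling errors of all
  later generations together stay below \<open>e / 2\<close>. Then \<open>s\<close> grows with
  \<open>p\<close> fixed, and the \<open>s\<close>-th iterate of \<open>f\<close> tends to the
  \<mu>-mean 0 at each of the finitely many vertices of generation \<open>p\<close>.\<close>

lemma second_moment_tendsto:
  assumes f: "f \<in> H" and f0: "(\<integral>x. f x \<partial>\<mu>) = 0"
  shows "(\<lambda>r. second_moment f r / 4 ^ r) \<longlonglongrightarrow> 0"
proof (rule LIMSEQ_I)
  fix e :: real assume e: "0 < e"
  obtain g where g: "g \<in> H" "\<And>r x. \<bar>(mean_step ^^ r) f x\<bar> \<le> g x"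
    using mean_step_funpow_dominated[OF f] by blast
  obtain C where C: "0 \<le> C" "\<And>r. (\<Sum>j\<in>generation r. \<integral>\<omega>. (g (X j \<omega>))\<^sup>2 \<partial>M) \<le> 2 ^ r * C"
    using generation_sum_bound[OF admissible_power2[OF g(1)]] by auto
  have "(\<lambda>p. 2 * C * (1 / 2) ^ p) \<longlonglongrightarrow> 2 * C * 0"
    by (intro tendsto_intros LIMSEQ_power_zero) auto
  then obtain p where p: "2 * C * (1 / 2) ^ p < e / 2"
    using order_tendstoD(2)[of _ "2 * C * 0" sequentially "e / 2"] half_gt_zero[OF e]
    by (fastforce simp only: eventually_sequentially mult_zero_right)
  \<comment> \<open>The iterates converge pointwise only; the square of \<open>g\<close>, integrable
    at every vertex, turns this into convergence in mean square.\<close>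
  have lim: "(\<lambda>s. \<integral>\<omega>. ((mean_step ^^ s) f (X j \<omega>))\<^sup>2 \<partial>M) \<longlonglongrightarrow> (\<integral>\<omega>. 0 \<partial>M)" if "j \<in> generation p" for j
  proof (rule integral_dominated_convergence[where w="\<lambda>\<omega>. (g (X j \<omega>))\<^sup>2"])
    have j: "1 \<le> j" by (rule generation_ge_1[OF that])
    show "integrable M (\<lambda>\<omega>. (g (X j \<omega>))\<^sup>2)"
      by (rule integrable_vertex[OF j admissible_power2[OF g(1)]])
    show "(\<lambda>\<omega>. ((mean_step ^^ s) f (X j \<omega>))\<^sup>2) \<in> borel_measurable M" for s
      by (intro borel_measurable_integrable integrable_vertex[OF j] admissible_power2 admissible_mean_step_funpow f)
    show "AE \<omega> in M. norm (((mean_step ^^ s) f (X j \<omega>))\<^sup>2) \<le> (g (X j \<omega>))\<^sup>2" for s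
      using g(2) by (auto simp: abs_le_square_iff[symmetric] intro: order_trans[OF _ abs_ge_self])
    have "(\<lambda>s. ((mean_step ^^ s) f x)\<^sup>2) \<longlonglongrightarrow> 0\<^sup>2" for x
      using mean_step_funpow_tendsto[OF f, of x] unfolding f0 by (rule tendsto_power)
    then show "AE \<omega> in M. (\<lambda>s. ((mean_step ^^ s) f (X j \<omega>))\<^sup>2) \<longlonglongrightarrow> 0" by simp
  qed simp
  have "(\<lambda>s. 2 ^ p * (\<Sum>j\<in>generation p. \<integral>\<omega>. ((mean_step ^^ s) f (X j \<omega>))\<^sup>2 \<partial>M) / 4 ^ p) \<longlonglongrightarrow>
      2 ^ p * (\<Sum>j\<in>generation p. \<integral>\<omega>. 0 \<partial>M) / 4 ^ p"
    by (intro tendsto_intros lim) auto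
  then have "\<forall>\<^sub>F s in sequentially. 2 ^ p * (\<Sum>j\<in>generation p. \<integral>\<omega>. ((mean_step ^^ s) f (X j \<omega>))\<^sup>2 \<partial>M) / 4 ^ p < e / 2"
    by (rule order_tendstoD(2)) (use e in simp)
  then obtain S where S: "\<And>s. S \<le> s \<Longrightarrow> 2 ^ p * (\<Sum>j\<in>generation p. \<integral>\<omega>. ((mean_step ^^ s) f (X j \<omega>))\<^sup>2 \<partial>M) / 4 ^ p < e / 2"
    by (auto simp: eventually_sequentially)
  have "second_moment f (p + s) / 4 ^ (p + s) < e" if "S \<le> s" for s
  proof -
    have "second_moment f (p + s) / 4 ^ (p + s) \<le>
        2 * C * (1 / 2 ^ p - 1 / 2 ^ (p + s)) + second_moment ((mean_step ^^ s) f) p / 4 ^ p"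
      by (rule second_moment_add_le[OF f g(2) g(1) C(2)])
    also have "2 * C * (1 / 2 ^ p - 1 / 2 ^ (p + s)) \<le> 2 * C * (1 / 2) ^ p"
      using C(1) by (intro mult_left_mono) (auto simp: power_divide)
    also have "second_moment ((mean_step ^^ s) f) p / 4 ^ p \<le>
        2 ^ p * (\<Sum>j\<in>generation p. \<integral>\<omega>. ((mean_step ^^ s) f (X j \<omega>))\<^sup>2 \<partial>M) / 4 ^ p"
      by (intro divide_right_mono second_moment_le admissible_mean_step_funpow f) auto
    also have "\<dots> < e / 2" by (rule S[OF that])
    also note p
    finally show ?thesis by simp
  qed
  then show "\<exists>no. \<forall>r\<ge>no. norm (second_moment f r / 4 ^ r - 0) < e"
    by (intro exI[of _ "p + S"]) (auto simp: second_moment_nonneg le_iff_add add.assoc)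
qed

end

section \<open>Characteristic functions\<close>

lemma norm_integral_le_integral:
  fixes f :: "'a \<Rightarrow> 'b::{banach, second_countable_topology}"
  assumes "integrable M f" "integrable M g" "\<And>x. norm (f x) \<le> g x"
  shows "norm (\<integral>x. f x \<partial>M) \<le> (\<integral>x. g x \<partial>M)"
  by (rule order_trans[OF integral_norm_bound integral_mono]) (use assms in auto)

text \<open>Turns closeness of the sums of conditional variances into closeness of the Gaussian
  factors.\<close>

lemma abs_exp_minus_diff_le:
  fixes a b :: real assumes "0 \<le> a" "0 \<le> b" shows "\<bar>exp (- a) - exp (- b)\<bar> \<le> \<bar>a - b\<bar>"
proof -
  have *: "exp (- x) - exp (- y) \<le> y - x" if "0 \<le> x" "x \<le> y" for x y :: real
  proof -
    have "exp (- x) - exp (- y) = exp (- x) * (1 - exp (- (y - x)))"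
      by (simp add: algebra_simps flip: exp_add)
    also have "\<dots> \<le> 1 * (1 - exp (- (y - x)))"
      using that by (intro mult_right_mono) auto
    also have "\<dots> \<le> y - x"
    proof -
      have "1 - exp (- d) \<le> d" for d :: real
        using exp_ge_add_one_self[of "- d"] by linarith
      then show ?thesis by (simp only: mult_1)
    qed
    finally show ?thesis .
  qed
  show ?thesis
    using *[of a b] *[of b a] assms by (cases "a \<le> b") (auto simp: abs_if)
qed

lemma abs_exp_minus_approx:
  fixes a :: real assumes "0 \<le> a" shows "\<bar>exp (- a) - (1 - a)\<bar> \<le> a\<^sup>2 / 2"
proof -
  \<comment> \<open>The quadratic Taylor polynomials at \<open>a\<close> and \<open>- a\<close>
    multiply to \<open>1 + a ^ 4 / 4\<close>, so the lower bound for \<open>exp a\<close> yields the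
    upper bound for \<open>exp (- a)\<close>.\<close>
  have "1 \<le> (1 - a + a\<^sup>2 / 2) * (1 + a + a\<^sup>2 / 2)"
  proof -
    have "(1 - a + a\<^sup>2 / 2) * (1 + a + a\<^sup>2 / 2) = 1 + (a\<^sup>2)\<^sup>2 / 4"
      by (simp add: power2_eq_square field_simps)
    then show ?thesis by simp
  qed
  also have "\<dots> \<le> (1 - a + a\<^sup>2 / 2) * exp a"
  proof (rule mult_left_mono)
    show "1 + a + a\<^sup>2 / 2 \<le> exp a" using exp_lower_Taylor_quadratic[OF assms] .
    have "0 \<le> (1 - a)\<^sup>2 + 1" by simp
    then show "0 \<le> 1 - a + a\<^sup>2 / 2" by (simp add: power2_eq_square algebra_simps)
  qed
  finally have "exp (- a) \<le> 1 - a + a\<^sup>2 / 2"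
    by (simp add: exp_minus field_simps)
  then show ?thesis using exp_ge_add_one_self[of "- a"] by (auto simp: abs_if)
qed

context prob_space
begin

lemma expectation_abs_power2_le:
  fixes Y :: "'a \<Rightarrow> real"
  assumes "integrable M Y" "integrable M (\<lambda>x. (Y x)\<^sup>2)"
  shows "(expectation (\<lambda>x. \<bar>Y x\<bar>))\<^sup>2 \<le> expectation (\<lambda>x. (Y x)\<^sup>2)"
  using variance_eq[of "\<lambda>x. \<bar>Y x\<bar>"] variance_positive[of "\<lambda>x. \<bar>Y x\<bar>"] assms by simp

lemma integrable_power2_of_power4:
  fixes Y :: "'a \<Rightarrow> real"
  assumes [measurable]: "Y \<in> borel_measurable M" and Y4: "integrable M (\<lambda>x. (Y x) ^ 4)"
  shows "integrable M (\<lambda>x. (Y x)\<^sup>2)"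
proof (rule square_integrable_imp_integrable)
  show "integrable M (\<lambda>x. ((Y x)\<^sup>2)\<^sup>2)" using Y4 by (simp flip: power_mult)
qed measurable

text \<open>Second-order Taylor expansion, the linear term vanishing since \<open>Y\<close> is
  centred. The cubic remainder is bounded by even moments, the ones available in \<open>H\<close>.
  Passing from \<open>1 - x\<close> to \<open>exp (- x)\<close> costs at most \<open>u ^ 4\<close>
  times the squared variance, itself at most the fourth moment by Jensen's inequality.\<close>

lemma char_gaussian_approx:
  fixes Y :: "'a \<Rightarrow> real"
  assumes Y [measurable]: "Y \<in> borel_measurable M" and Y4: "integrable M (\<lambda>x. (Y x) ^ 4)" and Y0: "expectation Y = 0"
  shows "norm (expectation (\<lambda>x. iexp (u * Y x)) - complex_of_real (exp (- (u\<^sup>2 * expectation (\<lambda>x. (Y x)\<^sup>2) / 2)))) \<le>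
    (\<bar>u\<bar> ^ 3 + u ^ 4) * (expectation (\<lambda>x. (Y x)\<^sup>2) + expectation (\<lambda>x. (Y x) ^ 4))"
proof -
  let ?s = "expectation (\<lambda>x. (Y x)\<^sup>2)" and ?t = "expectation (\<lambda>x. (Y x) ^ 4)"
  have Y2: "integrable M (\<lambda>x. (Y x)\<^sup>2)" by (rule integrable_power2_of_power4[OF Y Y4])
  have Y1: "integrable M Y" by (rule square_integrable_imp_integrable[OF Y Y2])
  have s0: "0 \<le> ?s" by (auto intro!: integral_nonneg_AE)
  have st: "?s\<^sup>2 \<le> ?t"
    using expectation_abs_power2_le[of "\<lambda>x. (Y x)\<^sup>2"] Y2 Y4 by (simp flip: power_mult)
  have int1: "integrable M (\<lambda>x. iexp (u * Y x))"
    by (rule integrable_const_bound[of _ 1]) auto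
  have int2: "integrable M (\<lambda>x. 1 + \<i> * complex_of_real (u * Y x) - complex_of_real (u\<^sup>2 * (Y x)\<^sup>2 / 2))"
    by (intro Bochner_Integration.integrable_diff Bochner_Integration.integrable_add integrable_mult_right
        integrable_of_real integrable_divide Y1 Y2 integrable_const)
  have "expectation (\<lambda>x. 1 + \<i> * complex_of_real (u * Y x) - complex_of_real (u\<^sup>2 * (Y x)\<^sup>2 / 2)) =
      1 + \<i> * complex_of_real (u * 0) - complex_of_real (u\<^sup>2 * ?s / 2)"
  proof (intro has_bochner_integral_integral_eq has_bochner_integral_diff has_bochner_integral_add
      has_bochner_integral_mult_right has_bochner_integral_of_real has_bochner_integral_divide)
    show "has_bochner_integral M (\<lambda>_. 1) (1 :: complex)"
      by (simp add: has_bochner_integral_iff prob_space)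
    show "has_bochner_integral M Y 0" "has_bochner_integral M (\<lambda>x. (Y x)\<^sup>2) ?s"
      using Y1 Y2 Y0 by (simp_all add: has_bochner_integral_iff)
  qed
  then have "expectation (\<lambda>x. iexp (u * Y x)) - complex_of_real (1 - u\<^sup>2 * ?s / 2) =
      expectation (\<lambda>x. iexp (u * Y x) - (1 + \<i> * complex_of_real (u * Y x) - complex_of_real (u\<^sup>2 * (Y x)\<^sup>2 / 2)))"
    using Bochner_Integration.integral_diff[OF int1 int2] by simp
  also have "norm \<dots> \<le> expectation (\<lambda>x. \<bar>u\<bar> ^ 3 * ((Y x)\<^sup>2 + (Y x) ^ 4))"
  proof (rule norm_integral_le_integral)
    fix x
    have "norm (iexp (u * Y x) - (1 + \<i> * complex_of_real (u * Y x) - complex_of_real (u\<^sup>2 * (Y x)\<^sup>2 / 2))) \<le> \<bar>u * Y x\<bar> ^ 3 / 6"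
      using iexp_approx1[of "u * Y x" 2]
      by (simp add: numeral_eq_Suc power2_eq_square algebra_simps)
    also have "\<dots> \<le> \<bar>u * Y x\<bar> ^ 3" by simp
    also have "\<dots> = \<bar>u\<bar> ^ 3 * \<bar>Y x\<bar> ^ 3" by (simp add: abs_mult power_mult_distrib)
    also have "\<bar>Y x\<bar> ^ 3 \<le> (Y x)\<^sup>2 + (Y x) ^ 4"
    proof -
      have "2 * (\<bar>Y x\<bar> * (Y x)\<^sup>2) \<le> (Y x)\<^sup>2 + (Y x) ^ 4"
        using sum_squares_bound[of "\<bar>Y x\<bar>" "(Y x)\<^sup>2"] by (simp add: mult.assoc flip: power_mult)
      moreover have "\<bar>Y x\<bar> ^ 3 = \<bar>Y x\<bar> * (Y x)\<^sup>2" by (simp add: power3_eq_cube power2_eq_square)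
      moreover have "0 \<le> \<bar>Y x\<bar> * (Y x)\<^sup>2" by simp
      ultimately show ?thesis by linarith
    qed
    finally show "norm (iexp (u * Y x) - (1 + \<i> * complex_of_real (u * Y x) - complex_of_real (u\<^sup>2 * (Y x)\<^sup>2 / 2))) \<le>
        \<bar>u\<bar> ^ 3 * ((Y x)\<^sup>2 + (Y x) ^ 4)"
      by (simp add: mult_left_mono)
  qed (use int1 int2 Y2 Y4 in auto)
  also have "\<dots> = \<bar>u\<bar> ^ 3 * (?s + ?t)" using Y2 Y4 by simp
  finally have 1: "norm (expectation (\<lambda>x. iexp (u * Y x)) - complex_of_real (1 - u\<^sup>2 * ?s / 2)) \<le> \<bar>u\<bar> ^ 3 * (?s + ?t)" .
  have "\<bar>exp (- (u\<^sup>2 * ?s / 2)) - (1 - u\<^sup>2 * ?s / 2)\<bar> \<le> (u\<^sup>2 * ?s / 2)\<^sup>2 / 2"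
    using s0 by (intro abs_exp_minus_approx) auto
  also have "\<dots> = u ^ 4 * ?s\<^sup>2 / 8"
    by (simp add: power_mult_distrib power_divide flip: power_mult)
  also have "\<dots> \<le> u ^ 4 * ?s\<^sup>2" by simp
  also have "\<dots> \<le> u ^ 4 * (?s + ?t)" by (rule mult_left_mono) (use st s0 in linarith, simp)
  finally have 2: "norm (complex_of_real (1 - u\<^sup>2 * ?s / 2) - complex_of_real (exp (- (u\<^sup>2 * ?s / 2)))) \<le> u ^ 4 * (?s + ?t)"
    by (simp only: norm_of_real of_real_diff[symmetric] abs_minus_commute)
  have "norm (expectation (\<lambda>x. iexp (u * Y x)) - complex_of_real (exp (- (u\<^sup>2 * ?s / 2)))) \<le>
      \<bar>u\<bar> ^ 3 * (?s + ?t) + u ^ 4 * (?s + ?t)"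
    by (rule norm_diff_triangle_le[OF 1 2])
  then show ?thesis by (simp add: distrib_right)
qed

end

lemma
  assumes v: "0 \<le> v"
  shows real_distribution_gaussian_law: "real_distribution (gaussian_law 0 v)"
    and char_gaussian_law: "char (gaussian_law 0 v) t = complex_of_real (exp (- (t\<^sup>2 * v / 2)))"
proof -
  have "real_distribution (gaussian_law 0 v) \<and> char (gaussian_law 0 v) t = complex_of_real (exp (- (t\<^sup>2 * v / 2)))"
  proof (cases "v = 0")
    case True
    then show ?thesis
      by (simp add: gaussian_law_def char_def integral_return real_distribution_def
          real_distribution_axioms_def prob_space_return)
  next
    case False
    \<comment> \<open>For positive variance the law is a rescaled standard normal law, whose
      characteristic function is known.\<close>
    interpret N: real_distribution std_normal_distribution by (rule real_dist_normal_dist)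
    have "distributed std_normal_distribution lborel (\<lambda>x. x) (normal_density 0 1)"
      unfolding distributed_def by (auto simp: distr_id2)
    from N.normal_density_affine[OF this, of "sqrt v" 0]
    have "distributed std_normal_distribution lborel (\<lambda>x. sqrt v * x) (normal_density 0 (sqrt v))"
      using False v by simp
    then have "distr std_normal_distribution lborel (\<lambda>x. sqrt v * x) = density lborel (normal_density 0 (sqrt v))"
      by (rule distributed_distr_eq_density)
    then have eq: "gaussian_law 0 v = distr std_normal_distribution borel (\<lambda>x. sqrt v * x)"
      using False by (simp add: gaussian_law_def cong: distr_cong)
    have "char (gaussian_law 0 v) t = char std_normal_distribution (t * sqrt v)"
      unfolding eq char_def by (subst integral_distr) (auto simp: mult_ac)
    also have "\<dots> = complex_of_real (exp (- (t\<^sup>2 * v / 2)))"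
      unfolding char_std_normal_distribution using v by (simp add: power_mult_distrib)
    finally have "char (gaussian_law 0 v) t = complex_of_real (exp (- (t\<^sup>2 * v / 2)))" .
    moreover have "real_distribution (gaussian_law 0 v)"
      unfolding eq by (rule N.real_distribution_distr) simp
    ultimately show ?thesis by blast
  qed
  then show "real_distribution (gaussian_law 0 v)" "char (gaussian_law 0 v) t = complex_of_real (exp (- (t\<^sup>2 * v / 2)))"
    by auto
qed

lemma (in bifurcating_markov_chain) measurable_triangle:
  assumes "1 \<le> i" shows "triangle X i \<in> M \<rightarrow>\<^sub>M borel \<Otimes>\<^sub>M borel \<Otimes>\<^sub>M borel"
  using measurable_Pair[OF measurable_vertex[OF assms] measurable_children[OF assms]]
  unfolding triangle_def[abs_def] .

text \<open>The children of a vertex below \<open>2 ^ r\<close> are below \<open>2 * 2 ^ r\<close>,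
  hence in generation \<open>r\<close> at the latest.\<close>

lemma (in bifurcating_markov_chain) measurable_triangle_filtration:
  assumes "1 \<le> i" "i < 2 ^ r" shows "triangle X i \<in> F r \<rightarrow>\<^sub>M borel \<Otimes>\<^sub>M borel \<Otimes>\<^sub>M borel"
proof -
  have le: "floor_log j \<le> r" if "j < 2 * 2 ^ r" for j
    by (cases "j = 0") (use that floor_log_exp2_le[of j] power_less_imp_less_exp[of "2 :: nat" "floor_log j" "Suc r"] in auto)
  show ?thesis
    unfolding triangle_def[abs_def] using assms
    by (intro measurable_Pair measurable_vertex_filtration le) auto
qed

section \<open>Removing the generations one after the other\<close>

locale centred_tree_sum = admissible_chain M F \<nu> P X \<mu> H
  for M :: "'w measure" and F \<nu> and P :: "'a::metric_space \<Rightarrow> ('a \<times> 'a) measure" and X \<mu> H +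
  fixes f :: "'a \<times> 'a \<times> 'a \<Rightarrow> real"
  assumes f_measurable [measurable]: "f \<in> borel_measurable (borel \<Otimes>\<^sub>M borel \<Otimes>\<^sub>M borel)"
    and power2_H: "trans_op3 P (\<lambda>w. (f w) ^ 2) \<in> H"
    and power4_exists: "trans_exists3 P (\<lambda>w. (f w) ^ 4)"
    and power4_H: "trans_op3 P (\<lambda>w. (f w) ^ 4) \<in> H"
    and centred: "\<And>x. trans_op3 P f x = 0"
begin

definition cond_variance :: "'a \<Rightarrow> real" where "cond_variance = trans_op3 P (\<lambda>w. (f w) ^ 2)"
definition limit_variance :: real where "limit_variance = (\<integral>x. cond_variance x \<partial>\<mu>)"
text \<open>Centred under \<mu>, so that its generation averages vanish in mean square.\<close>

definition cond_variance_dev :: "'a \<Rightarrow> real" where "cond_variance_dev x = cond_variance x - limit_variance"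
text \<open>Coefficient of the remainder in \<open>char_gaussian_approx\<close>. As a member of
  \<open>H\<close>, its expected sum over generation \<open>r\<close> is at most of order
  \<open>2 ^ r\<close>.\<close>

definition moments :: "'a \<Rightarrow> real" where "moments x = cond_variance x + trans_op3 P (\<lambda>w. (f w) ^ 4) x"

lemma cond_variance_H: "cond_variance \<in> H" unfolding cond_variance_def by (rule power2_H)
lemma cond_variance_dev_H: "cond_variance_dev \<in> H" unfolding cond_variance_dev_def[abs_def] by (intro admissible_diff admissible_const cond_variance_H)
lemma moments_H: "moments \<in> H" unfolding moments_def[abs_def] by (intro admissible_add cond_variance_H power4_H)

lemma cond_variance_nonneg: "0 \<le> cond_variance x"
  unfolding cond_variance_def trans_op3_def by (rule integral_nonneg_AE) (auto simp: split_beta')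
lemma moments_nonneg: "0 \<le> moments x"
  unfolding moments_def trans_op3_def using cond_variance_nonneg[of x]
  by (intro add_nonneg_nonneg integral_nonneg_AE) (auto simp: split_beta')
lemma limit_variance_nonneg: "0 \<le> limit_variance"
  unfolding limit_variance_def by (rule integral_nonneg_AE) (auto simp: cond_variance_nonneg)

lemma integral_cond_variance_dev: "(\<integral>x. cond_variance_dev x \<partial>\<mu>) = 0"
  unfolding cond_variance_dev_def using admissible_integrable_limit[OF cond_variance_H] limit.prob_space by (simp add: limit_variance_def)

definition transition_char :: "real \<Rightarrow> 'a \<Rightarrow> complex" where "transition_char u x = (\<integral>y. iexp (u * f (x, y)) \<partial>P x)"

lemma norm_transition_char_le: "norm (transition_char u x) \<le> 1"
  unfolding transition_char_def
  by (rule order_trans[OF integral_norm_bound transition.integral_le_const])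
     (auto intro!: transition.integrable_const_bound[of _ 1])

lemma transition_char_approx: "norm (transition_char u x - complex_of_real (exp (- (u\<^sup>2 * cond_variance x / 2)))) \<le> (\<bar>u\<bar> ^ 3 + u ^ 4) * moments x"
proof -
  have "norm ((\<integral>y. iexp (u * f (x, y)) \<partial>P x) - complex_of_real (exp (- (u\<^sup>2 * (\<integral>y. (f (x, y))\<^sup>2 \<partial>P x) / 2)))) \<le>
    (\<bar>u\<bar> ^ 3 + u ^ 4) * ((\<integral>y. (f (x, y))\<^sup>2 \<partial>P x) + (\<integral>y. (f (x, y)) ^ 4 \<partial>P x))"
  proof (rule transition.char_gaussian_approx)
    show "(\<lambda>y. f (x, y)) \<in> borel_measurable (P x)" by measurable
    show "integrable (P x) (\<lambda>y. (f (x, y)) ^ 4)"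
      using power4_exists unfolding trans_exists3_def by (simp add: split_beta')
    show "(\<integral>y. f (x, y) \<partial>P x) = 0"
      using centred[of x] unfolding trans_op3_def by (simp add: split_beta')
  qed
  then show ?thesis
    unfolding transition_char_def moments_def cond_variance_def trans_op3_def by (simp add: split_beta')
qed

lemma measurable_transition_char [measurable]: "transition_char u \<in> borel_measurable borel"
  unfolding transition_char_def[abs_def] by (rule measurable_transition_integral) measurable

text \<open>Conditioning on \<open>F r\<close> replaces each phase by
  \<open>transition_char u\<close> at its root; these factors are exchanged for exponentials, and
  the random exponent for its limiting value. The weight \<open>Z\<close> has modulus at most 1 and
  does not enlarge the errors.\<close>

lemma generation_step:
  assumes K: "K \<subseteq> generation r" and Z: "Z \<in> borel_measurable (F r)" and Z1: "\<And>\<omega>. norm (Z \<omega>) \<le> 1"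
  shows "norm ((\<integral>\<omega>. Z \<omega> * (\<Prod>j\<in>K. iexp (u * f (triangle X j \<omega>))) \<partial>M) -
      (\<integral>\<omega>. Z \<omega> \<partial>M) * complex_of_real (exp (- (u\<^sup>2 * (real (card K) * limit_variance) / 2)))) \<le>
    (\<bar>u\<bar> ^ 3 + u ^ 4) * (\<Sum>j\<in>K. \<integral>\<omega>. moments (X j \<omega>) \<partial>M) + u\<^sup>2 / 2 * (\<integral>\<omega>. \<bar>\<Sum>j\<in>K. cond_variance_dev (X j \<omega>)\<bar> \<partial>M)"
proof -
  define c where "c = exp (- (u\<^sup>2 * (real (card K) * limit_variance) / 2))"
  have K1: "1 \<le> j" if "j \<in> K" for j using that K generation_ge_1 by blast
  have [simp]: "finite K" using finite_subset[OF K] by simp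
  note [measurable] = measurable_vertex[OF K1]
  have [measurable]: "Z \<in> borel_measurable M" by (rule measurable_from_subalg[OF filtration_subalgebra Z])
  have int1: "integrable M (\<lambda>\<omega>. Z \<omega> * (\<Prod>j\<in>K. transition_char u (X j \<omega>)))"
  proof (rule integrable_const_bound[of _ 1])
    show "AE \<omega> in M. norm (Z \<omega> * (\<Prod>j\<in>K. transition_char u (X j \<omega>))) \<le> 1"
      unfolding norm_mult prod_norm[symmetric]
      by (intro AE_I2 mult_le_one prod_le_1 Z1 prod_nonneg) (auto simp: norm_transition_char_le)
  qed measurable
  have int2: "integrable M Z"
    by (rule integrable_const_bound[of _ 1]) (use Z1 in auto)
  have intm: "integrable M (\<lambda>\<omega>. moments (X j \<omega>))" and intd: "integrable M (\<lambda>\<omega>. cond_variance_dev (X j \<omega>))" if "j \<in> K" for j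
    using K1[OF that] moments_H cond_variance_dev_H by (auto intro: integrable_vertex)
  have pw: "norm ((\<Prod>j\<in>K. transition_char u (x j)) - of_real c) \<le>
      (\<bar>u\<bar> ^ 3 + u ^ 4) * (\<Sum>j\<in>K. moments (x j)) + u\<^sup>2 / 2 * \<bar>\<Sum>j\<in>K. cond_variance_dev (x j)\<bar>" for x
  proof -
    \<comment> \<open>For factors in the closed unit disc the difference of two products is at most
      the sum of the differences of the factors.\<close>
    have "norm ((\<Prod>j\<in>K. transition_char u (x j)) - (\<Prod>j\<in>K. complex_of_real (exp (- (u\<^sup>2 * cond_variance (x j) / 2))))) \<le>
        (\<Sum>j\<in>K. norm (transition_char u (x j) - complex_of_real (exp (- (u\<^sup>2 * cond_variance (x j) / 2)))))"
      by (rule norm_prod_diff) (auto simp: norm_transition_char_le cond_variance_nonneg)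
    also have "\<dots> \<le> (\<Sum>j\<in>K. (\<bar>u\<bar> ^ 3 + u ^ 4) * moments (x j))"
      by (intro sum_mono transition_char_approx)
    also have "(\<Prod>j\<in>K. complex_of_real (exp (- (u\<^sup>2 * cond_variance (x j) / 2)))) =
        of_real (exp (- (u\<^sup>2 * (\<Sum>j\<in>K. cond_variance (x j)) / 2)))"
      by (simp add: sum_distrib_left sum_divide_distrib flip: exp_sum sum_negf of_real_prod)
    finally have 1: "norm ((\<Prod>j\<in>K. transition_char u (x j)) - of_real (exp (- (u\<^sup>2 * (\<Sum>j\<in>K. cond_variance (x j)) / 2)))) \<le>
        (\<bar>u\<bar> ^ 3 + u ^ 4) * (\<Sum>j\<in>K. moments (x j))"
      by (simp add: sum_distrib_left)
    \<comment> \<open>Both exponents are nonpositive, where the exponential is 1-Lipschitz. The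
      absolute value is taken outside the sum, so that cancellation between vertices
      survives.\<close>
    have "\<bar>exp (- (u\<^sup>2 * (\<Sum>j\<in>K. cond_variance (x j)) / 2)) - c\<bar> \<le>
        \<bar>u\<^sup>2 * (\<Sum>j\<in>K. cond_variance (x j)) / 2 - u\<^sup>2 * (real (card K) * limit_variance) / 2\<bar>"
      unfolding c_def by (rule abs_exp_minus_diff_le) (auto simp: cond_variance_nonneg limit_variance_nonneg sum_nonneg)
    also have "\<dots> = u\<^sup>2 / 2 * \<bar>\<Sum>j\<in>K. cond_variance_dev (x j)\<bar>"
    proof -
      have "(\<Sum>j\<in>K. cond_variance_dev (x j)) = (\<Sum>j\<in>K. cond_variance (x j)) - real (card K) * limit_variance"
        by (simp add: cond_variance_dev_def sum_subtractf)
      then have "u\<^sup>2 * (\<Sum>j\<in>K. cond_variance (x j)) / 2 - u\<^sup>2 * (real (card K) * limit_variance) / 2 = u\<^sup>2 / 2 * (\<Sum>j\<in>K. cond_variance_dev (x j))"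
        by (simp only: right_diff_distrib diff_divide_distrib times_divide_eq_left)
      then show ?thesis by (simp only: abs_mult) simp
    qed
    finally have 2: "norm (complex_of_real (exp (- (u\<^sup>2 * (\<Sum>j\<in>K. cond_variance (x j)) / 2))) - of_real c) \<le>
        u\<^sup>2 / 2 * \<bar>\<Sum>j\<in>K. cond_variance_dev (x j)\<bar>"
      by (simp only: of_real_diff[symmetric] norm_of_real)
    show ?thesis by (rule norm_diff_triangle_le[OF 1 2])
  qed
  have "(\<integral>\<omega>. Z \<omega> * (\<Prod>j\<in>K. iexp (u * f (triangle X j \<omega>))) \<partial>M) = (\<integral>\<omega>. Z \<omega> * (\<Prod>j\<in>K. transition_char u (X j \<omega>)) \<partial>M)"
    unfolding transition_char_def by (rule expectation_prod_triangle[OF K Z Z1]) auto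
  then have "(\<integral>\<omega>. Z \<omega> * (\<Prod>j\<in>K. iexp (u * f (triangle X j \<omega>))) \<partial>M) - (\<integral>\<omega>. Z \<omega> \<partial>M) * of_real c =
      (\<integral>\<omega>. Z \<omega> * ((\<Prod>j\<in>K. transition_char u (X j \<omega>)) - of_real c) \<partial>M)"
    using int1 int2 by (simp add: right_diff_distrib)
  also have "norm \<dots> \<le> (\<integral>\<omega>. (\<bar>u\<bar> ^ 3 + u ^ 4) * (\<Sum>j\<in>K. moments (X j \<omega>)) + u\<^sup>2 / 2 * \<bar>\<Sum>j\<in>K. cond_variance_dev (X j \<omega>)\<bar> \<partial>M)"
  proof (rule norm_integral_le_integral)
    show "integrable M (\<lambda>\<omega>. Z \<omega> * ((\<Prod>j\<in>K. transition_char u (X j \<omega>)) - of_real c))"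
      using int1 int2 by (simp add: right_diff_distrib)
    show "norm (Z \<omega> * ((\<Prod>j\<in>K. transition_char u (X j \<omega>)) - of_real c)) \<le>
      (\<bar>u\<bar> ^ 3 + u ^ 4) * (\<Sum>j\<in>K. moments (X j \<omega>)) + u\<^sup>2 / 2 * \<bar>\<Sum>j\<in>K. cond_variance_dev (X j \<omega>)\<bar>" for \<omega>
      using mult_mono[OF Z1[of \<omega>] pw[of "\<lambda>j. X j \<omega>"]] by (simp add: norm_mult)
  qed (use intm intd in auto)
  also have "\<dots> = (\<bar>u\<bar> ^ 3 + u ^ 4) * (\<Sum>j\<in>K. \<integral>\<omega>. moments (X j \<omega>) \<partial>M) + u\<^sup>2 / 2 * (\<integral>\<omega>. \<bar>\<Sum>j\<in>K. cond_variance_dev (X j \<omega>)\<bar> \<partial>M)"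
    using intm intd by simp
  finally show ?thesis unfolding c_def .
qed

text \<open>Only the generations strictly below \<open>r\<close>: their triangles are known at time
  \<open>r\<close>, so this phase can serve as the weight \<open>Z\<close> for generation
  \<open>r\<close>.\<close>

definition tree_phase :: "real \<Rightarrow> nat \<Rightarrow> 'w \<Rightarrow> complex" where
  "tree_phase u r \<omega> = (\<Prod>j\<in>{1..<2 ^ r}. iexp (u * f (triangle X j \<omega>)))"

lemma tree_phase_measurable: "tree_phase u r \<in> borel_measurable (F r)"
  unfolding tree_phase_def
proof (rule borel_measurable_prod)
  fix j :: nat assume "j \<in> {1..<2 ^ r}"
  then have [measurable]: "triangle X j \<in> F r \<rightarrow>\<^sub>M borel \<Otimes>\<^sub>M borel \<Otimes>\<^sub>M borel"
    by (intro measurable_triangle_filtration) auto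
  show "(\<lambda>\<omega>. iexp (u * f (triangle X j \<omega>))) \<in> borel_measurable (F r)" by measurable
qed

lemma norm_tree_phase: "norm (tree_phase u r \<omega>) \<le> 1"
  unfolding tree_phase_def prod_norm[symmetric] by (intro prod_le_1) auto

lemma expectation_abs_generation_le:
  "(\<integral>\<omega>. \<bar>\<Sum>j\<in>generation r. cond_variance_dev (X j \<omega>)\<bar> \<partial>M) \<le> sqrt (second_moment cond_variance_dev r)"
  unfolding second_moment_def
proof (intro real_le_rsqrt expectation_abs_power2_le)
  show "integrable M (\<lambda>\<omega>. \<Sum>j\<in>generation r. cond_variance_dev (X j \<omega>))"
    by (intro Bochner_Integration.integrable_sum integrable_vertex cond_variance_dev_H generation_ge_1)
  show "integrable M (\<lambda>\<omega>. (\<Sum>j\<in>generation r. cond_variance_dev (X j \<omega>))\<^sup>2)"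
    unfolding power2_eq_square sum_product
    by (intro Bochner_Integration.integrable_sum integrable_vertex_mult cond_variance_dev_H generation_ge_1)
qed

text \<open>Induction on the number of generations: the last one is exchanged for its Gaussian
  factor with the earlier phase as weight, and since that factor is at most 1 the earlier error is
  not enlarged.\<close>

lemma tree_phase_approx:
  assumes C: "\<And>r. (\<Sum>j\<in>generation r. \<integral>\<omega>. moments (X j \<omega>) \<partial>M) \<le> 2 ^ r * C"
  shows "norm ((\<integral>\<omega>. tree_phase u r \<omega> \<partial>M) - complex_of_real (exp (- (u\<^sup>2 * (real (2 ^ r - 1) * limit_variance) / 2)))) \<le>
    (\<bar>u\<bar> ^ 3 + u ^ 4) * (\<Sum>s<r. 2 ^ s * C) + u\<^sup>2 / 2 * (\<Sum>s<r. sqrt (second_moment cond_variance_dev s))"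
proof (induction r)
  case 0
  show ?case by (simp add: tree_phase_def prob_space)
next
  case (Suc r)
  let ?e = "\<lambda>n. complex_of_real (exp (- (u\<^sup>2 * (real n * limit_variance) / 2)))"
  have "(2 :: nat) ^ Suc r - 1 = (2 ^ r - 1) + 2 ^ r"
    by simp
  then have e: "?e (2 ^ Suc r - 1) = ?e (2 ^ r - 1) * ?e (2 ^ r)"
    by (simp only: of_nat_add distrib_left distrib_right add_divide_distrib minus_add_distrib exp_add of_real_mult)
  have "(\<integral>\<omega>. tree_phase u (Suc r) \<omega> \<partial>M) =
      (\<integral>\<omega>. tree_phase u r \<omega> * (\<Prod>j\<in>generation r. iexp (u * f (triangle X j \<omega>))) \<partial>M)"
    unfolding tree_phase_def lessThan_power_Suc
    by (subst prod.union_disjoint) (simp_all add: disjoint_power_generation[simplified])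
  moreover have "norm ((\<integral>\<omega>. tree_phase u r \<omega> * (\<Prod>j\<in>generation r. iexp (u * f (triangle X j \<omega>))) \<partial>M) -
      (\<integral>\<omega>. tree_phase u r \<omega> \<partial>M) * ?e (2 ^ r)) \<le>
    (\<bar>u\<bar> ^ 3 + u ^ 4) * (2 ^ r * C) + u\<^sup>2 / 2 * sqrt (second_moment cond_variance_dev r)"
  proof -
    have "norm ((\<integral>\<omega>. tree_phase u r \<omega> * (\<Prod>j\<in>generation r. iexp (u * f (triangle X j \<omega>))) \<partial>M) -
        (\<integral>\<omega>. tree_phase u r \<omega> \<partial>M) * ?e (card (generation r))) \<le>
      (\<bar>u\<bar> ^ 3 + u ^ 4) * (\<Sum>j\<in>generation r. \<integral>\<omega>. moments (X j \<omega>) \<partial>M) +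
        u\<^sup>2 / 2 * (\<integral>\<omega>. \<bar>\<Sum>j\<in>generation r. cond_variance_dev (X j \<omega>)\<bar> \<partial>M)"
      by (rule generation_step[OF order_refl tree_phase_measurable norm_tree_phase])
    also have "\<dots> \<le> (\<bar>u\<bar> ^ 3 + u ^ 4) * (2 ^ r * C) + u\<^sup>2 / 2 * sqrt (second_moment cond_variance_dev r)"
      by (intro add_mono mult_left_mono C expectation_abs_generation_le) auto
    finally show ?thesis by simp
  qed
  moreover have "norm ((\<integral>\<omega>. tree_phase u r \<omega> \<partial>M) * ?e (2 ^ r) - ?e (2 ^ r - 1) * ?e (2 ^ r)) \<le>
      (\<bar>u\<bar> ^ 3 + u ^ 4) * (\<Sum>s<r. 2 ^ s * C) + u\<^sup>2 / 2 * (\<Sum>s<r. sqrt (second_moment cond_variance_dev s))"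
  proof -
    have "norm ((\<integral>\<omega>. tree_phase u r \<omega> \<partial>M) * ?e (2 ^ r) - ?e (2 ^ r - 1) * ?e (2 ^ r)) =
        norm ((\<integral>\<omega>. tree_phase u r \<omega> \<partial>M) - ?e (2 ^ r - 1)) * norm (?e (2 ^ r))"
      by (simp only: left_diff_distrib[symmetric] norm_mult)
    also have "\<dots> \<le> norm ((\<integral>\<omega>. tree_phase u r \<omega> \<partial>M) - ?e (2 ^ r - 1)) * 1"
      using limit_variance_nonneg by (intro mult_left_mono) auto
    finally show ?thesis using Suc.IH by linarith
  qed
  ultimately have "norm ((\<integral>\<omega>. tree_phase u (Suc r) \<omega> \<partial>M) - ?e (2 ^ Suc r - 1)) \<le>
      ((\<bar>u\<bar> ^ 3 + u ^ 4) * (2 ^ r * C) + u\<^sup>2 / 2 * sqrt (second_moment cond_variance_dev r)) +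
      ((\<bar>u\<bar> ^ 3 + u ^ 4) * (\<Sum>s<r. 2 ^ s * C) + u\<^sup>2 / 2 * (\<Sum>s<r. sqrt (second_moment cond_variance_dev s)))"
    unfolding e by (simp only:) (rule norm_diff_triangle_le)
  then show ?case by (simp only: sum.lessThan_Suc) (simp add: algebra_simps)
qed

text \<open>The deviation over \<open>K\<close> is kept as it stands, to be averaged later. The
  factor 2 in the moment term accounts for generation \<open>r\<close> and for all earlier
  generations, which together have fewer than \<open>2 ^ r\<close> vertices.\<close>

lemma partial_generation_phase_approx:
  assumes C: "\<And>r. (\<Sum>j\<in>generation r. \<integral>\<omega>. moments (X j \<omega>) \<partial>M) \<le> 2 ^ r * C" and K: "K \<subseteq> generation r"
  shows "norm ((\<integral>\<omega>. tree_phase u r \<omega> * (\<Prod>j\<in>K. iexp (u * f (triangle X j \<omega>))) \<partial>M) -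
      complex_of_real (exp (- (u\<^sup>2 * (real (2 ^ r - 1 + card K) * limit_variance) / 2)))) \<le>
    (\<bar>u\<bar> ^ 3 + u ^ 4) * (2 * 2 ^ r * C) +
    u\<^sup>2 / 2 * ((\<Sum>s<r. sqrt (second_moment cond_variance_dev s)) + (\<integral>\<omega>. \<bar>\<Sum>j\<in>K. cond_variance_dev (X j \<omega>)\<bar> \<partial>M))"
proof -
  let ?e = "\<lambda>n. complex_of_real (exp (- (u\<^sup>2 * (real n * limit_variance) / 2)))"
  have e: "?e (2 ^ r - 1 + card K) = ?e (2 ^ r - 1) * ?e (card K)"
    by (simp only: of_nat_add distrib_left distrib_right add_divide_distrib minus_add_distrib exp_add of_real_mult)
  have "norm ((\<integral>\<omega>. tree_phase u r \<omega> * (\<Prod>j\<in>K. iexp (u * f (triangle X j \<omega>))) \<partial>M) -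
      (\<integral>\<omega>. tree_phase u r \<omega> \<partial>M) * ?e (card K)) \<le>
    (\<bar>u\<bar> ^ 3 + u ^ 4) * (\<Sum>j\<in>K. \<integral>\<omega>. moments (X j \<omega>) \<partial>M) +
      u\<^sup>2 / 2 * (\<integral>\<omega>. \<bar>\<Sum>j\<in>K. cond_variance_dev (X j \<omega>)\<bar> \<partial>M)"
    by (rule generation_step[OF K tree_phase_measurable norm_tree_phase])
  also have "\<dots> \<le> (\<bar>u\<bar> ^ 3 + u ^ 4) * (2 ^ r * C) + u\<^sup>2 / 2 * (\<integral>\<omega>. \<bar>\<Sum>j\<in>K. cond_variance_dev (X j \<omega>)\<bar> \<partial>M)"
  proof (intro add_mono mult_left_mono order_refl)
    have "(\<Sum>j\<in>K. \<integral>\<omega>. moments (X j \<omega>) \<partial>M) \<le> (\<Sum>j\<in>generation r. \<integral>\<omega>. moments (X j \<omega>) \<partial>M)"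
      by (intro sum_mono2 K integral_nonneg_AE) (auto simp: moments_nonneg)
    then show "(\<Sum>j\<in>K. \<integral>\<omega>. moments (X j \<omega>) \<partial>M) \<le> 2 ^ r * C" using C[of r] by linarith
  qed auto
  finally have 1: "norm ((\<integral>\<omega>. tree_phase u r \<omega> * (\<Prod>j\<in>K. iexp (u * f (triangle X j \<omega>))) \<partial>M) -
      (\<integral>\<omega>. tree_phase u r \<omega> \<partial>M) * ?e (card K)) \<le>
    (\<bar>u\<bar> ^ 3 + u ^ 4) * (2 ^ r * C) + u\<^sup>2 / 2 * (\<integral>\<omega>. \<bar>\<Sum>j\<in>K. cond_variance_dev (X j \<omega>)\<bar> \<partial>M)" .
  have C0: "0 \<le> C"
    using order_trans[OF sum_nonneg C[of 0]] by (auto intro!: integral_nonneg_AE simp: moments_nonneg)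
  have "norm ((\<integral>\<omega>. tree_phase u r \<omega> \<partial>M) * ?e (card K) - ?e (2 ^ r - 1) * ?e (card K)) =
      norm ((\<integral>\<omega>. tree_phase u r \<omega> \<partial>M) - ?e (2 ^ r - 1)) * norm (?e (card K))"
    by (simp only: left_diff_distrib[symmetric] norm_mult)
  also have "\<dots> \<le> norm ((\<integral>\<omega>. tree_phase u r \<omega> \<partial>M) - ?e (2 ^ r - 1)) * 1"
    using limit_variance_nonneg by (intro mult_left_mono) auto
  also have "\<dots> \<le> (\<bar>u\<bar> ^ 3 + u ^ 4) * (\<Sum>s<r. 2 ^ s * C) + u\<^sup>2 / 2 * (\<Sum>s<r. sqrt (second_moment cond_variance_dev s))"
    using tree_phase_approx[OF C, of u r] by simp
  also have "\<dots> \<le> (\<bar>u\<bar> ^ 3 + u ^ 4) * (2 ^ r * C) + u\<^sup>2 / 2 * (\<Sum>s<r. sqrt (second_moment cond_variance_dev s))"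
  proof (intro add_mono mult_left_mono order_refl)
    have "(\<Sum>s<r. 2 ^ s * C) = (2 ^ r - 1) * C"
      by (induction r) (auto simp: algebra_simps)
    then show "(\<Sum>s<r. 2 ^ s * C) \<le> 2 ^ r * C" using C0 by (simp add: algebra_simps)
  qed auto
  finally have 2: "norm ((\<integral>\<omega>. tree_phase u r \<omega> \<partial>M) * ?e (card K) - ?e (2 ^ r - 1) * ?e (card K)) \<le>
      (\<bar>u\<bar> ^ 3 + u ^ 4) * (2 ^ r * C) + u\<^sup>2 / 2 * (\<Sum>s<r. sqrt (second_moment cond_variance_dev s))" .
  show ?thesis
    using norm_diff_triangle_le[OF 1 2] unfolding e by (simp add: algebra_simps)
qed

end

section \<open>Averaging over the permutation\<close>

text \<open>The factor by which the off-diagonal terms are weighted is the same for all pairs of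
  distinct points, since the permutations act transitively on such pairs.\<close>

lemma sum_permutations_le:
  fixes e :: "'b \<Rightarrow> 'b \<Rightarrow> real"
  assumes G: "finite G" and L: "L \<subseteq> G" and diag: "\<And>i. i \<in> G \<Longrightarrow> 0 \<le> e i i"
    and total: "0 \<le> (\<Sum>i\<in>G. \<Sum>j\<in>G. e i j)"
  shows "(\<Sum>p | p permutes G. \<Sum>i\<in>L. \<Sum>j\<in>L. e (p i) (p j)) \<le>
    fact (card G) * ((\<Sum>i\<in>G. e i i) + (\<Sum>i\<in>G. \<Sum>j\<in>G. e i j))"
proof -
  let ?\<Pi> = "{p. p permutes G}"
  define S where "S i j = (\<Sum>p\<in>?\<Pi>. e (p i) (p j))" for i j
  have card\<Pi>: "real (card ?\<Pi>) = fact (card G)" by (simp add: card_permutations[OF refl G])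
  have inv: "S (t i) (t j) = S i j" if "t permutes G" for t i j
    unfolding S_def using sum_permutations_compose_right[OF that, of "\<lambda>p. e (p i) (p j)"] by simp
  have const: "S i j = S i' j'" if "i \<in> G" "j \<in> G" "i \<noteq> j" "i' \<in> G" "j' \<in> G" "i' \<noteq> j'" for i j i' j'
  proof -
    \<comment> \<open>Two transpositions suffice: one carries \<open>i\<close> to \<open>i'\<close>,
      the other carries the image of \<open>j\<close> to \<open>j'\<close> and leaves
      \<open>i'\<close> alone.\<close>
    have "S i j = S i' (Transposition.transpose i i' j)"
      using inv[OF permutes_swap_id[of i G i'], of i j] that by simp
    also have "\<dots> = S i' j'"
    proof -
      let ?j = "Transposition.transpose i i' j"
      have "?j \<in> G" "?j \<noteq> i'" using that by (auto simp: Transposition.transpose_def)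
      then show ?thesis
        using inv[OF permutes_swap_id[of ?j G j'], of i' ?j] that by simp
    qed
    finally show ?thesis .
  qed
  \<comment> \<open>If \<open>G\<close> has no two distinct points, any \<open>c\<close> will
    do.\<close>
  obtain c where c: "\<And>i j. i \<in> G \<Longrightarrow> j \<in> G \<Longrightarrow> i \<noteq> j \<Longrightarrow> S i j = c"
    using const by (cases "\<exists>i\<in>G. \<exists>j\<in>G. i \<noteq> j") metis+
  have split: "(\<Sum>i\<in>A. \<Sum>j\<in>A. h i j) = (\<Sum>i\<in>A. h i i) + (\<Sum>i\<in>A. \<Sum>j\<in>A - {i}. h i j)"
    if "finite A" for A :: "'b set" and h :: "'b \<Rightarrow> 'b \<Rightarrow> real"
    using that by (simp add: sum.distrib[symmetric] sum.remove)
  have swap: "(\<Sum>i\<in>A. \<Sum>j\<in>A. S i j) = (\<Sum>p\<in>?\<Pi>. \<Sum>i\<in>A. \<Sum>j\<in>A. e (p i) (p j))" for A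
  proof -
    have "(\<Sum>i\<in>A. \<Sum>j\<in>A. S i j) = (\<Sum>i\<in>A. \<Sum>p\<in>?\<Pi>. \<Sum>j\<in>A. e (p i) (p j))"
      unfolding S_def by (intro sum.cong refl sum.swap)
    also have "\<dots> = (\<Sum>p\<in>?\<Pi>. \<Sum>i\<in>A. \<Sum>j\<in>A. e (p i) (p j))"
      by (rule sum.swap)
    finally show ?thesis .
  qed
  have reindex: "(\<Sum>i\<in>G. \<Sum>j\<in>G. S i j) = fact (card G) * (\<Sum>i\<in>G. \<Sum>j\<in>G. e i j)"
    and reindex_diag: "(\<Sum>i\<in>G. S i i) = fact (card G) * (\<Sum>i\<in>G. e i i)"
  proof -
    have p: "(\<Sum>i\<in>G. h (p i)) = (\<Sum>i\<in>G. h i)" if "p permutes G" for p and h :: "'b \<Rightarrow> real"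
      using sum.reindex_bij_betw[OF permutes_imp_bij[OF that]] .
    have "(\<Sum>i\<in>G. \<Sum>j\<in>G. S i j) = (\<Sum>p\<in>?\<Pi>. \<Sum>i\<in>G. \<Sum>j\<in>G. e (p i) (p j))"
      by (rule swap)
    also have "\<dots> = (\<Sum>p\<in>?\<Pi>. \<Sum>i\<in>G. \<Sum>j\<in>G. e i j)"
    proof (rule sum.cong[OF refl])
      fix q assume "q \<in> ?\<Pi>"
      then show "(\<Sum>i\<in>G. \<Sum>j\<in>G. e (q i) (q j)) = (\<Sum>i\<in>G. \<Sum>j\<in>G. e i j)"
        using p[of q "\<lambda>i. \<Sum>j\<in>G. e i (q j)"] p[of q "\<lambda>j. e _ j"] by simp
    qed
    finally show "(\<Sum>i\<in>G. \<Sum>j\<in>G. S i j) = fact (card G) * (\<Sum>i\<in>G. \<Sum>j\<in>G. e i j)"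
      by (simp add: card\<Pi>)
    have "(\<Sum>i\<in>G. S i i) = (\<Sum>p\<in>?\<Pi>. \<Sum>i\<in>G. e (p i) (p i))"
      unfolding S_def by (rule sum.swap)
    also have "\<dots> = (\<Sum>p\<in>?\<Pi>. \<Sum>i\<in>G. e i i)"
      by (rule sum.cong[OF refl], rule p) simp
    finally show "(\<Sum>i\<in>G. S i i) = fact (card G) * (\<Sum>i\<in>G. e i i)"
      by (simp add: card\<Pi>)
  qed
  have off: "(\<Sum>i\<in>A. \<Sum>j\<in>A - {i}. S i j) = real (card A * (card A - 1)) * c" if "A \<subseteq> G" for A
  proof -
    have fA: "finite A" using that G finite_subset by blast
    have "(\<Sum>i\<in>A. \<Sum>j\<in>A - {i}. S i j) = (\<Sum>i\<in>A. \<Sum>j\<in>A - {i}. c)"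
      using that by (intro sum.cong refl c) auto
    also have "\<dots> = (\<Sum>i\<in>A. real (card A - 1) * c)"
      using fA by (intro sum.cong) auto
    finally show ?thesis by simp
  qed
  have fL: "finite L" using L G finite_subset by blast
  have le: "real (card L * (card L - 1)) * c \<le> fact (card G) * (\<Sum>i\<in>G. \<Sum>j\<in>G. e i j)"
  proof (cases "0 \<le> c")
    case True
    have "real (card L * (card L - 1)) * c \<le> real (card G * (card G - 1)) * c"
      using card_mono[OF G L] True by (intro mult_right_mono of_nat_mono mult_le_mono diff_le_mono)
    also have "\<dots> = (\<Sum>i\<in>G. \<Sum>j\<in>G. S i j) - (\<Sum>i\<in>G. S i i)"
      unfolding split[OF G] using off[of G] by simp
    also have "\<dots> \<le> fact (card G) * (\<Sum>i\<in>G. \<Sum>j\<in>G. e i j)"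
      unfolding reindex reindex_diag using sum_nonneg[of G "\<lambda>i. e i i"] diag by simp
    finally show ?thesis .
  next
    case False
    then have "real (card L * (card L - 1)) * c \<le> 0" by (intro mult_nonneg_nonpos) auto
    also have "\<dots> \<le> fact (card G) * (\<Sum>i\<in>G. \<Sum>j\<in>G. e i j)" using total by simp
    finally show ?thesis .
  qed
  have "(\<Sum>p | p permutes G. \<Sum>i\<in>L. \<Sum>j\<in>L. e (p i) (p j)) = (\<Sum>i\<in>L. \<Sum>j\<in>L. S i j)"
    by (rule swap[symmetric])
  also have "\<dots> = (\<Sum>i\<in>L. S i i) + real (card L * (card L - 1)) * c"
    unfolding split[OF fL] off[OF L] ..
  also have "(\<Sum>i\<in>L. S i i) \<le> (\<Sum>i\<in>G. S i i)"
  proof (rule sum_mono2[OF G L])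
    fix i assume "i \<in> G - L"
    then have "p i \<in> G" if "p permutes G" for p using permutes_in_image[OF that] by blast
    then show "0 \<le> S i i" unfolding S_def by (intro sum_nonneg diag) auto
  qed
  also note reindex_diag
  finally show ?thesis using le by (simp add: distrib_left)
qed

text \<open>Weighted Cesaro convergence: the weights \<open>2 ^ s / 2 ^ q\<close> sum to less than
  1, and each of them vanishes as \<open>q\<close> grows.\<close>

lemma dyadic_average_tendsto_0:
  fixes b :: "nat \<Rightarrow> real"
  assumes b0: "\<And>s. 0 \<le> b s" and b: "b \<longlonglongrightarrow> 0"
  shows "(\<lambda>q. (\<Sum>s<q. 2 ^ s * b s) / 2 ^ q) \<longlonglongrightarrow> 0"
proof (rule LIMSEQ_I)
  fix e :: real assume e: "0 < e"
  obtain S where S: "\<And>s. S \<le> s \<Longrightarrow> b s < e / 2"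
    using order_tendstoD(2)[OF b half_gt_zero[OF e]] by (auto simp: eventually_sequentially)
  define A where "A = (\<Sum>s<S. 2 ^ s * b s)"
  \<comment> \<open>The allowance \<open>e / 2 * 2 ^ (S + k)\<close> doubles at each step, which
    leaves exactly the room required by the next term.\<close>
  have bound: "(\<Sum>s<S + k. 2 ^ s * b s) \<le> A + e / 2 * 2 ^ (S + k)" for k
  proof (induction k)
    case 0
    then show ?case using e by (simp add: A_def)
  next
    case (Suc k)
    have "2 ^ (S + k) * b (S + k) \<le> 2 ^ (S + k) * (e / 2)"
      using S[of "S + k"] by (intro mult_left_mono) auto
    moreover have "(\<Sum>s<S + Suc k. 2 ^ s * b s) = (\<Sum>s<S + k. 2 ^ s * b s) + 2 ^ (S + k) * b (S + k)"
      "e / 2 * 2 ^ (S + Suc k) = e / 2 * 2 ^ (S + k) + 2 ^ (S + k) * (e / 2)"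
      by simp_all
    ultimately show ?case using Suc by linarith
  qed
  have "(\<lambda>q. A * (1 / 2) ^ q) \<longlonglongrightarrow> A * 0"
    by (intro tendsto_intros LIMSEQ_power_zero) auto
  then have "\<forall>\<^sub>F q in sequentially. A * (1 / 2) ^ q < e / 2"
    by (rule order_tendstoD(2)) (use e in simp)
  then obtain T where T: "\<And>q. T \<le> q \<Longrightarrow> A * (1 / 2) ^ q < e / 2"
    by (auto simp: eventually_sequentially)
  have "norm ((\<Sum>s<q. 2 ^ s * b s) / 2 ^ q - 0) < e" if q: "max S T \<le> q" for q
  proof -
    obtain k where k: "q = S + k" using q by (metis le_add_diff_inverse max.boundedE)
    have "(\<Sum>s<q. 2 ^ s * b s) / 2 ^ q \<le> (A + e / 2 * 2 ^ q) / 2 ^ q"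
      unfolding k by (intro divide_right_mono bound) auto
    also have "\<dots> = A * (1 / 2) ^ q + e / 2" by (simp add: add_divide_distrib power_divide)
    also have "\<dots> < e" using T[of q] q by simp
    finally show ?thesis using b0 by (simp add: sum_nonneg)
  qed
  then show "\<exists>no. \<forall>q\<ge>no. norm ((\<Sum>s<q. 2 ^ s * b s) / 2 ^ q - 0) < e" by blast
qed

section \<open>The random permutation and its independence of the chain\<close>

locale permuted_tree_sum = centred_tree_sum M F \<nu> P X \<mu> H f
  for M :: "'w measure" and F \<nu> and P :: "'a::metric_space \<Rightarrow> ('a \<times> 'a) measure" and X \<mu> H f +
  fixes \<pi> :: "'w \<Rightarrow> nat \<Rightarrow> nat"
  assumes uniform: "uniform_generation_permutation M \<pi>"
    and independent: "independent_of_chain M X \<pi>"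
begin

definition sigma_chain :: "'w measure" where
  "sigma_chain = vimage_algebra (space M) (\<lambda>\<omega>. \<lambda>n\<in>{1..}. X n \<omega>) (PiM {1..} (\<lambda>_. borel))"

definition sigma_perm :: "'w measure" where
  "sigma_perm = vimage_algebra (space M) (\<lambda>\<omega>. \<lambda>n\<in>{1..}. \<pi> \<omega> n) (PiM {1..} (\<lambda>_. count_space UNIV))"

lemma indep: "indep_set (sets sigma_chain) (sets sigma_perm)"
  using independent unfolding independent_of_chain_def sigma_chain_def sigma_perm_def .

lemma subalgebra_chain: "subalgebra M sigma_chain" and subalgebra_perm: "subalgebra M sigma_perm"
  using indep_setD_ev1[OF indep] indep_setD_ev2[OF indep]
  by (auto simp: subalgebra_def sigma_chain_def sigma_perm_def)

lemma measurable_sigma_chain: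
  assumes "1 \<le> n" shows "X n \<in> sigma_chain \<rightarrow>\<^sub>M borel"
proof -
  have "(\<lambda>\<omega>. \<lambda>n\<in>{1..}. X n \<omega>) \<in> sigma_chain \<rightarrow>\<^sub>M PiM {1..} (\<lambda>_. borel)"
    unfolding sigma_chain_def by (rule measurable_vimage_algebra1) (auto simp: space_PiM)
  from measurable_compose[OF this measurable_component_singleton[of n]] show ?thesis
    using assms by simp
qed

lemma measurable_sigma_perm:
  assumes "1 \<le> n" shows "(\<lambda>\<omega>. \<pi> \<omega> n) \<in> sigma_perm \<rightarrow>\<^sub>M count_space UNIV"
proof -
  have "(\<lambda>\<omega>. \<lambda>n\<in>{1..}. \<pi> \<omega> n) \<in> sigma_perm \<rightarrow>\<^sub>M PiM {1..} (\<lambda>_. count_space UNIV)"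
    unfolding sigma_perm_def by (rule measurable_vimage_algebra1) (auto simp: space_PiM)
  from measurable_compose[OF this measurable_component_singleton[of n]] show ?thesis
    using assms by simp
qed

lemma
  assumes "\<omega> \<in> space M"
  shows permutes: "\<pi> \<omega> permutes {1..}" and image_generation: "\<pi> \<omega> ` generation q = generation q"
  using uniform assms unfolding uniform_generation_permutation_def by auto

text \<open>Full generations are only rearranged, so their contribution to the sum does not see the
  permutation.\<close>

lemma image_tree:
  assumes "\<omega> \<in> space M" shows "\<pi> \<omega> ` {1..<2 ^ q} = {1..<2 ^ q}"
proof (induction q)
  case (Suc q)
  then show ?case
    unfolding lessThan_power_Suc image_Un image_generation[OF assms] by simp
qed simp

abbreviation perms :: "nat \<Rightarrow> (nat \<Rightarrow> nat) set" where
  "perms q \<equiv> {p. p permutes generation q}"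

definition perm_event :: "nat \<Rightarrow> (nat \<Rightarrow> nat) \<Rightarrow> 'w set" where
  "perm_event q p = {\<omega> \<in> space M. restrict_generation (\<pi> \<omega>) q = p}"

lemma finite_perms [simp]: "finite (perms q)"
  by (simp add: finite_permutations)

lemma restrict_generation_in_perms:
  assumes "\<omega> \<in> space M" shows "restrict_generation (\<pi> \<omega>) q \<in> perms q"
proof -
  have "inj_on (\<pi> \<omega>) (generation q)" using permutes_inj[OF permutes[OF assms]] by (rule inj_on_subset) simp
  then have "bij_betw (\<pi> \<omega>) (generation q) (generation q)"
    using image_generation[OF assms] by (simp add: bij_betw_def)
  then have "bij_betw (restrict_generation (\<pi> \<omega>) q) (generation q) (generation q)"
    by (simp add: restrict_generation_def cong: bij_betw_cong)
  then have "restrict_generation (\<pi> \<omega>) q permutes generation q"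
    by (rule bij_imp_permutes) (simp add: restrict_generation_def)
  then show ?thesis by simp
qed

lemma perm_event_sigma_perm:
  assumes "p \<in> perms q" shows "perm_event q p \<in> sets sigma_perm"
proof -
  \<comment> \<open>Off the generation both maps are the identity, so finitely many coordinates of
    \<open>\<pi>\<close> decide the event.\<close>
  have "perm_event q p = {\<omega> \<in> space sigma_perm. \<forall>i\<in>generation q. \<pi> \<omega> i = p i}"
    using assms unfolding perm_event_def restrict_generation_def permutes_def
    by (auto simp: fun_eq_iff sigma_perm_def)
  also have "\<dots> \<in> sets sigma_perm"
  proof (rule sets.sets_Collect_finite_All')
    fix i assume "i \<in> generation q"
    then have [measurable]: "(\<lambda>\<omega>. \<pi> \<omega> i) \<in> sigma_perm \<rightarrow>\<^sub>M count_space UNIV"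
      by (intro measurable_sigma_perm generation_ge_1)
    show "{\<omega> \<in> space sigma_perm. \<pi> \<omega> i = p i} \<in> sets sigma_perm" by measurable
  qed (auto simp: generation_def)
  finally show ?thesis .
qed

lemma prob_perm_event:
  assumes p: "p \<in> perms q" shows "prob (perm_event q p) = 1 / fact (2 ^ q)"
proof -
  let ?R = "\<lambda>\<omega>. restrict_generation (\<pi> \<omega>) q"
  have R: "?R \<in> M \<rightarrow>\<^sub>M count_space (perms q)"
    using uniform unfolding uniform_generation_permutation_def indep_vars_def2 by auto
  have "prob (perm_event q p) = measure (distr M (count_space (perms q)) ?R) {p}"
    using p by (subst measure_distr[OF R]) (auto simp: perm_event_def intro!: arg_cong[where f=prob])
  also have "\<dots> = measure (uniform_count_measure (perms q)) {p}"
    using uniform unfolding uniform_generation_permutation_def by simp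
  also have "\<dots> = 1 / fact (2 ^ q)"
    using p by (subst measure_uniform_count_measure) (auto simp: card_permutations[OF refl] finite_permutations)
  finally show ?thesis .
qed

text \<open>Independence of the two sigma-fields factorises the expectation, and all permutations of
  the generation are equally likely.\<close>

lemma expectation_perm_event:
  fixes W :: "'w \<Rightarrow> complex"
  assumes p: "p \<in> perms q" and W: "W \<in> borel_measurable sigma_chain" and W1: "\<And>\<omega>. norm (W \<omega>) \<le> 1"
  shows "(\<integral>\<omega>. W \<omega> * indicator (perm_event q p) \<omega> \<partial>M) = (\<integral>\<omega>. W \<omega> \<partial>M) / fact (2 ^ q)"
proof -
  let ?I = "indicator (perm_event q p) :: 'w \<Rightarrow> complex"
  have WM [measurable]: "W \<in> borel_measurable M" by (rule measurable_from_subalg[OF subalgebra_chain W])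
  have I: "?I \<in> borel_measurable sigma_perm"
    using perm_event_sigma_perm[OF p] by simp
  have IM [measurable]: "?I \<in> borel_measurable M" by (rule measurable_from_subalg[OF subalgebra_perm I])
  have sub: "sigma_sets (space M) {Y -` A \<inter> space M |A. A \<in> sets borel} \<subseteq> sets N"
    if "Y \<in> borel_measurable N" "space N = space M" for Y :: "'w \<Rightarrow> complex" and N
    unfolding that(2)[symmetric] using measurable_sets[OF that(1)] by (intro sets.sigma_sets_subset) auto
  have "indep_var borel W borel ?I"
    unfolding indep_var_eq
  proof (intro conjI WM IM)
    show "indep_set (sigma_sets (space M) {W -` A \<inter> space M |A. A \<in> sets borel})
        (sigma_sets (space M) {?I -` A \<inter> space M |A. A \<in> sets borel})"
      using indep unfolding indep_set_def
      by (rule indep_sets_mono_sets)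
        (use sub[OF W] sub[OF I] in \<open>auto simp: sigma_chain_def sigma_perm_def split: bool.split\<close>)
  qed
  then have "(\<integral>\<omega>. W \<omega> * ?I \<omega> \<partial>M) = (\<integral>\<omega>. W \<omega> \<partial>M) * (\<integral>\<omega>. ?I \<omega> \<partial>M)"
    by (rule indep_var_lebesgue_integral) (use W1 in \<open>auto intro!: integrable_const_bound[of _ 1] simp: indicator_def\<close>)
  also have "(\<integral>\<omega>. ?I \<omega> \<partial>M) = complex_of_real (prob (perm_event q p))"
  proof -
    have "perm_event q p \<subseteq> space M" by (auto simp: perm_event_def)
    moreover have "?I = (\<lambda>\<omega>. complex_of_real (indicator (perm_event q p) \<omega>))"
      by (auto simp: indicator_def)
    ultimately show ?thesis by (simp add: Int_absorb2)
  qed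
  finally show ?thesis by (simp add: prob_perm_event[OF p])
qed

lemma perm_sum_measurable: "perm_sum X \<pi> f n \<in> borel_measurable M"
  unfolding perm_sum_def[abs_def]
proof (rule borel_measurable_sum)
  fix i assume "i \<in> {1..n}"
  then have i: "1 \<le> i" by simp
  have "(\<lambda>\<omega>. \<pi> \<omega> i) \<in> M \<rightarrow>\<^sub>M count_space UNIV"
    by (rule measurable_from_subalg[OF subalgebra_perm measurable_sigma_perm[OF i]])
  \<comment> \<open>Index 0 is not a vertex and nothing is assumed on \<open>X 0\<close>, so the
    random index is confined to the positive integers before composing.\<close>
  moreover have "\<pi> \<omega> i \<in> {1..}" if "\<omega> \<in> space M" for \<omega>
    using permutes_in_image[OF permutes[OF that], of i] i by simp
  ultimately have "(\<lambda>\<omega>. \<pi> \<omega> i) \<in> M \<rightarrow>\<^sub>M count_space {1..}"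
    by (subst measurable_count_space_eq2_countable) (auto dest: measurable_sets)
  then show "(\<lambda>\<omega>. f (triangle X (\<pi> \<omega> i) \<omega>)) \<in> borel_measurable M"
    by (rule measurable_compose_countable'[where f="\<lambda>k \<omega>. f (triangle X k \<omega>)", rotated])
       (auto intro!: measurable_compose[OF measurable_triangle f_measurable])
qed

section \<open>The sum up to a fixed n as an average over the last generation\<close>

context
  fixes n q :: nat
  assumes n: "1 \<le> n" and q: "q = floor_log n"
begin

lemma generation_bounds: "2 ^ q \<le> n" "n < 2 * 2 ^ q"
  using n floor_log_exp2_le[of n] floor_log_exp2_gt[of n] by (auto simp: q)

lemma last_generation_subset: "{2 ^ q..n} \<subseteq> generation q"
  using generation_bounds by (auto simp: generation_def)

text \<open>The product runs over the image set, matching the set \<open>K\<close> of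
  \<open>partial_generation_phase_approx\<close>.\<close>

definition perm_phase :: "real \<Rightarrow> (nat \<Rightarrow> nat) \<Rightarrow> 'w \<Rightarrow> complex" where
  "perm_phase u p \<omega> = tree_phase u q \<omega> * (\<Prod>j\<in>p ` {2 ^ q..n}. iexp (u * f (triangle X j \<omega>)))"

lemma image_subset_generation: "p \<in> perms q \<Longrightarrow> p ` {2 ^ q..n} \<subseteq> generation q"
  using last_generation_subset by (metis image_mono mem_Collect_eq permutes_image)

lemma perm_phase_measurable:
  assumes "p \<in> perms q" shows "perm_phase u p \<in> borel_measurable sigma_chain"
proof -
  have "(\<lambda>\<omega>. iexp (u * f (triangle X j \<omega>))) \<in> borel_measurable sigma_chain" if "1 \<le> j" for j
  proof -
    have [measurable]: "triangle X j \<in> sigma_chain \<rightarrow>\<^sub>M borel \<Otimes>\<^sub>M borel \<Otimes>\<^sub>M borel"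
      unfolding triangle_def[abs_def] using that by (intro measurable_Pair measurable_sigma_chain) auto
    show ?thesis by measurable
  qed
  moreover have "1 \<le> j" if "j \<in> p ` {2 ^ q..n}" for j
    using image_subset_generation[OF assms] that generation_ge_1 by blast
  ultimately show ?thesis
    unfolding perm_phase_def[abs_def] tree_phase_def
    by (intro borel_measurable_times borel_measurable_prod) auto
qed

lemma norm_perm_phase: "norm (perm_phase u p \<omega>) \<le> 1"
  unfolding perm_phase_def norm_mult prod_norm[symmetric]
  by (intro mult_le_one norm_tree_phase prod_le_1 prod_nonneg) auto

text \<open>Below the last generation the permutation cancels; inside it only the restriction to
  \<open>generation q\<close> matters. The events \<open>perm_event q p\<close> partition the space,
  so at most one term of the sum is nonzero at each \<omega>.\<close>

lemma iexp_perm_sum: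
  assumes \<omega>: "\<omega> \<in> space M"
  shows "iexp (u * perm_sum X \<pi> f n \<omega>) = (\<Sum>p\<in>perms q. perm_phase u p \<omega> * indicator (perm_event q p) \<omega>)"
proof -
  let ?p = "restrict_generation (\<pi> \<omega>) q"
  let ?g = "\<lambda>j. f (triangle X j \<omega>)"
  have inj: "inj_on (\<pi> \<omega>) A" for A
    using permutes_inj[OF permutes[OF \<omega>]] by (rule inj_on_subset) simp
  have split: "{1..n} = {1..<2 ^ q} \<union> {2 ^ q..n}" "{1..<2 ^ q} \<inter> {2 ^ q..n} = {}"
    using generation_bounds by (auto intro: order_trans[of 1 "2 ^ q"])
  have im: "?p ` {2 ^ q..n} = \<pi> \<omega> ` {2 ^ q..n}"
    using last_generation_subset by (intro image_cong) (auto simp: restrict_generation_def)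
  have "perm_sum X \<pi> f n \<omega> = (\<Sum>i\<in>{1..<2 ^ q}. ?g (\<pi> \<omega> i)) + (\<Sum>i\<in>{2 ^ q..n}. ?g (\<pi> \<omega> i))"
    unfolding perm_sum_def split(1) by (rule sum.union_disjoint) (use split(2) in auto)
  also have "\<dots> = (\<Sum>j\<in>{1..<2 ^ q}. ?g j) + (\<Sum>j\<in>?p ` {2 ^ q..n}. ?g j)"
    unfolding im using sum.reindex[OF inj, of ?g "{1..<2 ^ q}"] sum.reindex[OF inj, of ?g "{2 ^ q..n}"]
    by (simp only: image_tree[OF \<omega>] o_def)
  finally have "iexp (u * perm_sum X \<pi> f n \<omega>) = perm_phase u ?p \<omega>"
    unfolding perm_phase_def tree_phase_def
    by (simp add: exp_sum exp_add distrib_left sum_distrib_left)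
  also have "\<dots> = (\<Sum>p\<in>{?p}. perm_phase u p \<omega> * indicator (perm_event q p) \<omega>)"
    using \<omega> by (simp add: perm_event_def)
  also have "\<dots> = (\<Sum>p\<in>perms q. perm_phase u p \<omega> * indicator (perm_event q p) \<omega>)"
    using restrict_generation_in_perms[OF \<omega>]
    by (intro sum.mono_neutral_left) (auto simp: perm_event_def)
  finally show ?thesis .
qed

lemma expectation_iexp_perm_sum:
  "(\<integral>\<omega>. iexp (u * perm_sum X \<pi> f n \<omega>) \<partial>M) = (\<Sum>p\<in>perms q. \<integral>\<omega>. perm_phase u p \<omega> \<partial>M) / fact (2 ^ q)"
proof -
  have "(\<integral>\<omega>. iexp (u * perm_sum X \<pi> f n \<omega>) \<partial>M) =
      (\<integral>\<omega>. (\<Sum>p\<in>perms q. perm_phase u p \<omega> * indicator (perm_event q p) \<omega>) \<partial>M)"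
    by (rule Bochner_Integration.integral_cong[OF refl iexp_perm_sum])
  also have "\<dots> = (\<Sum>p\<in>perms q. \<integral>\<omega>. perm_phase u p \<omega> * indicator (perm_event q p) \<omega> \<partial>M)"
  proof (rule Bochner_Integration.integral_sum)
    fix p assume p: "p \<in> perms q"
    have "perm_event q p \<in> sets M"
      using perm_event_sigma_perm[OF p] subalgebra_perm by (auto simp: subalgebra_def)
    moreover have "perm_phase u p \<in> borel_measurable M"
      by (rule measurable_from_subalg[OF subalgebra_chain perm_phase_measurable[OF p]])
    ultimately show "integrable M (\<lambda>\<omega>. perm_phase u p \<omega> * indicator (perm_event q p) \<omega>)"
      using norm_perm_phase by (intro integrable_const_bound[of _ 1]) (auto simp: indicator_def)
  qed
  also have "\<dots> = (\<Sum>p\<in>perms q. (\<integral>\<omega>. perm_phase u p \<omega> \<partial>M) / fact (2 ^ q))"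
    by (intro sum.cong refl expectation_perm_event perm_phase_measurable norm_perm_phase)
  finally show ?thesis by (simp add: sum_divide_distrib)
qed

text \<open>Jensen's inequality is applied twice, under the chain and under the uniform choice of
  \<open>p\<close>. The resulting covariance sums fall under \<open>sum_permutations_le\<close>: the
  squares contribute order \<open>2 ^ q\<close>, negligible against \<open>4 ^ q\<close>, and the
  whole generation contributes its second moment.\<close>

lemma average_abs_last_generation_le:
  assumes C: "\<And>r. (\<Sum>j\<in>generation r. \<integral>\<omega>. (cond_variance_dev (X j \<omega>))\<^sup>2 \<partial>M) \<le> 2 ^ r * C"
  shows "(\<Sum>p\<in>perms q. \<integral>\<omega>. \<bar>\<Sum>j\<in>p ` {2 ^ q..n}. cond_variance_dev (X j \<omega>)\<bar> \<partial>M) / fact (2 ^ q) \<le>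
    sqrt (2 ^ q * C + second_moment cond_variance_dev q)"
proof -
  let ?L = "{2 ^ q..n}" and ?d = "\<lambda>j \<omega>. cond_variance_dev (X j \<omega>)"
  let ?e = "\<lambda>i j. \<integral>\<omega>. ?d i \<omega> * ?d j \<omega> \<partial>M"
  let ?a = "\<lambda>p. \<integral>\<omega>. \<bar>\<Sum>j\<in>p ` ?L. ?d j \<omega>\<bar> \<partial>M"
  have card: "real (card (perms q)) = fact (2 ^ q)"
    by (simp add: card_permutations[OF refl])
  have le: "(?a p)\<^sup>2 \<le> (\<Sum>i\<in>?L. \<Sum>j\<in>?L. ?e (p i) (p j))" if p: "p \<in> perms q" for p
  proof -
    have g: "1 \<le> p i" if "i \<in> ?L" for i
      using image_subset_generation[OF p] that generation_ge_1 by blast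
    have int: "integrable M (\<lambda>\<omega>. ?d (p i) \<omega> * ?d (p j) \<omega>)" if "i \<in> ?L" "j \<in> ?L" for i j
      by (rule integrable_vertex_mult[OF g g cond_variance_dev_H cond_variance_dev_H]) (use that in auto)
    have inj: "inj_on p ?L" using p by (auto intro: inj_on_subset[OF permutes_inj])
    have eq: "(\<Sum>j\<in>p ` ?L. ?d j \<omega>) = (\<Sum>i\<in>?L. ?d (p i) \<omega>)" for \<omega>
      by (simp add: sum.reindex[OF inj])
    have "(?a p)\<^sup>2 \<le> (\<integral>\<omega>. (\<Sum>i\<in>?L. ?d (p i) \<omega>)\<^sup>2 \<partial>M)"
      unfolding eq
    proof (rule expectation_abs_power2_le)
      show "integrable M (\<lambda>\<omega>. \<Sum>i\<in>?L. ?d (p i) \<omega>)"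
        by (intro Bochner_Integration.integrable_sum integrable_vertex cond_variance_dev_H g)
      show "integrable M (\<lambda>\<omega>. (\<Sum>i\<in>?L. ?d (p i) \<omega>)\<^sup>2)"
        unfolding power2_eq_square sum_product by (intro Bochner_Integration.integrable_sum int)
    qed
    also have "\<dots> = (\<Sum>i\<in>?L. \<Sum>j\<in>?L. ?e (p i) (p j))"
    proof -
      have "(\<integral>\<omega>. (\<Sum>i\<in>?L. ?d (p i) \<omega>)\<^sup>2 \<partial>M) = (\<Sum>i\<in>?L. \<integral>\<omega>. (\<Sum>j\<in>?L. ?d (p i) \<omega> * ?d (p j) \<omega>) \<partial>M)"
        unfolding power2_eq_square sum_product
        by (intro Bochner_Integration.integral_sum Bochner_Integration.integrable_sum int)
      also have "\<dots> = (\<Sum>i\<in>?L. \<Sum>j\<in>?L. ?e (p i) (p j))"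
        by (intro sum.cong refl Bochner_Integration.integral_sum int)
      finally show ?thesis .
    qed
    finally show ?thesis .
  qed
  \<comment> \<open>Cauchy-Schwarz over the permutations, of which there are
    \<open>fact (2 ^ q)\<close>.\<close>
  have "((\<Sum>p\<in>perms q. ?a p) / fact (2 ^ q))\<^sup>2 \<le> (fact (2 ^ q) * (\<Sum>p\<in>perms q. (?a p)\<^sup>2)) / (fact (2 ^ q))\<^sup>2"
    unfolding power_divide using sum_squared_le_sum_of_squares[of ?a "perms q"] card
    by (intro divide_right_mono) (auto simp: mult.commute)
  also have "\<dots> = (\<Sum>p\<in>perms q. (?a p)\<^sup>2) / fact (2 ^ q)"
    by (simp add: power2_eq_square)
  also have "\<dots> \<le> (\<Sum>p\<in>perms q. \<Sum>i\<in>?L. \<Sum>j\<in>?L. ?e (p i) (p j)) / fact (2 ^ q)"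
    by (intro divide_right_mono sum_mono le) auto
  also have "\<dots> \<le> (fact (card (generation q)) * ((\<Sum>i\<in>generation q. ?e i i) + (\<Sum>i\<in>generation q. \<Sum>j\<in>generation q. ?e i j))) / fact (2 ^ q)"
  proof (intro divide_right_mono sum_permutations_le last_generation_subset)
    \<comment> \<open>Individual covariances may be negative, but their total is an expected
      square.\<close>
    show "0 \<le> (\<Sum>i\<in>generation q. \<Sum>j\<in>generation q. ?e i j)"
      unfolding second_moment_eq[OF cond_variance_dev_H, symmetric] by (rule second_moment_nonneg)
    show "0 \<le> ?e i i" for i by (rule integral_nonneg_AE) auto
  qed auto
  also have "\<dots> = (\<Sum>i\<in>generation q. ?e i i) + second_moment cond_variance_dev q"
    unfolding second_moment_eq[OF cond_variance_dev_H] by simp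
  also have "\<dots> \<le> 2 ^ q * C + second_moment cond_variance_dev q"
    using C[of q] by (simp add: power2_eq_square)
  finally show ?thesis by (rule real_le_rsqrt)
qed

lemma characteristic_perm_sum_approx:
  assumes C: "\<And>r. (\<Sum>j\<in>generation r. \<integral>\<omega>. moments (X j \<omega>) \<partial>M) \<le> 2 ^ r * C"
    and C': "\<And>r. (\<Sum>j\<in>generation r. \<integral>\<omega>. (cond_variance_dev (X j \<omega>))\<^sup>2 \<partial>M) \<le> 2 ^ r * C'"
  shows "norm ((\<integral>\<omega>. iexp (u * perm_sum X \<pi> f n \<omega>) \<partial>M) - complex_of_real (exp (- (u\<^sup>2 * (real n * limit_variance) / 2)))) \<le>
    (\<bar>u\<bar> ^ 3 + u ^ 4) * (2 * 2 ^ q * C) +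
    u\<^sup>2 / 2 * ((\<Sum>s<q. sqrt (second_moment cond_variance_dev s)) + sqrt (2 ^ q * C' + second_moment cond_variance_dev q))"
proof -
  let ?c = "complex_of_real (exp (- (u\<^sup>2 * (real n * limit_variance) / 2)))"
  let ?E = "\<lambda>p. \<integral>\<omega>. perm_phase u p \<omega> \<partial>M"
  let ?A = "(\<bar>u\<bar> ^ 3 + u ^ 4) * (2 * 2 ^ q * C) + u\<^sup>2 / 2 * (\<Sum>s<q. sqrt (second_moment cond_variance_dev s))"
  let ?a = "\<lambda>p. \<integral>\<omega>. \<bar>\<Sum>j\<in>p ` {2 ^ q..n}. cond_variance_dev (X j \<omega>)\<bar> \<partial>M"
  have card: "card (perms q) = fact (2 ^ q)" by (simp add: card_permutations[OF refl])
  have each: "norm (?E p - ?c) \<le> ?A + u\<^sup>2 / 2 * ?a p" if p: "p \<in> perms q" for p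
  proof -
    have "inj_on p {2 ^ q..n}" using p by (auto intro: inj_on_subset[OF permutes_inj])
    \<comment> \<open>There are \<open>2 ^ q - 1\<close> vertices before generation \<open>q\<close>
      and \<open>n - 2 ^ q + 1\<close> sampled ones. The total is \<open>n\<close> for every
      \<open>p\<close>, so all permutations share the same Gaussian term and only the errors are
      averaged.\<close>
    then have "2 ^ q - 1 + card (p ` {2 ^ q..n}) = n"
      using generation_bounds by (simp add: card_image)
    then show ?thesis
      using partial_generation_phase_approx[OF C image_subset_generation[OF p], of u]
      unfolding perm_phase_def by (simp add: algebra_simps)
  qed
  have "(\<integral>\<omega>. iexp (u * perm_sum X \<pi> f n \<omega>) \<partial>M) - ?c = (\<Sum>p\<in>perms q. ?E p - ?c) / fact (2 ^ q)"
    unfolding expectation_iexp_perm_sum by (simp add: sum_subtractf card diff_divide_distrib)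
  also have "norm \<dots> = norm (\<Sum>p\<in>perms q. ?E p - ?c) / fact (2 ^ q)"
    by (simp add: norm_divide)
  also have "\<dots> \<le> (\<Sum>p\<in>perms q. ?A + u\<^sup>2 / 2 * ?a p) / fact (2 ^ q)"
    by (intro divide_right_mono sum_norm_le each) auto
  also have "\<dots> = ?A + u\<^sup>2 / 2 * ((\<Sum>p\<in>perms q. ?a p) / fact (2 ^ q))"
    by (simp add: sum.distrib card sum_distrib_left add_divide_distrib sum_divide_distrib)
  also have "\<dots> \<le> ?A + u\<^sup>2 / 2 * sqrt (2 ^ q * C' + second_moment cond_variance_dev q)"
    by (intro add_left_mono mult_left_mono average_abs_last_generation_le C') auto
  finally show ?thesis by (simp only: distrib_left add.assoc)
qed

end

section \<open>Passage to the limit\<close>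

lemma characteristic_perm_sum_tendsto:
  "(\<lambda>n. \<integral>\<omega>. iexp (t * (real n powr (- 1 / 2) * perm_sum X \<pi> f n \<omega>)) \<partial>M) \<longlonglongrightarrow>
    complex_of_real (exp (- (t\<^sup>2 * limit_variance / 2)))"
proof -
  obtain C where C: "0 \<le> C" "\<And>r. (\<Sum>j\<in>generation r. \<integral>\<omega>. moments (X j \<omega>) \<partial>M) \<le> 2 ^ r * C"
    using generation_sum_bound[OF moments_H] by blast
  obtain C' where C': "0 \<le> C'" "\<And>r. (\<Sum>j\<in>generation r. \<integral>\<omega>. (cond_variance_dev (X j \<omega>))\<^sup>2 \<partial>M) \<le> 2 ^ r * C'"
    using generation_sum_bound[OF admissible_power2[OF cond_variance_dev_H]] by auto
  \<comment> \<open>Normalised so that \<open>2 ^ s * b s\<close> is the root of the second moment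
    of generation \<open>s\<close>, and \<open>2 ^ q * d q\<close> is the whole deviation term of
    \<open>characteristic_perm_sum_approx\<close>.\<close>
  define b where "b s = sqrt (second_moment cond_variance_dev s / 4 ^ s)" for s
  define d where "d q = (\<Sum>s<q. 2 ^ s * b s) / 2 ^ q + sqrt (C' * (1 / 2) ^ q + second_moment cond_variance_dev q / 4 ^ q)" for q
  define u where "u n = t * real n powr (- 1 / 2)" for n
  have sm: "(\<lambda>r. second_moment cond_variance_dev r / 4 ^ r) \<longlonglongrightarrow> 0"
    by (rule second_moment_tendsto[OF cond_variance_dev_H integral_cond_variance_dev])
  have sqrt4: "sqrt (4 ^ s) = 2 ^ s" for s
    by (simp add: real_sqrt_power)
  have d0: "d \<longlonglongrightarrow> 0"
  proof -
    have "(\<lambda>q. (\<Sum>s<q. 2 ^ s * b s) / 2 ^ q) \<longlonglongrightarrow> 0"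
    proof (rule dyadic_average_tendsto_0)
      show "b \<longlonglongrightarrow> 0" using tendsto_real_sqrt[OF sm] unfolding b_def by simp
      show "0 \<le> b s" for s unfolding b_def using second_moment_nonneg[of cond_variance_dev s] by simp
    qed
    moreover have "(\<lambda>q. sqrt (C' * (1 / 2) ^ q + second_moment cond_variance_dev q / 4 ^ q)) \<longlonglongrightarrow> sqrt (C' * 0 + 0)"
      by (intro tendsto_intros sm LIMSEQ_power_zero) auto
    ultimately show ?thesis unfolding d_def by (auto intro: tendsto_add_zero)
  qed
  have log: "filterlim floor_log at_top sequentially"
    unfolding filterlim_at_top
  proof
    fix Z :: nat
    have "Z \<le> floor_log n" if "2 ^ Z \<le> n" for n
      using floor_log_le_iff[OF that] by simp
    then show "\<forall>\<^sub>F n in sequentially. Z \<le> floor_log n"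
      unfolding eventually_sequentially by blast
  qed
  have u0: "u \<longlonglongrightarrow> 0"
  proof -
    have "(\<lambda>n. real n powr (- 1 / 2)) \<longlonglongrightarrow> 0"
      by (rule tendsto_neg_powr) (auto intro: filterlim_real_sequentially)
    then show ?thesis unfolding u_def by (rule tendsto_mult_right_zero)
  qed
  have lim: "(\<lambda>n. (\<bar>u n\<bar> + (u n)\<^sup>2) * (2 * t\<^sup>2 * C) + t\<^sup>2 / 2 * d (floor_log n)) \<longlonglongrightarrow>
      (\<bar>0\<bar> + 0\<^sup>2) * (2 * t\<^sup>2 * C) + t\<^sup>2 / 2 * 0"
    by (intro tendsto_intros u0 filterlim_compose[OF d0 log])
  have bound: "norm ((\<integral>\<omega>. iexp (t * (real n powr (- 1 / 2) * perm_sum X \<pi> f n \<omega>)) \<partial>M) -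
      complex_of_real (exp (- (t\<^sup>2 * limit_variance / 2)))) \<le>
      (\<bar>u n\<bar> + (u n)\<^sup>2) * (2 * t\<^sup>2 * C) + t\<^sup>2 / 2 * d (floor_log n)" if n: "1 \<le> n" for n
  proof -
    define q where "q = floor_log n"
    have qn: "2 ^ q \<le> n" by (rule generation_bounds(1)[OF n q_def])
    then have qn': "(2 :: real) ^ q \<le> real n" by (metis of_nat_le_iff of_nat_numeral of_nat_power)
    have un: "(u n)\<^sup>2 * real n = t\<^sup>2"
    proof -
      have "(real n powr (- 1 / 2))\<^sup>2 = real n powr (- 1)"
        using n by (simp add: powr_power)
      also have "\<dots> = 1 / real n"
        using n by (simp add: powr_minus_divide)
      finally show ?thesis
        using n unfolding u_def power_mult_distrib by simp
    qed
    let ?T = "(\<Sum>s<q. sqrt (second_moment cond_variance_dev s)) + sqrt (2 ^ q * C' + second_moment cond_variance_dev q)"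
    have T: "?T = 2 ^ q * d q"
    proof -
      have "sqrt (second_moment cond_variance_dev s) = 2 ^ s * b s" for s
        unfolding b_def real_sqrt_divide sqrt4 by simp
      moreover have "sqrt (2 ^ q * C' + second_moment cond_variance_dev q) = 2 ^ q * sqrt (C' * (1 / 2) ^ q + second_moment cond_variance_dev q / 4 ^ q)"
      proof -
        have 4: "(4 :: real) ^ q = 2 ^ q * 2 ^ q" by (simp flip: power_mult_distrib)
        have "2 ^ q * C' + second_moment cond_variance_dev q = 4 ^ q * (C' * (1 / 2) ^ q + second_moment cond_variance_dev q / 4 ^ q)"
          by (simp add: 4 field_simps)
        then show ?thesis by (simp only: real_sqrt_mult sqrt4)
      qed
      ultimately show ?thesis by (simp add: d_def distrib_left)
    qed
    have dq: "0 \<le> d q"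
      unfolding d_def b_def using C'(1) second_moment_nonneg[of cond_variance_dev]
      by (intro add_nonneg_nonneg divide_nonneg_pos sum_nonneg mult_nonneg_nonneg real_sqrt_ge_zero) auto
    have "norm ((\<integral>\<omega>. iexp (u n * perm_sum X \<pi> f n \<omega>) \<partial>M) - complex_of_real (exp (- ((u n)\<^sup>2 * (real n * limit_variance) / 2)))) \<le>
        (\<bar>u n\<bar> ^ 3 + (u n) ^ 4) * (2 * 2 ^ q * C) + (u n)\<^sup>2 / 2 * ?T"
      by (rule characteristic_perm_sum_approx[OF n q_def C(2) C'(2)])
    \<comment> \<open>The scaling gives \<open>u^2 n = t^2\<close>, and
      \<open>2 ^ q \<le> n\<close>, so \<open>u^2\<close> absorbs the size of the last
      generation.\<close>
    also have "(u n)\<^sup>2 / 2 * ?T \<le> t\<^sup>2 / 2 * d q"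
    proof -
      have "(u n)\<^sup>2 / 2 * ?T = (u n)\<^sup>2 * 2 ^ q * (d q / 2)" unfolding T by simp
      also have "\<dots> \<le> (u n)\<^sup>2 * real n * (d q / 2)"
        using dq qn' by (intro mult_right_mono mult_left_mono) auto
      finally show ?thesis unfolding un by simp
    qed
    \<comment> \<open>Splitting off one \<open>u^2\<close> against \<open>2 ^ q\<close> leaves
      \<open>|u| + u^2\<close>, of order \<open>n^(-1/2)\<close>.\<close>
    also have "(\<bar>u n\<bar> ^ 3 + (u n) ^ 4) * (2 * 2 ^ q * C) \<le> (\<bar>u n\<bar> + (u n)\<^sup>2) * (2 * t\<^sup>2 * C)"
    proof -
      have "\<bar>u n\<bar> ^ 3 + (u n) ^ 4 = (\<bar>u n\<bar> + (u n)\<^sup>2) * (u n)\<^sup>2"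
        by (simp add: power3_eq_cube power4_eq_xxxx power2_eq_square distrib_right abs_mult_self_eq mult.assoc)
      then have "(\<bar>u n\<bar> ^ 3 + (u n) ^ 4) * (2 * 2 ^ q * C) = (\<bar>u n\<bar> + (u n)\<^sup>2) * (2 * ((u n)\<^sup>2 * 2 ^ q) * C)" by simp
      also have "\<dots> \<le> (\<bar>u n\<bar> + (u n)\<^sup>2) * (2 * ((u n)\<^sup>2 * real n) * C)"
        using C(1) qn' by (intro mult_left_mono mult_right_mono) auto
      finally show ?thesis unfolding un .
    qed
    finally show ?thesis
      by (simp add: u_def q_def un[unfolded u_def, symmetric] mult_ac)
  qed
  have "(\<lambda>n. (\<integral>\<omega>. iexp (t * (real n powr (- 1 / 2) * perm_sum X \<pi> f n \<omega>)) \<partial>M) -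
      complex_of_real (exp (- (t\<^sup>2 * limit_variance / 2)))) \<longlonglongrightarrow> 0"
  proof (rule Lim_null_comparison)
    show "\<forall>\<^sub>F n in sequentially. norm ((\<integral>\<omega>. iexp (t * (real n powr (- 1 / 2) * perm_sum X \<pi> f n \<omega>)) \<partial>M) -
        complex_of_real (exp (- (t\<^sup>2 * limit_variance / 2)))) \<le> (\<bar>u n\<bar> + (u n)\<^sup>2) * (2 * t\<^sup>2 * C) + t\<^sup>2 / 2 * d (floor_log n)"
      unfolding eventually_sequentially using bound by blast
  qed (use lim in simp)
  then show ?thesis by (rule LIM_zero_cancel)
qed

end

theorem theorem19:
  fixes M :: "'w measure"
    and F :: "nat \<Rightarrow> 'w measure"
    and \<nu> \<mu> :: "'a::metric_space measure"
    and P :: "'a \<Rightarrow> ('a \<times> 'a) measure"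
    and X :: "nat \<Rightarrow> 'w \<Rightarrow> 'a"
    and \<pi> :: "'w \<Rightarrow> nat \<Rightarrow> nat"
    and H :: "('a \<Rightarrow> real) set"
    and f :: "'a \<times> 'a \<times> 'a \<Rightarrow> real"
  assumes "bifurcating_markov_chain M F \<nu> P X"
    and "uniform_generation_permutation M \<pi>"
    and "independent_of_chain M X \<pi>"
    and "admissible P \<nu> \<mu> H"
    and "f \<in> borel_measurable (borel \<Otimes>\<^sub>M borel \<Otimes>\<^sub>M borel)"
    and "trans_exists3 P (\<lambda>w. (f w) ^ 2)" "trans_op3 P (\<lambda>w. (f w) ^ 2) \<in> H"
    and "trans_exists3 P (\<lambda>w. (f w) ^ 4)" "trans_op3 P (\<lambda>w. (f w) ^ 4) \<in> H"
    and "\<And>x. trans_op3 P f x = 0"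
  shows "weak_conv_m
           (\<lambda>n. distr M borel (\<lambda>\<omega>. real n powr (- 1 / 2) * perm_sum X \<pi> f n \<omega>))
           (gaussian_law 0 (\<integral>x. trans_op3 P (\<lambda>w. (f w) ^ 2) x \<partial>\<mu>))"
proof -
  interpret permuted_tree_sum M F \<nu> P X \<mu> H f \<pi>
    using assms by (intro permuted_tree_sum.intro centred_tree_sum.intro admissible_chain.intro
        admissible_chain_axioms.intro centred_tree_sum_axioms.intro permuted_tree_sum_axioms.intro)
  have rv: "(\<lambda>\<omega>. real n powr (- 1 / 2) * perm_sum X \<pi> f n \<omega>) \<in> borel_measurable M" for n
    using perm_sum_measurable[of n] by measurable
  have v: "(\<integral>x. trans_op3 P (\<lambda>w. (f w) ^ 2) x \<partial>\<mu>) = limit_variance"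
    by (simp add: limit_variance_def cond_variance_def)
  show ?thesis
    unfolding v
  proof (rule levy_continuity)
    show "real_distribution (distr M borel (\<lambda>\<omega>. real n powr (- 1 / 2) * perm_sum X \<pi> f n \<omega>))" for n
      by (rule real_distribution_distr[OF rv])
    show "real_distribution (gaussian_law 0 limit_variance)"
      by (rule real_distribution_gaussian_law[OF limit_variance_nonneg])
    show "(\<lambda>n. char (distr M borel (\<lambda>\<omega>. real n powr (- 1 / 2) * perm_sum X \<pi> f n \<omega>)) t)
        \<longlonglongrightarrow> char (gaussian_law 0 limit_variance) t" for t
    proof -
      have "char (distr M borel (\<lambda>\<omega>. real n powr (- 1 / 2) * perm_sum X \<pi> f n \<omega>)) t =
          (\<integral>\<omega>. iexp (t * (real n powr (- 1 / 2) * perm_sum X \<pi> f n \<omega>)) \<partial>M)" for n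
        unfolding char_def by (rule integral_distr[OF rv]) measurable
      then show ?thesis
        unfolding char_gaussian_law[OF limit_variance_nonneg] by (simp only: characteristic_perm_sum_tendsto)
    qed
  qed
qed

end
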